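(* For any finite or countably infinite concise set $\mathcal{L}\subseteq\mathbb{G}_d$, there is a weak mixing $\mathbb{R}^d$-action $T$ and a weak mixing $\mathbb{Z}^d$-action $S$ with the property that $\mathcal{L}=\mathcal{NE}_T=\mathcal{NW}_T=\mathcal{NE}_S=\mathcal{NW}_S$.
   Context: All actions are free measurable measure preserving actions on a Lebesgue probability space $(X,\mu)$. For an action $T=\{T^g\}_{g\in G}$ of a locally compact abelian group $G$, a nonzero $f\in L^2(X,\mu)$ is an eigenfunction if there is a continuous character $\gamma:G\to\{z\in\mathbb{C}:|z|=1\}$ with $f(T^gx)=\gamma(g)f(x)$ for all $g\in G$ and a.e. $x$, and is invariant if this holds with $\gamma\equiv1$. The action is ergodic (weak mixing) if the constant functions are the only invariant functions (eigenfunctions). For $0<e<d$, an $e$-dimensional linear subspace of $\mathbb{R}^d$ is called an $e$-dimensional direction, and $\mathbb{G}_{e,d}$ is the set of all $e$-dimensional directions. Put $\mathbb{G}_{0,d}=\{\vec 0\}$ (the zero subspace), $\mathbb{G}_{d,d}=\{\mathbb{R}^d\}$ and $\mathbb{G}_d=\bigcup_{e=0}^d\mathbb{G}_{e,d}$. A set of directions $\mathcal{L}\subseteq\mathbb{G}_d$ is concise if for all $L,L'\in\mathcal{L}$, $L\subseteq L'$ implies $L=L'$. A direction $L\in\mathbb{G}_d$ is subordinate to $\mathcal{L}\subseteq\mathbb{G}_d$ if $L\subseteq L'$ for some $L'\in\mathcal{L}$. Directional ergodicity and weak mixing are defined for $L\in\mathbb{G}_{e,d}$ with $1\le e\le d$,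 as follows. For an $\mathbb{R}^d$-action $T$: $T$ is ergodic (weak mixing) in the direction $L$ if the $L$-action $\{T^{\vec t}\}_{\vec t\in L}$ is ergodic (weak mixing). For a $\mathbb{Z}^d$-action $T$: let $\widetilde T$ be the unit suspension, i.e. the $\mathbb{R}^d$-action on $(\widetilde X,\tilde\mu)=(X\times[0,1)^d,\mu\times\lambda)$, $\lambda$ Lebesgue measure, given by $\widetilde T^{\vec t}(x,\vec r)=(T^{\lfloor\vec t+\vec r\rfloor}x,\{\vec t+\vec r\})$, where $\lfloor\cdot\rfloor$ is the componentwise floor and $\{\vec w\}=\vec w-\lfloor\vec w\rfloor$. Let $\mathcal{O}=\{F(x,\vec s)=f(\vec s): f\in L^2([0,1)^d,\lambda)\}$ and $L^2_{\mathcal{O}}(\widetilde X,\tilde\mu)=\mathcal{O}^\perp\subseteq L^2(\widetilde X,\tilde\mu)$. A nonzero $F\in L^2(\widetilde X,\tilde\mu)$ is a direction $L$ eigenfunction of $\widetilde T$ if for some $\vec\ell\in L$, $F(\widetilde T^{\vec t}y)=e^{2\pi i(\vec\ell\cdot\vec t)}F(y)$ for all $\vec t\in L$ and a.e. $y$, and is direction $L$ invariant if this holds with $\vec\ell=\vec 0$. Then $T$ is ergodic (weak mixing) in the direction $L$ if $\widetilde T$ has no nonzero direction $L$ invariant function (no nonzero direction $L$ eigenfunction) in $L^2_{\mathcal{O}}(\widetilde X,\tilde\mu)$. In both cases $\mathcal{E}_T\subseteq\mathbb{G}_d$ and $\mathcal{W}_T\subseteq\mathbb{G}_d$ denote the sets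 of ergodic and of weak mixing directions for $T$, and $\mathcal{E}_T^c$, $\mathcal{W}_T^c$ their complements, the sets of non-ergodic and non-weak mixing directions. For an ergodic $\mathbb{R}^d$- or $\mathbb{Z}^d$-action $T$, $\mathcal{NE}_T$ and $\mathcal{NW}_T$ denote the unique, at most countable, concise subsets of $\mathbb{G}_d$ such that $L\in\mathcal{E}_T^c$ if and only if $L$ is subordinate to $\mathcal{NE}_T$, and $L\in\mathcal{W}_T^c$ if and only if $L$ is subordinate to $\mathcal{NW}_T$.
   Formalization: The set of directions is assumed nonempty and not to contain R^d: the zero subspace is always a non-ergodic direction, so NE_T is never empty, and for a weak mixing T the direction R^d is weak mixing, so the set {R^d} cannot equal NW_T. *)

theory Defs
  imports "HOL-Probability.Probability"
begin

section \<open>Lebesgue probability spaces and their actions\<close>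

abbreviation unit_interval_space :: "real measure" where
  "unit_interval_space \<equiv> restrict_space lborel {0..1}"

text \<open>Isomorphic modulo null sets to the unit interval with Lebesgue measure. Atoms need not be
  allowed for: a free action of an infinite group preserving a probability measure forces
  the measure to be non-atomic. The reference space carries the Borel sets (not their
  completion), so that joint measurability of an action can be expressed with the ordinary
  product sigma-algebra.\<close>

definition lebesgue_prob_space :: "'x measure \<Rightarrow> bool" where
  "lebesgue_prob_space M \<longleftrightarrow> prob_space M \<and>
    (\<exists>A B f g. A \<in> sets M \<and> emeasure M A = 1 \<and>
       B \<in> sets unit_interval_space \<and> emeasure unit_interval_space B = 1 \<and>
       f \<in> restrict_space M A \<rightarrow>\<^sub>M restrict_space unit_interval_space B \<and>
       g \<in> restrict_space unit_interval_space B \<rightarrow>\<^sub>M restrict_space M A \<and>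
       (\<forall>x\<in>A. g (f x) = x) \<and> (\<forall>y\<in>B. f (g y) = y) \<and>
       distr (restrict_space M A) (restrict_space unit_interval_space B) f
         = restrict_space unit_interval_space B)"

definition free_mp_action ::
  "'x measure \<Rightarrow> ('g::{ab_group_add,topological_space} \<Rightarrow> 'x \<Rightarrow> 'x) \<Rightarrow> bool" where
  "free_mp_action M T \<longleftrightarrow>
     lebesgue_prob_space M \<and>
     (\<lambda>(g, x). T g x) \<in> borel \<Otimes>\<^sub>M M \<rightarrow>\<^sub>M M \<and>
     (\<forall>x\<in>space M. T 0 x = x) \<and>
     (\<forall>g h. \<forall>x\<in>space M. T (g + h) x = T g (T h x)) \<and>
     (\<forall>g. distr M M (T g) = M) \<and>
     (AE x in M. \<forall>g. T g x = x \<longrightarrow> g = 0)"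

section \<open>Eigenfunctions, ergodicity, weak mixing\<close>

text \<open>Functions stand for their classes modulo null sets; being nonzero is meant in this sense.\<close>

definition L2 :: "'x measure \<Rightarrow> ('x \<Rightarrow> complex) set" where
  "L2 M = {f \<in> borel_measurable M. integrable M (\<lambda>x. (cmod (f x))\<^sup>2)}"

definition nonzero_fun :: "'x measure \<Rightarrow> ('x \<Rightarrow> complex) \<Rightarrow> bool" where
  "nonzero_fun M f \<longleftrightarrow> \<not> (AE x in M. f x = 0)"

text \<open>Below, \<open>H\<close> is a subgroup of the acting group \<open>'g\<close>, with the subspace topology, and the
  action considered is the restriction of \<open>T\<close> to \<open>H\<close>. Only values on \<open>H\<close> matter.\<close>

definition character_on :: "'g::{ab_group_add,topological_space} set \<Rightarrow> ('g \<Rightarrow> complex) \<Rightarrow> bool" where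
  "character_on H \<gamma> \<longleftrightarrow> continuous_on H \<gamma> \<and> (\<forall>g\<in>H. cmod (\<gamma> g) = 1) \<and>
     (\<forall>g\<in>H. \<forall>h\<in>H. \<gamma> (g + h) = \<gamma> g * \<gamma> h)"

definition eigenfunction_on ::
  "'g::{ab_group_add,topological_space} set \<Rightarrow> 'x measure \<Rightarrow> ('g \<Rightarrow> 'x \<Rightarrow> 'x) \<Rightarrow> ('x \<Rightarrow> complex) \<Rightarrow> bool" where
  "eigenfunction_on H M T f \<longleftrightarrow> f \<in> L2 M \<and> nonzero_fun M f \<and>
     (\<exists>\<gamma>. character_on H \<gamma> \<and> (\<forall>g\<in>H. AE x in M. f (T g x) = \<gamma> g * f x))"

definition invariant_function_on ::
  "'g::{ab_group_add,topological_space} set \<Rightarrow> 'x measure \<Rightarrow> ('g \<Rightarrow> 'x \<Rightarrow> 'x) \<Rightarrow> ('x \<Rightarrow> complex) \<Rightarrow> bool" where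
  "invariant_function_on H M T f \<longleftrightarrow> f \<in> L2 M \<and> nonzero_fun M f \<and>
     (\<forall>g\<in>H. AE x in M. f (T g x) = f x)"

definition ae_constant :: "'x measure \<Rightarrow> ('x \<Rightarrow> complex) \<Rightarrow> bool" where
  "ae_constant M f \<longleftrightarrow> (\<exists>c. AE x in M. f x = c)"

definition ergodic_on ::
  "'g::{ab_group_add,topological_space} set \<Rightarrow> 'x measure \<Rightarrow> ('g \<Rightarrow> 'x \<Rightarrow> 'x) \<Rightarrow> bool" where
  "ergodic_on H M T \<longleftrightarrow> (\<forall>f. invariant_function_on H M T f \<longrightarrow> ae_constant M f)"

definition weak_mixing_on ::
  "'g::{ab_group_add,topological_space} set \<Rightarrow> 'x measure \<Rightarrow> ('g \<Rightarrow> 'x \<Rightarrow> 'x) \<Rightarrow> bool" where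
  "weak_mixing_on H M T \<longleftrightarrow> (\<forall>f. eigenfunction_on H M T f \<longrightarrow> ae_constant M f)"

section \<open>Directions\<close>

text \<open>The dimension \<open>d\<close> is \<open>CARD('d)\<close>.\<close>

definition directions_dim :: "nat \<Rightarrow> (real^'d) set set" where
  "directions_dim e = {L. subspace L \<and> dim L = e}"

definition directions :: "(real^'d) set set" where
  "directions = (\<Union>e\<in>{0..CARD('d)}. directions_dim e)"

definition concise :: "(real^'d) set set \<Rightarrow> bool" where
  "concise \<L> \<longleftrightarrow> (\<forall>L\<in>\<L>. \<forall>L'\<in>\<L>. L \<subseteq> L' \<longrightarrow> L = L')"

definition subordinate :: "(real^'d) set \<Rightarrow> (real^'d) set set \<Rightarrow> bool" where
  "subordinate L \<L> \<longleftrightarrow> (\<exists>L'\<in>\<L>. L \<subseteq> L')"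

text \<open>Directional properties are only defined in dimension at least 1, so the zero direction is
  neither ergodic nor weak mixing and lies in both complements.\<close>

definition ergodic_directions_R :: "'x measure \<Rightarrow> (real^'d \<Rightarrow> 'x \<Rightarrow> 'x) \<Rightarrow> (real^'d) set set" where
  "ergodic_directions_R M T = {L \<in> directions. 1 \<le> dim L \<and> ergodic_on L M T}"

definition weak_mixing_directions_R :: "'x measure \<Rightarrow> (real^'d \<Rightarrow> 'x \<Rightarrow> 'x) \<Rightarrow> (real^'d) set set" where
  "weak_mixing_directions_R M T = {L \<in> directions. 1 \<le> dim L \<and> weak_mixing_on L M T}"

section \<open>Unit suspension and directional properties of \<open>\<int>\<^sup>d\<close>-actions\<close>

definition unit_cube :: "(real^'d) measure" where
  "unit_cube = restrict_space lborel {r. \<forall>i. 0 \<le> r $ i \<and> r $ i < 1}"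

definition vec_floor :: "real^'d \<Rightarrow> int^'d" where
  "vec_floor v = (\<chi> i. \<lfloor>v $ i\<rfloor>)"

definition vec_frac :: "real^'d \<Rightarrow> real^'d" where
  "vec_frac v = (\<chi> i. frac (v $ i))"

definition suspension_space :: "'x measure \<Rightarrow> ('x \<times> (real^'d)) measure" where
  "suspension_space M = M \<Otimes>\<^sub>M unit_cube"

definition suspension :: "(int^'d \<Rightarrow> 'x \<Rightarrow> 'x) \<Rightarrow> real^'d \<Rightarrow> 'x \<times> (real^'d) \<Rightarrow> 'x \<times> (real^'d)" where
  "suspension T t = (\<lambda>(x, r). (T (vec_floor (t + r)) x, vec_frac (t + r)))"

definition L2_base :: "('x \<times> (real^'d) \<Rightarrow> complex) set" where
  "L2_base = {(\<lambda>(x, s). f s) | f. f \<in> L2 unit_cube}"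

definition L2_perp :: "'x measure \<Rightarrow> ('x \<times> (real^'d) \<Rightarrow> complex) set" where
  "L2_perp M = {F \<in> L2 (suspension_space M).
     \<forall>G\<in>L2_base. (LINT y|suspension_space M. F y * cnj (G y)) = 0}"

definition direction_eigenfunction ::
  "'x measure \<Rightarrow> (int^'d \<Rightarrow> 'x \<Rightarrow> 'x) \<Rightarrow> (real^'d) set \<Rightarrow> ('x \<times> (real^'d) \<Rightarrow> complex) \<Rightarrow> bool" where
  "direction_eigenfunction M T L F \<longleftrightarrow>
     F \<in> L2 (suspension_space M) \<and> nonzero_fun (suspension_space M) F \<and>
     (\<exists>l\<in>L. \<forall>t\<in>L. AE y in suspension_space M.
        F (suspension T t y) = exp (2 * of_real pi * \<i> * of_real (l \<bullet> t)) * F y)"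

definition direction_invariant ::
  "'x measure \<Rightarrow> (int^'d \<Rightarrow> 'x \<Rightarrow> 'x) \<Rightarrow> (real^'d) set \<Rightarrow> ('x \<times> (real^'d) \<Rightarrow> complex) \<Rightarrow> bool" where
  "direction_invariant M T L F \<longleftrightarrow>
     F \<in> L2 (suspension_space M) \<and> nonzero_fun (suspension_space M) F \<and>
     (\<forall>t\<in>L. AE y in suspension_space M. F (suspension T t y) = F y)"

definition ergodic_directions_Z :: "'x measure \<Rightarrow> (int^'d \<Rightarrow> 'x \<Rightarrow> 'x) \<Rightarrow> (real^'d) set set" where
  "ergodic_directions_Z M T =
     {L \<in> directions. 1 \<le> dim L \<and> \<not> (\<exists>F\<in>L2_perp M. direction_invariant M T L F)}"

definition weak_mixing_directions_Z :: "'x measure \<Rightarrow> (int^'d \<Rightarrow> 'x \<Rightarrow> 'x) \<Rightarrow> (real^'d) set set" where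
  "weak_mixing_directions_Z M T =
     {L \<in> directions. 1 \<le> dim L \<and> \<not> (\<exists>F\<in>L2_perp M. direction_eigenfunction M T L F)}"

section \<open>The sets \<open>NE\<close> and \<open>NW\<close>\<close>

text \<open>\<open>concise_generator \<D> \<N>\<close> is the defining property of the set \<open>\<N>\<close> attached to \<open>\<D>\<close>, the set of
  non-ergodic or of non-weak mixing directions. As \<open>\<N>\<close> is unique (lemma below), the four predicates
  after it say \<open>\<N> = NE\<^sub>T\<close> and \<open>\<N> = NW\<^sub>T\<close>; unlike an equation with a definite description, they also
  assert that \<open>NE\<^sub>T\<close> and \<open>NW\<^sub>T\<close> exist.\<close>

definition concise_generator :: "(real^'d) set set \<Rightarrow> (real^'d) set set \<Rightarrow> bool" where
  "concise_generator \<D> \<N> \<longleftrightarrow> \<N> \<subseteq> directions \<and> countable \<N> \<and> concise \<N> \<and>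
     (\<forall>L\<in>directions. L \<in> \<D> \<longleftrightarrow> subordinate L \<N>)"

lemma concise_generator_unique:
  assumes "concise_generator \<D> \<N>" "concise_generator \<D> \<N>'"
  shows "\<N> = \<N>'"
proof -
  have sub: "A \<subseteq> B" if A: "concise_generator \<D> A" and B: "concise_generator \<D> B" for A B
  proof
    fix L assume L: "L \<in> A"
    then have "L \<in> directions" "L \<in> \<D>"
      using A unfolding concise_generator_def subordinate_def by blast+
    then obtain L' where L': "L' \<in> B" "L \<subseteq> L'"
      using B unfolding concise_generator_def subordinate_def by blast
    then have "L' \<in> directions" "L' \<in> \<D>"
      using B unfolding concise_generator_def subordinate_def by blast+
    then obtain L'' where L'': "L'' \<in> A" "L' \<subseteq> L''"
      using A unfolding concise_generator_def subordinate_def by blast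
    then have "L = L''"
      using A L L' unfolding concise_generator_def concise_def by (meson order_trans)
    then show "L \<in> B" using L' L'' by auto
  qed
  show ?thesis using sub assms by blast
qed

definition is_NE_R :: "'x measure \<Rightarrow> (real^'d \<Rightarrow> 'x \<Rightarrow> 'x) \<Rightarrow> (real^'d) set set \<Rightarrow> bool" where
  "is_NE_R M T \<N> \<longleftrightarrow> concise_generator (directions - ergodic_directions_R M T) \<N>"

definition is_NW_R :: "'x measure \<Rightarrow> (real^'d \<Rightarrow> 'x \<Rightarrow> 'x) \<Rightarrow> (real^'d) set set \<Rightarrow> bool" where
  "is_NW_R M T \<N> \<longleftrightarrow> concise_generator (directions - weak_mixing_directions_R M T) \<N>"

definition is_NE_Z :: "'x measure \<Rightarrow> (int^'d \<Rightarrow> 'x \<Rightarrow> 'x) \<Rightarrow> (real^'d) set set \<Rightarrow> bool" where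
  "is_NE_Z M T \<N> \<longleftrightarrow> concise_generator (directions - ergodic_directions_Z M T) \<N>"

definition is_NW_Z :: "'x measure \<Rightarrow> (int^'d \<Rightarrow> 'x \<Rightarrow> 'x) \<Rightarrow> (real^'d) set set \<Rightarrow> bool" where
  "is_NW_Z M T \<N> \<longleftrightarrow> concise_generator (directions - weak_mixing_directions_Z M T) \<N>"

text \<open>Two degenerate concise sets cannot occur: the zero direction is never ergodic, so \<open>NE\<^sub>T\<close> is
  nonempty, and the full direction is weak mixing for a weak mixing action, so it is not in \<open>NW\<^sub>T\<close>.\<close>

lemma not_is_NE_R_empty:
  fixes T :: "real^'d \<Rightarrow> 'x \<Rightarrow> 'x"
  shows "\<not> is_NE_R M T {}"
proof -
  have "{0} \<in> (directions :: (real^'d) set set)"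
    by (auto simp: directions_def directions_dim_def)
  moreover have "{0} \<notin> ergodic_directions_R M T"
    by (simp add: ergodic_directions_R_def)
  ultimately show ?thesis
    by (auto simp: is_NE_R_def concise_generator_def subordinate_def)
qed

lemma weak_mixing_not_is_NW_R_UNIV:
  fixes T :: "real^'d \<Rightarrow> 'x \<Rightarrow> 'x"
  assumes "weak_mixing_on UNIV M T" "UNIV \<in> \<N>"
  shows "\<not> is_NW_R M T \<N>"
proof -
  have "UNIV \<in> (directions :: (real^'d) set set)" "1 \<le> dim (UNIV :: (real^'d) set)"
    by (auto simp: directions_def directions_dim_def Suc_le_eq)
  moreover from this have "UNIV \<in> weak_mixing_directions_R M T"
    using assms by (simp add: weak_mixing_directions_R_def)
  moreover have "subordinate UNIV \<N>"
    using assms(2) by (auto simp: subordinate_def)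
  ultimately show ?thesis
    unfolding is_NW_R_def concise_generator_def by blast
qed

end

theory Submission
  imports Defs
begin

text \<open>
  The action is a Poisson suspension. Enumerate the zero space together with the members of \<open>\<L>\<close> as
  \<open>\<Lambda> 0 = {0}, \<Lambda> 1, \<Lambda> 2, \<dots>\<close> and choose linear maps \<open>Q n\<close> of \<open>\<real>\<^sup>d\<close> with kernel \<open>\<Lambda> n\<close>. Points are triples of a layer
  \<open>n\<close>, a position in \<open>\<real>\<^sup>d\<close> and a real mark, and \<open>g\<close> moves the points of layer \<open>n\<close> by \<open>Q n g\<close>. This preserves the
  product of counting and Lebesgue measure, so the Poisson process with that intensity, a random closed
  set, is carried to a process with the same law, and \<open>T\<close> is the resulting action on configurations.
  The action \<open>S\<close> of the integers is the restriction of \<open>T\<close> to integer vectors.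

  Only void events are ever computed. The event that a configuration misses an open set \<open>U\<close> has
  probability \<open>exp (- intensity U)\<close>; missing \<open>U\<close> and missing \<open>W\<close> means missing \<open>U \<union> W\<close>. Hence these events are
  stable under intersection, determine the law, and are independent for disjoint sets.

  If a direction \<open>L\<close> lies in \<open>\<Lambda> n\<close>, then it fixes layer \<open>n\<close>, and the events concerning that layer are not
  trivial; so \<open>L\<close> is not ergodic (\<open>not_ergodic_R\<close>, \<open>direction_invariant_perp\<close>). If \<open>L\<close> lies in no \<open>\<Lambda> n\<close>, then by
  the Baire category theorem it contains a vector \<open>v\<close> outside all of them, and the multiples \<open>k v\<close> move every
  bounded part of every layer to infinity. Bounded parts of configurations then become exactly independent
  of their translates, which is a strong form of mixing along \<open>k v\<close> and rules out eigenfunctions.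
  The same holds with vectors at bounded distance from \<open>k v\<close>, depending on a parameter \<open>y\<close> on which a further
  system acts; there the conclusion is that eigenfunctions depend on \<open>y\<close> only
  (\<open>skew_eigenfunction_factors\<close>). With the integer part of \<open>k v\<close> this gives weak mixing of \<open>S\<close>. With the integer
  part of \<open>k v + y\<close> and \<open>y\<close> in the torus it concerns the unit suspension of \<open>S\<close>, and shows that there are no
  eigenfunctions orthogonal to the functions on the torus (\<open>direction_eigenfunction_not_perp\<close>).

  Layer 0 moves under every nonzero vector, and its marks, almost surely distinct, make the points
  recognisable; therefore the action is free (\<open>marks_distinct\<close>, \<open>free\<close>). To obtain a Lebesgue space, closed sets
  are coded by reals. The law of the code is the image of a Polish probability space under a Borel map,
  without atoms because the action is free, and such a law is isomorphic to the unit interval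
  (\<open>lebesgue_prob_space_distr\<close>).
\<close>

section \<open>Laws of Borel images of Polish spaces\<close>

lemma sigma_compact_full_subset:
  fixes M :: "'a::{second_countable_topology, complete_space} measure"
  assumes M: "prob_space M" "sets M = sets borel" and B: "B \<in> sets borel" "emeasure M B = 1"
  shows "\<exists>K :: nat \<Rightarrow> 'a set. (\<forall>n. compact (K n) \<and> K n \<subseteq> B) \<and> emeasure M (\<Union>n. K n) = 1"
proof -
  interpret prob_space M by fact
  have "\<exists>K. compact K \<and> K \<subseteq> B \<and> 1 - 1 / real (Suc n) < measure M K" for n
  proof -
    have "ennreal (1 - 1 / real (Suc n)) < emeasure M B"
      using B by (simp add: ennreal_less_one_iff)
    also have "emeasure M B = (SUP K \<in> {K. K \<subseteq> B \<and> compact K}. emeasure M K)"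
      by (rule inner_regular) (use M B in auto)
    finally show ?thesis
      by (auto simp: less_SUP_iff emeasure_eq_measure ennreal_less_iff)
  qed
  then obtain K where K: "compact (K n)" "K n \<subseteq> B" "1 - 1 / real (Suc n) < measure M (K n)" for n
    by metis
  have ms: "K n \<in> sets M" for n using K(1)[of n] M by (simp add: compact_imp_closed)
  have "1 - 1 / real (Suc n) \<le> measure M (\<Union>n. K n)" for n
    using K(3)[of n] finite_measure_mono[of "K n" "\<Union>n. K n"] ms by (smt (verit) UN_upper UNIV_I sets.countable_UN image_subset_iff)
  moreover have "(\<lambda>n. 1 - 1 / real (Suc n)) \<longlonglongrightarrow> 1 - 0"
    by (intro tendsto_intros LIMSEQ_Suc[OF lim_1_over_n])
  ultimately have "1 \<le> measure M (\<Union>n. K n)"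
    by (intro LIMSEQ_le_const2[of _ 1]) auto
  then have "measure M (\<Union>n. K n) = 1" using prob_le_1 by (meson antisym)
  then show ?thesis using K by (intro exI[of _ K]) (auto simp: emeasure_eq_measure)
qed

text \<open>The image of a Polish probability space under a Borel map need not be Borel, but it has a Borel
  subset of full measure. Inner regularity is applied to the graph of the map, where the projection
  to the image is continuous and therefore keeps compactness.\<close>

lemma sigma_compact_full_subset_of_image:
  fixes P :: "'a::{second_countable_topology, complete_space} measure"
    and h :: "'a \<Rightarrow> real"
  assumes P: "prob_space P" "sets P = sets borel" and h[measurable]: "h \<in> borel_measurable borel"
    and D[measurable]: "D \<in> sets borel" "emeasure P (h -` D) = 1"
  shows "\<exists>K :: nat \<Rightarrow> real set. (\<forall>n. compact (K n) \<and> K n \<subseteq> D \<and> K n \<subseteq> range h) \<and>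
    emeasure (distr P borel h) (\<Union>n. K n) = 1"
proof -
  interpret prob_space P by fact
  note [measurable_cong] = P(2)
  define g where "g = (\<lambda>x. (x, h x))"
  have g[measurable]: "g \<in> P \<rightarrow>\<^sub>M borel" unfolding g_def
    by (subst borel_prod[symmetric]) measurable
  have sp: "space P = UNIV" using P(2) sets_eq_imp_space_eq by fastforce
  \<comment> \<open>The graph of \<^term>\<open>h\<close> over \<^term>\<open>D\<close>: compact subsets of it project to compact subsets of the image.\<close>
  define G where "G = {z :: 'a \<times> real. h (fst z) = snd z \<and> snd z \<in> D}"
  have G: "G \<in> sets borel"
  proof -
    have "G = {z \<in> space (borel \<Otimes>\<^sub>M borel). h (fst z) = snd z \<and> snd z \<in> D}"
      by (auto simp: G_def space_pair_measure)
    also have "\<dots> \<in> sets (borel \<Otimes>\<^sub>M borel)" by measurable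
    finally show ?thesis by (simp only: borel_prod)
  qed
  have 1: "emeasure (distr P borel g) G = 1"
    using G D(2) by (subst emeasure_distr) (auto simp: G_def g_def sp vimage_def)
  obtain K :: "nat \<Rightarrow> ('a \<times> real) set"
    where K: "\<And>n. compact (K n)" "\<And>n. K n \<subseteq> G" "emeasure (distr P borel g) (\<Union>n. K n) = 1"
    using sigma_compact_full_subset[of "distr P borel g" G] prob_space_distr[OF g] G 1 by auto
  let ?K = "\<lambda>n. snd ` K n"
  have cK: "compact (?K n)" for n
    by (intro compact_continuous_image K(1)) (auto intro!: continuous_intros)
  have Ks: "(\<Union>n. K n) \<in> sets borel" "(\<Union>n. ?K n) \<in> sets borel"
    using K(1) cK by (intro sets.countable_UN image_subsetI borel_compact, simp)+
  have "1 = emeasure P (g -` (\<Union>n. K n))"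
    using K(3) Ks by (subst (asm) emeasure_distr) (auto simp: sp)
  also have "\<dots> \<le> emeasure P (h -` (\<Union>n. ?K n))"
  proof (rule emeasure_mono)
    show "g -` (\<Union>n. K n) \<subseteq> h -` (\<Union>n. ?K n)" by (force simp: g_def)
    show "h -` (\<Union>n. ?K n) \<in> sets P" using measurable_sets[OF h Ks(2)] P(2) by simp
  qed
  also have "\<dots> = emeasure (distr P borel h) (\<Union>n. ?K n)"
    using Ks by (subst emeasure_distr) (auto simp: sp)
  finally have "emeasure (distr P borel h) (\<Union>n. ?K n) \<ge> 1" .
  moreover have "emeasure (distr P borel h) (\<Union>n. ?K n) \<le> 1"
    using Ks by (subst emeasure_distr) (auto simp: emeasure_eq_measure)
  moreover have "?K n \<subseteq> D \<and> ?K n \<subseteq> range h" for n using K(2)[of n] by (force simp: G_def)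
  ultimately show ?thesis using cK by (intro exI[of _ ?K]) (auto intro: antisym)
qed

text \<open>Without atoms the distribution function is continuous, and it carries the measure to the uniform
  distribution.\<close>

lemma cdf_uniform:
  fixes R :: "real measure"
  assumes "real_distribution R" and na: "\<And>x. measure R {x} = 0"
  shows "distr R unit_interval_space (cdf R) = unit_interval_space"
    and "continuous_on UNIV (cdf R)"
    and "cdf R \<in> R \<rightarrow>\<^sub>M unit_interval_space"
proof -
  interpret real_distribution R by fact
  have "isCont (cdf R) x" for x using na isCont_cdf by simp
  then show cont: "continuous_on UNIV (cdf R)" by (simp add: continuous_at_imp_continuous_on)
  then have mb: "cdf R \<in> borel_measurable borel" by (rule borel_measurable_continuous_onI)
  have mR: "cdf R \<in> borel_measurable R" by (rule measurable_finite_borel[OF mb])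
  show mu: "cdf R \<in> R \<rightarrow>\<^sub>M unit_interval_space"
    by (intro measurable_restrict_space2) (use mR in \<open>auto simp: cdf_nonneg cdf_bounded_prob\<close>)
  have su: "sets unit_interval_space \<subseteq> sets borel" by (auto simp: sets_restrict_space)
  have pu: "prob_space unit_interval_space"
    by (rule prob_spaceI) (simp add: emeasure_restrict_space space_restrict_space)
  have emb: "(\<lambda>x. x) \<in> unit_interval_space \<rightarrow>\<^sub>M borel"
    by (rule measurable_restrict_space1) simp
  have rd1: "real_distribution (distr R borel (cdf R))" using mR by simp
  have rd2: "real_distribution (distr unit_interval_space borel (\<lambda>x. x))"
    using prob_space.real_distribution_distr[OF pu emb] .
  have eq: "distr R borel (cdf R) = distr unit_interval_space borel (\<lambda>x. x)"
  proof (rule cdf_unique[OF rd1 rd2], rule ext)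
    fix t :: real
    have L: "cdf (distr R borel (cdf R)) t = measure R {x. cdf R x \<le> t}"
      using mR by (simp add: cdf_def measure_distr vimage_def)
    have "cdf (distr unit_interval_space borel (\<lambda>x. x)) t = measure unit_interval_space ({0..1} \<inter> {..t})"
      using emb by (simp add: cdf_def measure_distr space_restrict_space Int_commute)
    also have "\<dots> = measure lborel ({0..1} \<inter> {..t})"
      by (subst measure_restrict_space) auto
    also have "{0..1} \<inter> {..t} = {0..min 1 t}" by auto
    also have "measure lborel {0..min 1 t} = max 0 (min 1 t)" by auto
    finally have Rt: "cdf (distr unit_interval_space borel (\<lambda>x. x)) t = max 0 (min 1 t)" .
    consider "t \<ge> 1" | "t < 0" | "0 \<le> t" "t < 1" by linarith
    then have "measure R {x. cdf R x \<le> t} = max 0 (min 1 t)"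
    proof cases
      case 1
      then have "{x. cdf R x \<le> t} = UNIV" using cdf_bounded_prob by (auto intro: order_trans)
      then show ?thesis using 1 prob_space by simp
    next
      case 2
      then have "{x. cdf R x \<le> t} = {}" using cdf_nonneg by (auto simp: not_le intro: less_le_trans)
      then show ?thesis using 2 by simp
    next
      case 3
      have *: "\<exists>y. cdf R y = s" if s: "0 < s" "s < 1" for s
      proof -
        have "eventually (\<lambda>y. cdf R y < s) at_bot" using order_tendstoD(2)[OF cdf_lim_at_bot s(1)] .
        then obtain a where a: "cdf R a < s" by (auto simp: eventually_at_bot_linorder)
        have "eventually (\<lambda>y. s < cdf R y) at_top"
          using order_tendstoD(1)[OF cdf_lim_at_top_prob s(2)] .
        then obtain b where b: "s < cdf R b" by (auto simp: eventually_at_top_linorder)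
        have "a \<le> b" using a b cdf_nondecreasing[of b a] by (meson linear not_le order_less_trans)
        then show ?thesis using IVT'[of "cdf R" a s b] a b cont
          by (metis continuous_on_subset less_imp_le top_greatest)
      qed
      show ?thesis
      proof (rule antisym)
        have "t \<le> measure R {x. cdf R x \<le> t}"
        proof (cases "t = 0")
          case False
          then obtain y where y: "cdf R y = t" using *[of t] 3 by auto
          have "{x \<in> space R. cdf R x \<le> t} \<in> sets R" using mR by measurable
          moreover have "cdf R x \<le> t" if "x \<le> y" for x using cdf_nondecreasing[OF that] y by simp
          ultimately have "measure R {..y} \<le> measure R {x. cdf R x \<le> t}"
            by (intro finite_measure_mono) auto
          then show ?thesis using y by (simp add: cdf_def)
        qed simp
        then show "max 0 (min 1 t) \<le> measure R {x. cdf R x \<le> t}" using 3 by simp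
        \<comment> \<open>The value \<open>t = 0\<close> need not be attained, so the upper bound is approached through larger values.\<close>
        have "measure R {x. cdf R x \<le> t} \<le> s" if "t < s" for s
        proof (cases "s < 1")
          case True
          then obtain z where z: "cdf R z = s" using *[of s] 3 \<open>t < s\<close> by auto
          have "x \<le> z" if "cdf R x \<le> t" for x
            using that \<open>t < s\<close> z cdf_nondecreasing[of z x] by linarith
          then have "measure R {x. cdf R x \<le> t} \<le> cdf R z"
            unfolding cdf_def by (intro finite_measure_mono) auto
          then show ?thesis using z by simp
        qed (use prob_le_1 in \<open>auto intro: order_trans\<close>)
        then have "measure R {x. cdf R x \<le> t} \<le> t" by (rule dense_ge)
        then show "measure R {x. cdf R x \<le> t} \<le> max 0 (min 1 t)" using 3 by simp
      qed
    qed
    then show "cdf (distr R borel (cdf R)) t = cdf (distr unit_interval_space borel (\<lambda>x. x)) t"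
      using L Rt by simp
  qed
  show "distr R unit_interval_space (cdf R) = unit_interval_space"
  proof (rule measure_eqI)
    fix A assume "A \<in> sets (distr R unit_interval_space (cdf R))"
    then have A: "A \<in> sets unit_interval_space" by simp
    then have Ab: "A \<in> sets borel" "A \<subseteq> {0..1}" using su by (auto simp: sets_restrict_space)
    have "emeasure (distr R unit_interval_space (cdf R)) A = emeasure (distr R borel (cdf R)) A"
      using A Ab mR mu by (simp add: emeasure_distr)
    also have "\<dots> = emeasure unit_interval_space A"
      using eq A Ab emb by (simp add: emeasure_distr space_restrict_space Int_absorb2)
    finally show "emeasure (distr R unit_interval_space (cdf R)) A = emeasure unit_interval_space A" .
  qed simp
qed

text \<open>The isomorphism with the unit interval is the distribution function, restricted to a
  \<open>\<sigma>\<close>-compact set of full measure on which it is injective; since it is continuous, images of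
  closed parts of that set are again \<open>\<sigma>\<close>-compact, which makes the inverse measurable. The carrier \<open>X\<close> is an
  arbitrary superset of the range, such as the set of all codes of closed sets.\<close>

lemma lebesgue_prob_space_distr:
  fixes P :: "'a::{second_countable_topology, complete_space} measure"
    and h :: "'a \<Rightarrow> real"
  assumes P: "prob_space P" "sets P = sets borel" and h: "h \<in> borel_measurable borel"
    and X: "range h \<subseteq> X"
    and na: "\<And>y. y \<in> X \<Longrightarrow> emeasure (distr P (restrict_space borel X) h) {y} = 0"
  shows "lebesgue_prob_space (distr P (restrict_space borel X) h)"
proof -
  interpret P: prob_space P by fact
  define M where "M = distr P (restrict_space borel X) h"
  define R where "R = distr P borel h"
  have sp: "space P = UNIV" using P(2) sets_eq_imp_space_eq by fastforce
  have hP: "h \<in> borel_measurable P" using h P(2) by (simp cong: measurable_cong_sets)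
  have hX: "h \<in> P \<rightarrow>\<^sub>M restrict_space borel X"
    using X by (intro measurable_restrict_space2 hP) auto
  have pM: "prob_space M" unfolding M_def by (rule P.prob_space_distr[OF hX])
  have rd: "real_distribution R" unfolding R_def using hP by simp
  interpret R: real_distribution R by fact
  have setsM: "A \<in> sets M \<longleftrightarrow> (\<exists>B\<in>sets borel. A = X \<inter> B)" for A
    by (auto simp: M_def sets_restrict_space)
  have em: "emeasure M (X \<inter> B) = emeasure R B" if "B \<in> sets borel" for B
    using that hX hP X unfolding M_def R_def
    by (subst (1 2) emeasure_distr) (auto simp: sets_restrict_space sp intro!: arg_cong2[where f=emeasure])
  have naR: "measure R {x} = 0" for x
  proof (cases "x \<in> X")
    case True
    then have "emeasure R {x} = 0" using na[OF True] em[of "{x}"] by (simp add: M_def)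
    then show ?thesis by (simp add: measure_def)
  next
    case False
    then have "h -` {x} = {}" using X by auto
    then show ?thesis unfolding R_def using hP by (simp add: measure_distr)
  qed
  let ?F = "cdf R" and ?I = unit_interval_space
  note F = cdf_uniform[OF rd naR]
  have Fb: "?F \<in> borel_measurable borel" using F(2) by (rule borel_measurable_continuous_onI)
  have su: "sets ?I \<subseteq> sets borel" by (auto simp: sets_restrict_space)
  have emI: "emeasure ?I A = emeasure R (?F -` A)" if "A \<in> sets ?I" for A
    using that F(3) by (subst F(1)[symmetric]) (simp add: emeasure_distr)
  \<comment> \<open>Two points with the same value of the distribution function have a rational point between
    them with that value, so the function is injective off this null set.\<close>
  define N where "N = (\<Union>q\<in>\<rat>. {x. ?F x = ?F q})"
  have flat: "{x. ?F x = c} \<in> null_sets R" for c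
  proof -
    have m: "{x. ?F x = c} \<in> sets R" using Fb by simp
    show ?thesis
    proof (cases "c \<in> {0..1}")
      case True
      then have c: "{c} \<in> sets ?I" by (auto simp: sets_restrict_space image_iff intro!: bexI[of _ "{c}"])
      have "emeasure R {x. ?F x = c} = emeasure ?I {c}" using emI[OF c] by (simp add: vimage_def)
      also have "\<dots> = 0" using True by (subst emeasure_restrict_space) auto
      finally show ?thesis using m by auto
    next
      case False
      then have "{x. ?F x = c} = {}" using R.cdf_nonneg R.cdf_bounded_prob by auto
      then show ?thesis by simp
    qed
  qed
  have N: "N \<in> null_sets R" unfolding N_def using flat countable_rat by (intro null_sets_UN') auto
  then have Nb: "N \<in> sets borel" by auto
  have "emeasure R (- N) = 1"
    using N R.emeasure_eq_1_AE[of "-N"] AE_not_in[OF N] Nb by auto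
  then have "emeasure P (h -` (- N)) = 1" unfolding R_def
    using Nb hP by (subst (asm) emeasure_distr) (auto simp: sp vimage_def)
  then have "\<exists>K :: nat \<Rightarrow> real set. (\<forall>n. compact (K n) \<and> K n \<subseteq> - N \<and> K n \<subseteq> range h) \<and>
      emeasure R (\<Union>n. K n) = 1"
    unfolding R_def using Nb by (intro sigma_compact_full_subset_of_image[OF P h]) auto
  then obtain K :: "nat \<Rightarrow> real set"
    where K: "\<And>n. compact (K n)" "\<And>n. K n \<subseteq> - N" "\<And>n. K n \<subseteq> range h"
    "emeasure R (\<Union>n. K n) = 1" by blast
  define A where "A = (\<Union>n. K n)"
  define B where "B = ?F ` A"
  have AX: "A \<subseteq> X" using K(3) X by (auto simp: A_def)
  have img: "?F ` (A \<inter> C) \<in> sets ?I" if "closed C" for C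
  proof -
    have "?F ` (A \<inter> C) = (\<Union>n. ?F ` (K n \<inter> C))" by (auto simp: A_def)
    moreover have "compact (?F ` (K n \<inter> C))" for n
      by (rule compact_continuous_image) (use F(2) K(1) that in \<open>auto intro: continuous_on_subset compact_Int_closed\<close>)
    ultimately have "?F ` (A \<inter> C) \<in> sets borel"
      by (simp only:, intro sets.countable_UN image_subsetI borel_compact)
    moreover have "?F ` (A \<inter> C) \<subseteq> {0..1}" using R.cdf_nonneg R.cdf_bounded_prob by auto
    ultimately show ?thesis by (auto simp: sets_restrict_space image_iff intro!: bexI[of _ "?F ` (A \<inter> C)"])
  qed
  have inj: "inj_on ?F A"
  proof -
    have *: False if "x \<in> A" "y \<in> A" "x < y" "?F x = ?F y" for x y
    proof -
      obtain q where q: "q \<in> \<rat>" "x < q" "q < y" using Rats_dense_in_real[OF \<open>x < y\<close>] by auto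
      have "?F q = ?F x" using R.cdf_nondecreasing[of x q] R.cdf_nondecreasing[of q y] q that by auto
      then have "x \<in> N" using q by (auto simp: N_def intro!: bexI[of _ q])
      then show False using that K(2) by (auto simp: A_def)
    qed
    show ?thesis by (rule inj_onI) (metis * linorder_less_linear)
  qed
  have Ab: "A \<in> sets borel" unfolding A_def using K(1)
    by (intro sets.countable_UN image_subsetI borel_compact) auto
  have AM: "A \<in> sets M" using AX Ab setsM by blast
  have BI: "B \<in> sets ?I" using img[of UNIV] by (simp add: B_def)
  have eA: "emeasure M A = 1" using em[OF Ab] K(4) AX by (simp add: A_def Int_absorb1)
  have eB: "emeasure ?I B = 1"
  proof (rule antisym)
    have "1 = emeasure R A" using K(4) by (simp add: A_def)
    also have "\<dots> \<le> emeasure R (?F -` B)"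
      using BI su Fb measurable_sets[OF Fb, of B] by (intro emeasure_mono) (auto simp: B_def)
    finally show "1 \<le> emeasure ?I B" using emI[OF BI] by simp
    show "emeasure ?I B \<le> 1" using emI[OF BI] R.emeasure_le_1 by simp
  qed
  define g where "g = the_inv_into A ?F"
  have gF: "g (?F x) = x" if "x \<in> A" for x using that inj by (simp add: g_def the_inv_into_f_f)
  have Fg: "?F (g y) = y" if "y \<in> B" for y using that gF by (auto simp: B_def)
  have MR: "restrict_space M A = restrict_space R A"
  proof (rule measure_eqI)
    have "sets (restrict_space M A) = (\<inter>) A ` sets M" by (simp add: sets_restrict_space)
    also have "\<dots> = (\<inter>) A ` sets borel"
    proof
      show "(\<inter>) A ` sets M \<subseteq> (\<inter>) A ` sets borel"
      proof
        fix C assume "C \<in> (\<inter>) A ` sets M"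
        then obtain D where D: "D \<in> sets M" "C = A \<inter> D" by (elim imageE)
        obtain B where B: "B \<in> sets borel" "D = X \<inter> B"
          using iffD1[OF setsM D(1)] by (elim bexE)
        then have "B \<in> sets borel" "C = A \<inter> B" using AX D(2) by (simp, simp only: Int_assoc[symmetric] Int_absorb2)
        then show "C \<in> (\<inter>) A ` sets borel" by blast
      qed
      show "(\<inter>) A ` sets borel \<subseteq> (\<inter>) A ` sets M"
      proof
        fix C assume "C \<in> (\<inter>) A ` sets borel"
        then obtain B where B: "C = A \<inter> B" "B \<in> sets borel" by (elim imageE)
        have "C = A \<inter> (X \<inter> B)" using AX B(1) by (simp only: Int_assoc[symmetric] Int_absorb2)
        moreover have "X \<inter> B \<in> sets M" by (rule iffD2[OF setsM]) (use B(2) in blast)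
        ultimately show "C \<in> (\<inter>) A ` sets M" by (intro image_eqI)
      qed
    qed
    finally show "sets (restrict_space M A) = sets (restrict_space R A)" by (simp add: sets_restrict_space)
    fix C assume "C \<in> sets (restrict_space M A)"
    then obtain D where D: "C = A \<inter> D" "D \<in> sets M" by (auto simp: sets_restrict_space)
    then obtain B' where B': "B' \<in> sets borel" "D = X \<inter> B'" using setsM by auto
    then have C: "C = X \<inter> (A \<inter> B')" "C = A \<inter> B'" using D AX by auto
    have "emeasure (restrict_space M A) C = emeasure M C"
      using D AM by (subst emeasure_restrict_space) auto
    also have "\<dots> = emeasure R (A \<inter> B')" using em[of "A \<inter> B'"] C B' Ab by simp
    also have "\<dots> = emeasure (restrict_space R A) C"
      using C Ab by (subst emeasure_restrict_space) auto
    finally show "emeasure (restrict_space M A) C = emeasure (restrict_space R A) C" .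
  qed
  have fm: "?F \<in> restrict_space M A \<rightarrow>\<^sub>M restrict_space ?I B"
    unfolding MR by (intro measurable_restrict_space2 measurable_restrict_space1 F(3))
      (auto simp: B_def space_restrict_space)
  have gm: "g \<in> restrict_space ?I B \<rightarrow>\<^sub>M restrict_space M A"
    unfolding MR
  proof (intro measurable_restrict_space2)
    have BI1: "B \<subseteq> {0..1}" using BI by (auto simp: sets_restrict_space)
    then show "g \<in> space (restrict_space ?I B) \<rightarrow> A"
      using gF by (auto simp: B_def space_restrict_space)
    have "g \<in> restrict_space ?I B \<rightarrow>\<^sub>M borel"
      unfolding borel_eq_closed
    proof (rule measurable_measure_of)
      fix C :: "real set" assume "C \<in> Collect closed"
      then have C: "closed C" by simp
      have "g -` C \<inter> space (restrict_space ?I B) = ?F ` (A \<inter> C)"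
        using BI1 gF by (auto simp: B_def space_restrict_space image_iff)
      also have "\<dots> = B \<inter> ?F ` (A \<inter> C)" by (auto simp: B_def)
      finally show "g -` C \<inter> space (restrict_space ?I B) \<in> sets (restrict_space ?I B)"
        using img[OF C] by (auto simp: sets_restrict_space[of ?I B])
    qed auto
    then show "g \<in> restrict_space ?I B \<rightarrow>\<^sub>M R" by (simp cong: measurable_cong_sets)
  qed
  have dist: "distr (restrict_space M A) (restrict_space ?I B) ?F = restrict_space ?I B"
  proof (rule measure_eqI)
    fix C assume "C \<in> sets (distr (restrict_space M A) (restrict_space ?I B) ?F)"
    then have C: "C \<in> sets (restrict_space ?I B)" by simp
    have "B \<inter> space ?I \<in> sets ?I" using BI by (intro sets.Int sets.top)
    with C have C': "C \<in> sets ?I" "C \<subseteq> B" by (simp_all only: sets_restrict_space_iff)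
    have m: "?F -` C \<in> sets R" using C' su measurable_sets[OF Fb, of C] by auto
    have "emeasure (distr (restrict_space M A) (restrict_space ?I B) ?F) C
      = emeasure (restrict_space R A) (?F -` C \<inter> A)"
      using C fm MR by (simp add: emeasure_distr space_restrict_space)
    also have "\<dots> = emeasure R (?F -` C \<inter> A)" using Ab by (subst emeasure_restrict_space) auto
    also have "\<dots> = emeasure R (?F -` C)"
    proof (rule emeasure_eq_AE)
      show "AE x in R. (x \<in> ?F -` C \<inter> A) = (x \<in> ?F -` C)"
      proof -
        have "AE x in R. x \<in> A"
          using R.AE_in_set_eq_1[of A] K(4) Ab by (simp add: A_def[symmetric] measure_def)
        then show ?thesis by eventually_elim simp
      qed
    qed (use m Ab in auto)
    also have "\<dots> = emeasure ?I C" using emI C' by simp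
    also have "\<dots> = emeasure (restrict_space ?I B) C" 
      by (rule emeasure_restrict_space[symmetric, OF sets.Int[OF BI sets.top] C'(2)])
    finally show "emeasure (distr (restrict_space M A) (restrict_space ?I B) ?F) C
      = emeasure (restrict_space ?I B) C" .
  qed simp
  show ?thesis
    unfolding lebesgue_prob_space_def M_def[symmetric]
    using pM AM eA BI eB fm gm gF Fg dist by (intro conjI exI[of _ A] exI[of _ B] exI[of _ ?F] exI[of _ g]) auto
qed

section \<open>Closed sets coded by real numbers\<close>

definition basic_open :: "nat \<Rightarrow> 'e::second_countable_topology set" where
  "basic_open = from_nat_into (SOME B. countable B \<and> topological_basis B)"

lemma basic_open_basis: "topological_basis (range (basic_open :: nat \<Rightarrow> 'e::second_countable_topology set))"
proof -
  let ?B = "SOME B :: 'e set set. countable B \<and> topological_basis B"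
  have B: "countable ?B \<and> topological_basis ?B" by (rule someI_ex) (rule ex_countable_basis)
  have "?B \<noteq> {}"
  proof
    assume "?B = {}"
    then have "topological_basis ({} :: 'e set set)" using B by simp
    then show False using topological_basisE[of "{} :: 'e set set" UNIV undefined] by auto
  qed
  then have "range (basic_open :: nat \<Rightarrow> 'e set) = ?B" using B by (simp add: basic_open_def range_from_nat_into)
  then show ?thesis using B by simp
qed

lemma open_basic_open: "open (basic_open i)"
  using topological_basis_open[OF basic_open_basis] by auto

lemma basic_open_cover:
  assumes "open U" "x \<in> U"
  shows "\<exists>i. x \<in> basic_open i \<and> basic_open i \<subseteq> U"
  using topological_basisE[OF basic_open_basis assms] by blast

text \<open>Base three with digits 0 and 1: digit \<open>i\<close> tells whether the set hits the basic open set \<open>basic_open i\<close>.\<close>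

definition encode :: "'e::second_countable_topology set \<Rightarrow> real" where
  "encode A = (\<Sum>i. of_bool (A \<inter> basic_open i \<noteq> {}) / 3 ^ i)"

definition nonzero_digit :: "nat \<Rightarrow> real \<Rightarrow> bool" where
  "nonzero_digit i y \<longleftrightarrow> \<lfloor>3 ^ i * y\<rfloor> mod 3 \<noteq> 0"

text \<open>The complement of the basic open sets that are not hit; inverse to \<open>encode\<close> on closed sets.\<close>

definition decode :: "real \<Rightarrow> 'e::second_countable_topology set" where
  "decode y = - (\<Union>i\<in>{i. \<not> nonzero_digit i y}. basic_open i)"

definition codes :: "'e::second_countable_topology itself \<Rightarrow> real set" where
  "codes _ = encode ` {A :: 'e set. closed A}"

lemma summable_ternary: "summable (\<lambda>i. of_bool (a i) / 3 ^ i :: real)"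
proof (rule summable_comparison_test')
  show "summable (\<lambda>i. (1 / 3 :: real) ^ i)" by (rule summable_geometric) simp
  show "norm (of_bool (a i) / 3 ^ i :: real) \<le> (1 / 3) ^ i" for i by (simp add: power_one_over)
qed

text \<open>Only the digits 0 and 1 are used, in base three, so no carry can occur and the digits can be read
  off with the floor function.\<close>

lemma nonzero_digit_ternary_sum: "nonzero_digit i (\<Sum>j. of_bool (a j) / 3 ^ j) \<longleftrightarrow> a i"
proof -
  define N :: int where "N = (\<Sum>j<i. of_bool (a j) * 3 ^ (i - j - 1))"
  define \<rho> :: real where "\<rho> = (\<Sum>k. of_bool (a (k + Suc i)) / 3 ^ Suc k)"
  have sm: "summable (\<lambda>k. of_bool (a (k + Suc i)) / 3 ^ Suc k :: real)"
    using summable_mult[OF summable_ternary[of "\<lambda>k. a (k + Suc i)"], of "1/3"] by simp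
  have "\<rho> \<le> (\<Sum>k. (1 / 3) * (1 / 3) ^ k)" unfolding \<rho>_def
    by (intro suminf_le sm summable_mult summable_geometric) (auto simp: power_one_over)
  also have "\<dots> = (1 / 3) * (1 / (1 - 1 / 3))"
    by (subst suminf_mult) (auto intro: summable_geometric simp: suminf_geometric)
  finally have \<rho>1: "\<rho> < 1" by simp
  have \<rho>0: "0 \<le> \<rho>" unfolding \<rho>_def by (intro suminf_nonneg sm) auto
  have "(\<Sum>j. of_bool (a j) / 3 ^ j :: real)
     = (\<Sum>k. of_bool (a (k + Suc i)) / 3 ^ (k + Suc i)) + (\<Sum>j<Suc i. of_bool (a j) / 3 ^ j)"
    by (rule suminf_split_initial_segment[OF summable_ternary])
  also have "(\<Sum>k. of_bool (a (k + Suc i)) / 3 ^ (k + Suc i) :: real) = \<rho> / 3 ^ i"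
    unfolding \<rho>_def by (subst suminf_divide[OF sm, symmetric]) (simp add: power_add mult.assoc)
  finally have "3 ^ i * (\<Sum>j. of_bool (a j) / 3 ^ j :: real)
     = \<rho> + of_bool (a i) + (\<Sum>j<i. 3 ^ i * (of_bool (a j) / 3 ^ j))"
    by (simp add: distrib_left sum_distrib_left)
  also have "(\<Sum>j<i. 3 ^ i * (of_bool (a j) / 3 ^ j) :: real) = of_int (3 * N)"
  proof -
    have "3 ^ i * (of_bool (a j) / 3 ^ j :: real) = 3 * (of_bool (a j) * 3 ^ (i - j - 1))" if "j < i" for j
    proof -
      have "i = Suc (i - j - 1) + j" using that by simp
      then have "(3::real) ^ i = 3 * 3 ^ (i - j - 1) * 3 ^ j" by (metis power_add power_Suc)
      then show ?thesis by simp
    qed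
    then have "(\<Sum>j<i. 3 ^ i * (of_bool (a j) / 3 ^ j) :: real) = (\<Sum>j<i. 3 * (of_bool (a j) * 3 ^ (i - j - 1)))"
      by (intro sum.cong) auto
    then show ?thesis by (simp add: N_def sum_distrib_left del: sum_mult_of_bool_eq sum_of_bool_mult_eq)
  qed
  \<comment> \<open>A multiple of three, plus the digit, plus a remainder that is at most one half.\<close>
  finally have e: "3 ^ i * (\<Sum>j. of_bool (a j) / 3 ^ j :: real) = of_int (3 * N + of_bool (a i)) + \<rho>" by simp
  have fl: "\<lfloor>3 ^ i * (\<Sum>j. of_bool (a j) / 3 ^ j :: real)\<rfloor> = 3 * N + of_bool (a i)"
    by (rule floor_unique) (use e \<rho>0 \<rho>1 in linarith)+
  show ?thesis unfolding nonzero_digit_def fl by (cases "a i") auto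
qed

lemma nonzero_digit_encode: "nonzero_digit i (encode A) \<longleftrightarrow> A \<inter> basic_open i \<noteq> {}"
  unfolding encode_def by (rule nonzero_digit_ternary_sum)

lemma decode_encode: "closed A \<Longrightarrow> decode (encode A) = A"
proof -
  assume A: "closed A"
  have "- A = (\<Union>i\<in>{i. A \<inter> basic_open i = {}}. basic_open i)"
    using basic_open_cover[of "- A"] A by (auto simp: open_Compl) blast
  then show ?thesis by (auto simp: decode_def nonzero_digit_encode)
qed

lemma closed_decode: "closed (decode y)"
  unfolding decode_def by (intro closed_Compl open_UN ballI open_basic_open)

lemma encode_decode: "y \<in> codes TYPE('e::second_countable_topology) \<Longrightarrow> encode (decode y :: 'e set) = y"
  by (auto simp: codes_def decode_encode)

lemma encode_in_codes: "closed (A :: 'e::second_countable_topology set) \<Longrightarrow> encode A \<in> codes TYPE('e)"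
  by (auto simp: codes_def)

lemma nonzero_digit_iff_hit:
  assumes "y \<in> codes TYPE('e::second_countable_topology)"
  shows "nonzero_digit i y \<longleftrightarrow> (decode y :: 'e set) \<inter> basic_open i \<noteq> {}"
  using nonzero_digit_encode[of i "decode y :: 'e set"] encode_decode[OF assms] by simp

lemma nonzero_digit_borel[measurable]: "Measurable.pred borel (nonzero_digit i)"
  unfolding nonzero_digit_def by measurable

lemma void_decode_iff:
  assumes "y \<in> codes TYPE('e::second_countable_topology)" "open U"
  shows "(decode y :: 'e set) \<inter> U = {} \<longleftrightarrow> (\<forall>i. basic_open i \<subseteq> U \<longrightarrow> \<not> nonzero_digit i y)"
  unfolding nonzero_digit_iff_hit[OF assms(1)] using basic_open_cover[OF assms(2)] by blast

lemma void_decode_sets: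
  assumes "open (U :: 'e::second_countable_topology set)"
  shows "{y \<in> codes TYPE('e). decode y \<inter> U = {}} \<in> sets (restrict_space borel (codes TYPE('e)))"
proof -
  have "{y \<in> codes TYPE('e). decode y \<inter> U = {}} = codes TYPE('e) \<inter> {y. \<forall>i. basic_open i \<subseteq> U \<longrightarrow> \<not> nonzero_digit i y}"
    using void_decode_iff[OF _ assms] by auto
  moreover have "{y. \<forall>i. basic_open i \<subseteq> U \<longrightarrow> \<not> nonzero_digit i y} \<in> sets borel" by measurable
  ultimately show ?thesis by (auto simp: sets_restrict_space)
qed

text \<open>The code is a measurable function of the events that the set misses a basic open set, and these
  events are countable intersections of those for open sets inside the windows \<open>W N\<close>.\<close>

lemma sets_codes_eq_sigma_sets:
  fixes W :: "nat \<Rightarrow> 'e::second_countable_topology set"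
  assumes W: "\<And>N. open (W N)" "(\<Union>N. W N) = UNIV"
  shows "sets (restrict_space borel (codes TYPE('e)))
    = sigma_sets (codes TYPE('e)) {{y \<in> codes TYPE('e). decode y \<inter> U = {}} | U :: 'e set. open U \<and> (\<exists>N. U \<subseteq> W N)}"
    (is "_ = sigma_sets ?X ?G")
proof
  have G: "?G \<subseteq> Pow ?X" by auto
  show "sigma_sets ?X ?G \<subseteq> sets (restrict_space borel ?X)"
    using void_decode_sets sets.sigma_sets_subset[of ?G "restrict_space borel ?X"]
    by (auto simp: space_restrict_space)
  let ?S = "sigma ?X ?G"
  have m: "{y \<in> ?X. decode y \<inter> basic_open i = ({} :: 'e set)} \<in> sets ?S" for i
  proof -
    have "{y \<in> ?X. decode y \<inter> basic_open i = ({} :: 'e set)} = (\<Inter>N. {y \<in> ?X. decode y \<inter> (basic_open i \<inter> W N) = ({} :: 'e set)})"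
      using W(2) by auto
    also have "\<dots> \<in> sets ?S"
    proof (rule sets.countable_INT'[OF _ _ image_subsetI])
      fix N
      have "{y \<in> ?X. decode y \<inter> (basic_open i \<inter> W N) = ({} :: 'e set)} \<in> ?G"
        using W(1) open_basic_open by (intro CollectI exI[of _ "basic_open i \<inter> W N"]) auto
      then show "{y \<in> ?X. decode y \<inter> (basic_open i \<inter> W N) = ({} :: 'e set)} \<in> sets ?S"
        using G by simp
    qed auto
    finally show ?thesis .
  qed
  have "(\<lambda>y. \<Sum>i. of_bool (decode y \<inter> basic_open i \<noteq> ({} :: 'e set)) / 3 ^ i :: real) \<in> borel_measurable ?S"
  proof (intro borel_measurable_suminf borel_measurable_divide borel_measurable_const)
    fix i
    have sp: "space ?S = ?X" using G by (simp add: space_measure_of)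
    have "{y \<in> space ?S. \<not> (decode y \<inter> basic_open i \<noteq> ({} :: 'e set))} \<in> sets ?S"
      using m[of i] sp by simp
    then have "Measurable.pred ?S (\<lambda>y. decode y \<inter> basic_open i \<noteq> ({} :: 'e set))"
      by (simp add: pred_def)
    then show "(\<lambda>y. of_bool (decode y \<inter> basic_open i \<noteq> ({} :: 'e set)) :: real) \<in> borel_measurable ?S"
      by (rule measurable_compose) simp
  qed
  then have "(\<lambda>y. encode (decode y :: 'e set)) \<in> borel_measurable ?S" by (simp add: encode_def)
  then have id: "(\<lambda>y. y) \<in> borel_measurable ?S"
    using G encode_decode[where 'e='e] by (subst measurable_cong[where g="\<lambda>y. encode (decode y :: 'e set)"]) (auto simp: space_measure_of)
  show "sets (restrict_space borel ?X) \<subseteq> sigma_sets ?X ?G"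
  proof
    fix C assume "C \<in> sets (restrict_space borel ?X)"
    then obtain B where B: "B \<in> sets borel" "C = ?X \<inter> B" by (auto simp: sets_restrict_space)
    have "(\<lambda>y. y) -` B \<inter> space ?S \<in> sets ?S" by (rule measurable_sets[OF id B(1)])
    then show "C \<in> sigma_sets ?X ?G" using B(2) G by (simp add: space_measure_of Int_commute)
  qed
qed

text \<open>A set and its closure hit the same open sets.\<close>

lemma measurable_encode_closure:
  fixes cfg :: "'w \<Rightarrow> 'e::second_countable_topology set"
  assumes "\<And>U. open U \<Longrightarrow> {w \<in> space N. cfg w \<inter> U = {}} \<in> sets N"
  shows "(\<lambda>w. encode (closure (cfg w))) \<in> borel_measurable N"
  unfolding encode_def
proof (intro borel_measurable_suminf borel_measurable_divide borel_measurable_const)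
  fix i
  have eq: "closure (cfg w) \<inter> basic_open i = {} \<longleftrightarrow> cfg w \<inter> basic_open i = {}" for w
    using open_Int_closure_eq_empty[OF open_basic_open[of i], of "cfg w"] by (simp add: Int_commute)
  have "{w \<in> space N. \<not> (closure (cfg w) \<inter> basic_open i \<noteq> {})} \<in> sets N"
    using assms[OF open_basic_open[of i]] by (simp add: eq)
  then have "Measurable.pred N (\<lambda>w. closure (cfg w) \<inter> basic_open i \<noteq> {})"
    by (simp add: pred_def)
  then show "(\<lambda>w. of_bool (closure (cfg w) \<inter> basic_open i \<noteq> {}) :: real) \<in> borel_measurable N"
    by (rule measurable_compose) simp
qed

text \<open>A closed set moved by \<open>g\<close> hits an open set \<open>U\<close> iff it has a point \<open>e\<close> with \<open>(g, e)\<close> in the open set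
  of pairs moved into \<open>U\<close>. Covering that set by countably many open boxes separates \<open>g\<close> from the set.\<close>

lemma coded_action_measurable:
  fixes \<tau> :: "'g::second_countable_topology \<Rightarrow> 'e::second_countable_topology \<Rightarrow> 'e"
  assumes cont: "\<And>U. open U \<Longrightarrow> open {(g, e). \<tau> g e \<in> U}"
    and cl: "\<And>g A. closed A \<Longrightarrow> closed (\<tau> g ` A)"
    and M: "sets M = sets (restrict_space borel (codes TYPE('e)))"
  shows "(\<lambda>(g, y). encode (\<tau> g ` decode y)) \<in> borel \<Otimes>\<^sub>M M \<rightarrow>\<^sub>M M"
proof -
  let ?X = "codes TYPE('e)"
  have sp: "space M = ?X" using sets_eq_imp_space_eq[OF M] by (simp add: space_restrict_space)
  have hit: "{y \<in> ?X. nonzero_digit k y} \<in> sets M" for k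
  proof -
    have "{y \<in> ?X. nonzero_digit k y} = ?X \<inter> {y. nonzero_digit k y}" by auto
    moreover have "{y. nonzero_digit k y} \<in> sets borel" by measurable
    ultimately show ?thesis unfolding M by (auto simp: sets_restrict_space)
  qed
  have "{z \<in> space (borel \<Otimes>\<^sub>M M). \<tau> (fst z) ` decode (snd z) \<inter> basic_open i \<noteq> {}} \<in> sets (borel \<Otimes>\<^sub>M M)" for i
  proof -
    \<comment> \<open>The preimage of the basic open set under the action is open, hence a countable union of boxes.\<close>
    define J where "J = {(j, k). basic_open j \<times> basic_open k \<subseteq> {(g, e). \<tau> g e \<in> basic_open i}}"
    have "{z \<in> space (borel \<Otimes>\<^sub>M M). \<tau> (fst z) ` decode (snd z) \<inter> basic_open i \<noteq> {}}
        = (\<Union>(j, k)\<in>J. basic_open j \<times> {y \<in> ?X. nonzero_digit k y})"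
    proof (intro set_eqI iffI)
      fix z :: "'g \<times> real" assume "z \<in> {z \<in> space (borel \<Otimes>\<^sub>M M). \<tau> (fst z) ` decode (snd z) \<inter> basic_open i \<noteq> {}}"
      then obtain g :: 'g and y and e :: 'e where z: "z = (g, y)" "y \<in> ?X" "e \<in> decode y" "\<tau> g e \<in> basic_open i"
        by (cases z) (auto simp: space_pair_measure sp)
      have "open {(g, e). \<tau> g e \<in> basic_open i}" by (rule cont[OF open_basic_open])
      then obtain A B where AB: "open A" "open B" "(g, e) \<in> A \<times> B" "A \<times> B \<subseteq> {(g, e). \<tau> g e \<in> basic_open i}"
        using z(4) by (elim open_prod_elim[where x="(g, e)"]) auto
      obtain j where j: "g \<in> basic_open j" "basic_open j \<subseteq> A" using basic_open_cover[OF AB(1)] AB(3) by blast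
      obtain k where k: "e \<in> basic_open k" "basic_open k \<subseteq> B" using basic_open_cover[OF AB(2)] AB(3) by blast
      have "(j, k) \<in> J" using j k AB(4) unfolding J_def by blast
      moreover have "nonzero_digit k y" using nonzero_digit_iff_hit[OF z(2), of k] z(3) k(1) by blast
      ultimately show "z \<in> (\<Union>(j, k)\<in>J. basic_open j \<times> {y \<in> ?X. nonzero_digit k y})" using z(1,2) j(1) by blast
    next
      fix z :: "'g \<times> real" assume "z \<in> (\<Union>(j, k)\<in>J. basic_open j \<times> {y \<in> ?X. nonzero_digit k y})"
      then obtain j k and g :: 'g and y where z: "z = (g, y)" "(j, k) \<in> J" "g \<in> basic_open j" "y \<in> ?X" "nonzero_digit k y" by blast
      obtain e :: 'e where e: "e \<in> decode y" "e \<in> basic_open k" using nonzero_digit_iff_hit[OF z(4), of k] z(5) by blast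
      have "\<tau> g e \<in> basic_open i" using z(2,3) e(2) unfolding J_def by blast
      then show "z \<in> {z \<in> space (borel \<Otimes>\<^sub>M M). \<tau> (fst z) ` decode (snd z) \<inter> basic_open i \<noteq> {}}"
        using z e by (auto simp: space_pair_measure sp)
    qed
    also have "\<dots> \<in> sets (borel \<Otimes>\<^sub>M M)"
      by (rule sets.countable_UN') (auto intro!: pair_measureI hit borel_open open_basic_open)
    finally show ?thesis .
  qed
  then have "(\<lambda>z. \<Sum>i. of_bool (\<tau> (fst z) ` decode (snd z) \<inter> basic_open i \<noteq> {}) / 3 ^ i :: real) \<in> borel_measurable (borel \<Otimes>\<^sub>M M)"
    by (intro borel_measurable_suminf borel_measurable_divide borel_measurable_const
        measurable_compose[OF _ measurable_of_bool]) (simp add: pred_def)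
  then have "(\<lambda>z. encode (\<tau> (fst z) ` decode (snd z))) \<in> borel_measurable (borel \<Otimes>\<^sub>M M)"
    by (simp add: encode_def)
  then have "(\<lambda>z. encode (\<tau> (fst z) ` decode (snd z))) \<in> borel \<Otimes>\<^sub>M M \<rightarrow>\<^sub>M restrict_space borel ?X"
    by (intro measurable_restrict_space2) (auto intro!: encode_in_codes cl closed_decode)
  then show ?thesis unfolding split_beta' by (subst measurable_cong_sets[OF refl M])
qed

section \<open>Poisson clouds and their void probabilities\<close>

lemma void_event_borel:
  fixes U :: "'p::second_countable_topology set"
  assumes U: "U \<in> sets borel"
  shows "{c :: real \<times> (nat \<Rightarrow> 'p). \<forall>i. real i < fst c \<longrightarrow> snd c i \<notin> U} \<in> sets borel"
proof -
  have mc: "(\<lambda>c::real \<times> (nat \<Rightarrow> 'p). snd c i) \<in> borel_measurable borel" for i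
    by (intro borel_measurable_continuous_onI continuous_intros continuous_on_product_then_coordinatewise)
  have "closed {c :: real \<times> (nat \<Rightarrow> 'p). fst c \<le> real i}" for i
    by (intro closed_Collect_le continuous_intros)
  moreover have "(\<lambda>c::real \<times> (nat \<Rightarrow> 'p). snd c i) -` (- U) \<in> sets borel" for i
    using measurable_sets[OF mc, of "- U"] U by simp
  ultimately have "(\<Inter>i. {c :: real \<times> (nat \<Rightarrow> 'p). fst c \<le> real i} \<union> (\<lambda>c. snd c i) -` (- U)) \<in> sets borel"
    by (intro sets.countable_INT'' sets.Un) (auto intro: borel_closed)
  also have "(\<Inter>i. {c :: real \<times> (nat \<Rightarrow> 'p). fst c \<le> real i} \<union> (\<lambda>c. snd c i) -` (- U))
    = {c. \<forall>i. real i < fst c \<longrightarrow> snd c i \<notin> U}" by (auto simp: not_less) (meson not_less)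
  finally show ?thesis .
qed

text \<open>A Poisson number of independent points distributed according to the normalised \<open>\<nu>\<close>. The configuration is kept as the pair of the number
  of points and an infinite sequence, of which only the first terms count; the number is a real so that
  the sample space is a complete metric space. The probability that no point falls into a set is the
  generating function of the Poisson law.\<close>

lemma poisson_void_finite:
  fixes \<nu> :: "'p::second_countable_topology measure"
  assumes "finite_measure \<nu>" and \<nu>: "sets \<nu> = sets borel"
  shows "\<exists>Q :: (real \<times> (nat \<Rightarrow> 'p)) measure. prob_space Q \<and> sets Q = sets borel \<and>
    (\<forall>U\<in>sets borel. measure Q {c. \<forall>i. real i < fst c \<longrightarrow> snd c i \<notin> U} = exp (- measure \<nu> U))"
proof -
  interpret finite_measure \<nu> by fact
  have sp: "space \<nu> = UNIV" using \<nu> sets_eq_imp_space_eq by fastforce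
  define r where "r = measure \<nu> UNIV"
  show ?thesis
  proof (cases "r = 0")
    case True
    \<comment> \<open>Intensity zero: the configuration is empty.\<close>
    define Q :: "(real \<times> (nat \<Rightarrow> 'p)) measure" where "Q = return borel (0, undefined)"
    interpret Q: prob_space Q unfolding Q_def by (rule prob_space_return) simp
    have "measure Q {c. \<forall>i. real i < fst c \<longrightarrow> snd c i \<notin> U} = exp (- measure \<nu> U)"
      if U: "U \<in> sets borel" for U
    proof -
      have 0: "measure \<nu> U = 0"
        using True finite_measure_mono[of U UNIV] sp \<nu> U measure_nonneg[of \<nu> U]
        by (simp add: r_def sets.top[of \<nu>, simplified sp])
      show ?thesis using 0 void_event_borel[OF U] by (simp add: Q_def measure_return)
    qed
    then show ?thesis using Q.prob_space_axioms by (intro exI[of _ Q]) (simp add: Q_def)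
  next
    case False
    then have r: "r > 0" by (simp add: r_def zero_less_measure_iff)
    define \<kappa> where "\<kappa> = uniform_measure \<nu> UNIV"
    have e0: "emeasure \<nu> UNIV \<noteq> 0" "emeasure \<nu> UNIV \<noteq> \<infinity>"
      using False by (auto simp: r_def measure_def)
    interpret \<kappa>: prob_space \<kappa> unfolding \<kappa>_def by (rule prob_space_uniform_measure[OF e0])
    have \<kappa>s[measurable_cong]: "sets \<kappa> = sets borel" by (simp add: \<kappa>_def \<nu>)
    have UN: "UNIV \<in> sets \<nu>" using sets.top[of \<nu>] sp by simp
    have m\<kappa>: "measure \<kappa> U = measure \<nu> U / r" if "U \<in> sets borel" for U
      using that UN \<nu> by (simp add: \<kappa>_def r_def measure_uniform_measure[OF e0])
    define K where "K = Pi\<^sub>M (UNIV :: nat set) (\<lambda>_. \<kappa>)"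
    interpret K: product_prob_space "\<lambda>_. \<kappa>" "UNIV :: nat set" ..
    interpret KP: prob_space K unfolding K_def by (rule prob_space_PiM) (rule \<kappa>.prob_space_axioms)
    have Ks: "sets K = sets borel"
    proof -
      have "sets K = sets (Pi\<^sub>M (UNIV :: nat set) (\<lambda>_. borel :: 'p measure))"
        unfolding K_def by (intro sets_PiM_cong refl \<kappa>s)
      then show ?thesis by (simp add: sets_PiM_equal_borel)
    qed
    let ?N = "measure_pmf (poisson_pmf r)"
    define h where "h = (\<lambda>z. (real (fst z), snd z) :: real \<times> (nat \<Rightarrow> 'p))"
    have h[measurable]: "h \<in> ?N \<Otimes>\<^sub>M K \<rightarrow>\<^sub>M borel"
    proof -
      have "h \<in> ?N \<Otimes>\<^sub>M K \<rightarrow>\<^sub>M borel \<Otimes>\<^sub>M borel"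
        unfolding h_def
      proof (rule measurable_Pair)
        show "(\<lambda>x. snd x) \<in> ?N \<Otimes>\<^sub>M K \<rightarrow>\<^sub>M borel"
          using measurable_snd[of ?N K] measurable_cong_sets[OF refl Ks, of "?N \<Otimes>\<^sub>M K"] by simp
      qed measurable
      then show ?thesis by (simp add: borel_prod)
    qed
    have pNK: "prob_space (?N \<Otimes>\<^sub>M K)"
      by (rule prob_space_pair) (unfold_locales)
    define Q where "Q = distr (?N \<Otimes>\<^sub>M K) borel h"
    have pQ: "prob_space Q" unfolding Q_def by (rule prob_space.prob_space_distr[OF pNK h])
    have "measure Q {c. \<forall>i. real i < fst c \<longrightarrow> snd c i \<notin> U} = exp (- measure \<nu> U)"
      if U[measurable]: "U \<in> sets borel" for U
    proof -
      have E: "{c :: real \<times> (nat \<Rightarrow> 'p). \<forall>i. real i < fst c \<longrightarrow> snd c i \<notin> U} \<in> sets borel" (is "?E \<in> _")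
        by (rule void_event_borel[OF U])
      define q where "q = measure \<kappa> (- U)"
      have q: "q = 1 - measure \<nu> U / r"
        using \<kappa>.prob_compl[of U] m\<kappa>[OF U] \<kappa>s sets_eq_imp_space_eq[OF \<kappa>s] by (simp add: q_def Compl_eq_Diff_UNIV)
      have q0: "0 \<le> q" by (simp add: q_def)
      have one: "emeasure K (Pair n -` (h -` ?E \<inter> space (?N \<Otimes>\<^sub>M K))) = ennreal (q ^ n)" for n
      proof -
        have "Pair n -` (h -` ?E \<inter> space (?N \<Otimes>\<^sub>M K)) = {x \<in> space K. \<forall>i\<in>{..<n}. x i \<in> - U}"
          by (auto simp: h_def space_pair_measure)
        also have "emeasure K \<dots> = (\<Prod>i<n. emeasure \<kappa> (- U))"
          unfolding K_def by (rule K.emeasure_PiM_Collect) auto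
        also have "\<dots> = ennreal (q ^ n)"
          using q0 by (simp add: \<kappa>.emeasure_eq_measure q_def[symmetric] ennreal_power)
        finally show ?thesis .
      qed
      have sums: "(\<lambda>n. (r ^ n / fact n * exp (- r)) * q ^ n) sums (exp (r * q) * exp (- r))"
      proof -
        have "(\<lambda>n. (r * q) ^ n /\<^sub>R fact n * exp (- r)) sums (exp (r * q) * exp (- r))"
          by (intro sums_mult2 exp_converges)
        then show ?thesis by (simp add: power_mult_distrib field_simps scaleR_conv_of_real)
      qed
      have "emeasure Q ?E = emeasure (?N \<Otimes>\<^sub>M K) (h -` ?E \<inter> space (?N \<Otimes>\<^sub>M K))"
        unfolding Q_def using E by (intro emeasure_distr h) simp
      also have "\<dots> = (\<integral>\<^sup>+n. emeasure K (Pair n -` (h -` ?E \<inter> space (?N \<Otimes>\<^sub>M K))) \<partial>?N)"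
        by (rule KP.emeasure_pair_measure_alt) (rule measurable_sets[OF h E])
      also have "\<dots> = (\<integral>\<^sup>+n. ennreal (q ^ n) \<partial>?N)" by (simp only: one)
      also have "\<dots> = (\<integral>\<^sup>+n. ennreal (pmf (poisson_pmf r) n) * ennreal (q ^ n) \<partial>count_space UNIV)"
        by (rule nn_integral_measure_pmf)
      also have "\<dots> = (\<Sum>n. ennreal ((r ^ n / fact n * exp (- r)) * q ^ n))"
        by (simp add: nn_integral_count_space_nat r q0 ennreal_mult''[symmetric])
      also have "\<dots> = ennreal (exp (r * q) * exp (- r))"
        using sums r q0 by (intro suminf_ennreal_eq) auto
      also have "exp (r * q) * exp (- r) = exp (- measure \<nu> U)"
        using r by (simp add: q mult_exp_exp right_diff_distrib)
      finally show ?thesis by (simp add: measure_def)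
    qed
    then show ?thesis using pQ by (intro exI[of _ Q]) (simp add: Q_def)
  qed
qed

text \<open>Independent clouds with intensities \<open>\<nu> j\<close>. Void probabilities multiply, so their logarithms add up;
  the statement is a limit because the total intensity of the sets may be infinite.\<close>

lemma poisson_process_exists:
  fixes \<nu> :: "nat \<Rightarrow> 'p::second_countable_topology measure"
  assumes \<nu>: "\<And>j. finite_measure (\<nu> j)" "\<And>j. sets (\<nu> j) = sets borel"
  shows "\<exists>P :: (nat \<Rightarrow> real \<times> (nat \<Rightarrow> 'p)) measure. prob_space P \<and> sets P = sets borel \<and>
    (\<forall>U. (\<forall>j. U j \<in> sets borel) \<longrightarrow> {w. \<forall>j i. real i < fst (w j) \<longrightarrow> snd (w j) i \<notin> U j} \<in> sets borel \<and>
      (\<lambda>n. exp (- (\<Sum>j<n. measure (\<nu> j) (U j)))) \<longlonglongrightarrow>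
        measure P {w. \<forall>j i. real i < fst (w j) \<longrightarrow> snd (w j) i \<notin> U j})"
proof -
  have "\<forall>j. \<exists>Q :: (real \<times> (nat \<Rightarrow> 'p)) measure. prob_space Q \<and> sets Q = sets borel \<and>
    (\<forall>U\<in>sets borel. measure Q {c. \<forall>i. real i < fst c \<longrightarrow> snd c i \<notin> U} = exp (- measure (\<nu> j) U))"
    using poisson_void_finite[OF \<nu>] by (rule allI)
  from choice[OF this] obtain Q :: "nat \<Rightarrow> (real \<times> (nat \<Rightarrow> 'p)) measure" where
    Q: "\<And>j. prob_space (Q j)" "\<And>j. sets (Q j) = sets borel"
      "\<And>j U. U \<in> sets borel \<Longrightarrow> measure (Q j) {c. \<forall>i. real i < fst c \<longrightarrow> snd c i \<notin> U} = exp (- measure (\<nu> j) U)"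
    by blast
  define P where "P = Pi\<^sub>M (UNIV :: nat set) Q"
  interpret Q: prob_space "Q j" for j by (rule Q(1))
  interpret P: product_prob_space Q "UNIV :: nat set" ..
  interpret PP: prob_space P unfolding P_def by (rule prob_space_PiM) (rule Q(1))
  have Ps: "sets P = sets borel"
  proof -
    have "sets P = sets (Pi\<^sub>M (UNIV :: nat set) (\<lambda>_. borel :: (real \<times> (nat \<Rightarrow> 'p)) measure))"
      unfolding P_def by (intro sets_PiM_cong refl Q(2))
    then show ?thesis by (simp add: sets_PiM_equal_borel)
  qed
  have sp: "space P = UNIV" using Ps sets_eq_imp_space_eq by fastforce
  have "{w. \<forall>j i. real i < fst (w j) \<longrightarrow> snd (w j) i \<notin> U j} \<in> sets borel \<and>
      (\<lambda>n. exp (- (\<Sum>j<n. measure (\<nu> j) (U j)))) \<longlonglongrightarrow>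
        measure P {w. \<forall>j i. real i < fst (w j) \<longrightarrow> snd (w j) i \<notin> U j}"
    if U: "\<And>j. U j \<in> sets borel" for U
  proof -
    define E where "E = (\<lambda>j. {c :: real \<times> (nat \<Rightarrow> 'p). \<forall>i. real i < fst c \<longrightarrow> snd c i \<notin> U j})"
    have E: "E j \<in> sets (Q j)" for j unfolding Q(2) E_def by (rule void_event_borel[OF U])
    define D where "D = (\<lambda>n. {w \<in> space P. \<forall>j\<in>{..<n}. w j \<in> E j})"
    have Dm: "D n \<in> sets P" for n unfolding D_def P_def using E by (intro sets.sets_Collect_finite_All sets_Collect_single') auto
    have mD: "measure P (D n) = exp (- (\<Sum>j<n. measure (\<nu> j) (U j)))" for n
    proof -
      have "emeasure P (D n) = (\<Prod>j<n. emeasure (Q j) (E j))"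
        unfolding D_def P_def by (rule P.emeasure_PiM_Collect) (use E in auto)
      also have "\<dots> = ennreal (\<Prod>j<n. exp (- measure (\<nu> j) (U j)))"
        using Q(3) U by (simp add: Q.emeasure_eq_measure E_def prod_ennreal)
      also have "(\<Prod>j<n. exp (- measure (\<nu> j) (U j))) = exp (- (\<Sum>j<n. measure (\<nu> j) (U j)))"
        by (simp add: exp_sum[symmetric] sum_negf)
      finally show ?thesis by (simp add: measure_def)
    qed
    have "(\<lambda>n. measure P (D n)) \<longlonglongrightarrow> measure P (\<Inter>n. D n)"
      by (rule PP.finite_Lim_measure_decseq) (use Dm in \<open>auto simp: D_def decseq_def\<close>)
    moreover have "(\<Inter>n. D n) = {w. \<forall>j i. real i < fst (w j) \<longrightarrow> snd (w j) i \<notin> U j}"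
      by (auto simp: D_def E_def sp)
    moreover have "(\<Inter>n. D n) \<in> sets P" using Dm by auto
    ultimately show ?thesis using Ps by (simp add: mD)
  qed
  then show ?thesis using PP.prob_space_axioms Ps by (intro exI[of _ P]) auto
qed

section \<open>Eigenfunctions over a factor\<close>

lemma norm_integral_le_integral:
  fixes f :: "'a \<Rightarrow> 'b::{banach, second_countable_topology}"
  assumes "integrable M f" "integrable M g" "\<And>x. x \<in> space M \<Longrightarrow> norm (f x) \<le> g x"
  shows "norm (\<integral>x. f x \<partial>M) \<le> (\<integral>x. g x \<partial>M)"
  by (rule order_trans[OF integral_norm_bound]) (use assms in \<open>intro integral_mono integrable_norm\<close>)

text \<open>Convergence to zero of linear functionals that are uniformly bounded in the \<open>L\<^sup>1\<close> norm is stable under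
  \<open>L\<^sup>1\<close> limits, so it spreads from a generator stable under intersection to all integrable functions.\<close>

lemma L1_bounded_functionals_vanish:
  fixes \<Lambda> :: "nat \<Rightarrow> ('z \<Rightarrow> complex) \<Rightarrow> complex"
  assumes "finite_measure Z"
    and gen: "sets Z = sigma_sets (space Z) G" "G \<subseteq> Pow (space Z)" "Int_stable G" "space Z \<in> G"
    and add: "\<And>k F H. integrable Z F \<Longrightarrow> integrable Z H \<Longrightarrow> \<Lambda> k (\<lambda>z. F z + H z) = \<Lambda> k F + \<Lambda> k H"
    and scale: "\<And>k F c. integrable Z F \<Longrightarrow> \<Lambda> k (\<lambda>z. F z * c) = \<Lambda> k F * c"
    and bound: "\<And>k F. integrable Z F \<Longrightarrow> cmod (\<Lambda> k F) \<le> C * (\<integral>z. cmod (F z) \<partial>Z)"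
    and base: "\<And>A. A \<in> G \<Longrightarrow> (\<lambda>k. \<Lambda> k (indicator A)) \<longlonglongrightarrow> 0"
    and F: "integrable Z F"
  shows "(\<lambda>k. \<Lambda> k F) \<longlonglongrightarrow> 0"
proof -
  interpret finite_measure Z by fact
  define V where "V = (\<lambda>F. (\<lambda>k. \<Lambda> k F) \<longlonglongrightarrow> 0)"
  have closed: "V F" if s: "\<And>i::nat. integrable Z (s i)" "\<And>i. V (s i)" and F: "integrable Z F"
    and lim: "\<And>z. z \<in> space Z \<Longrightarrow> (\<lambda>i. s i z) \<longlonglongrightarrow> F z"
    and dom: "integrable Z w" "\<And>i z. z \<in> space Z \<Longrightarrow> cmod (s i z) \<le> w z"
    for F s and w :: "'z \<Rightarrow> real"
  proof -
    have "(\<lambda>i. \<integral>z. cmod (F z - s i z) \<partial>Z) \<longlonglongrightarrow> (\<integral>z. 0 \<partial>Z)"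
    proof (rule integral_dominated_convergence)
      show "AE x in Z. (\<lambda>i. cmod (F x - s i x)) \<longlonglongrightarrow> 0"
        using lim by (intro AE_I2) (auto intro!: tendsto_eq_intros)
      show "integrable Z (\<lambda>z. cmod (F z) + w z)" using F dom(1) by simp
      show "AE x in Z. norm (cmod (F x - s i x)) \<le> cmod (F x) + w x" for i
        using dom(2)[of _ i] by (intro AE_I2) (auto intro!: order_trans[OF norm_triangle_ineq4])
      show "(\<lambda>z. cmod (F z - s i z)) \<in> borel_measurable Z" for i
        using s(1)[of i] F by auto
    qed simp
    then have L1: "(\<lambda>i. C * (\<integral>z. cmod (F z - s i z) \<partial>Z)) \<longlonglongrightarrow> C * 0"
      by (intro tendsto_mult_left) simp
    show "V F" unfolding V_def
    proof (rule LIMSEQ_I)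
      fix e :: real assume e: "0 < e"
      obtain i where i: "C * (\<integral>z. cmod (F z - s i z) \<partial>Z) < e / 2"
        using order_tendstoD(2)[OF L1, of "e / 2"] e eventually_happens'[OF sequentially_bot] by fastforce
      obtain K where K: "\<And>k. k \<ge> K \<Longrightarrow> cmod (\<Lambda> k (s i)) < e / 2"
        using LIMSEQ_D[OF s(2)[of i, unfolded V_def], of "e / 2"] e by auto
      have d: "integrable Z (\<lambda>z. F z - s i z)" using F s by simp
      have "cmod (\<Lambda> k F - 0) < e" if "k \<ge> K" for k
      proof -
        have "\<Lambda> k F = \<Lambda> k (s i) + \<Lambda> k (\<lambda>z. F z - s i z)"
          using add[OF s(1) d, of k i] by simp
        then show ?thesis
          using K[OF that] bound[OF d, of k] i norm_triangle_ineq[of "\<Lambda> k (s i)" "\<Lambda> k (\<lambda>z. F z - s i z)"] by simp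
      qed
      then show "\<exists>K. \<forall>k\<ge>K. cmod (\<Lambda> k F - 0) < e" by blast
    qed
  qed
  have Vadd: "V (\<lambda>z. F z + H z)" if "integrable Z F" "integrable Z H" "V F" "V H" for F H
    using tendsto_add[of "\<lambda>k. \<Lambda> k F" 0 sequentially "\<lambda>k. \<Lambda> k H" 0] that by (simp add: V_def add)
  have Vscale: "V (\<lambda>z. F z * c)" if "integrable Z F" "V F" for F c
    using tendsto_mult_right[of "\<lambda>k. \<Lambda> k F" 0 sequentially c] that by (simp add: V_def scale)
  have int: "integrable Z (indicator A :: 'z \<Rightarrow> complex)" if "A \<in> sets Z" for A
    by (rule integrable_const_bound[of _ 1]) (use that in \<open>auto simp: indicator_def\<close>)
  have Vind: "V (indicator A)" if "A \<in> sets Z" for A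
    using gen(3,2) that[unfolded gen(1)]
  proof (induction rule: sigma_sets_induct_disjoint)
    case (basic A)
    then show ?case using base by (simp add: V_def)
  next
    case empty
    have "(indicator {} :: 'z \<Rightarrow> complex) = (\<lambda>z. indicator (space Z) z * 0)" by auto
    then show ?case using Vscale[of "indicator (space Z)" 0] base[OF gen(4)] int by (simp add: V_def)
  next
    case (compl A)
    then have A: "A \<in> sets Z" by (simp add: gen(1))
    have "(indicator (space Z - A) :: 'z \<Rightarrow> complex) = (\<lambda>z. indicator (space Z) z + indicator A z * (-1))"
      using sets.sets_into_space[OF A] by (auto simp: indicator_def fun_eq_iff)
    moreover have "V (\<lambda>z. indicator (space Z) z + indicator A z * (-1))"
      using A int base[OF gen(4)] compl by (intro Vadd Vscale) (auto simp: V_def)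
    ultimately show ?case by simp
  next
    case (union A)
    have A: "A i \<in> sets Z" for i using union(2) gen(1) by auto
    define s where "s = (\<lambda>i. indicator (\<Union>j<i. A j) :: 'z \<Rightarrow> complex)"
    have si: "integrable Z (s i)" for i unfolding s_def using A by (intro int) auto
    have s: "V (s i)" for i
    proof (induction i)
      case 0
      have "s 0 = (\<lambda>z. indicator (space Z) z * 0)" by (auto simp: s_def)
      then show ?case using Vscale[of "indicator (space Z)" 0] base[OF gen(4)] int by (simp add: V_def)
    next
      case (Suc i)
      have "A i \<inter> (\<Union>j<i. A j) = {}" using union(1) by (auto simp: disjoint_family_on_def) (metis disjoint_iff less_irrefl)
      then have "s (Suc i) = (\<lambda>z. s i z + indicator (A i) z)"
        by (auto simp: s_def lessThan_Suc indicator_def fun_eq_iff)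
      then show ?case using Vadd[OF si[of i] int[OF A[of i]] Suc union(3)[of i]] by simp
    qed
    show ?case
    proof (rule closed[of s _ "\<lambda>_. 1"])
      show "(\<lambda>i. s i z) \<longlonglongrightarrow> indicator (\<Union>i. A i) z" for z
        unfolding s_def by (rule LIMSEQ_indicator_UN)
      show "integrable Z (indicator (\<Union>i. A i) :: 'z \<Rightarrow> complex)" by (rule int) (use A in auto)
    qed (use s si in \<open>auto simp: s_def indicator_def\<close>)
  qed
  have "V F" using F
  proof (induction rule: integrable_induct)
    case (base A c)
    have "(\<lambda>x. indicat_real A x *\<^sub>R c) = (\<lambda>x. indicator A x * c)" by (auto simp: indicator_def)
    then show ?case using Vscale[OF int Vind] base by simp
  next
    case (lim f s)
    show ?case by (rule closed[of s f "\<lambda>z. 2 * cmod (f z)"]) (use lim in auto)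
  qed (rule Vadd)
  then show ?thesis by (simp add: V_def)
qed

lemma distr_snd_pair:
  assumes "prob_space M" "prob_space Y"
  shows "distr (M \<Otimes>\<^sub>M Y) Y snd = Y"
proof -
  interpret M: prob_space M by fact
  interpret Y: prob_space Y by fact
  show ?thesis
  proof (rule measure_eqI)
    fix A assume A: "A \<in> sets (distr (M \<Otimes>\<^sub>M Y) Y snd)"
    have "snd -` A \<inter> space (M \<Otimes>\<^sub>M Y) = space M \<times> A"
      using A sets.sets_into_space[of A Y] by (auto simp: space_pair_measure)
    then show "emeasure (distr (M \<Otimes>\<^sub>M Y) Y snd) A = emeasure Y A"
      using A by (simp add: emeasure_distr Y.emeasure_pair_measure_Times M.emeasure_space_1)
  qed simp
qed

text \<open>A relative form of "mixing implies weak mixing". The maps \<open>S k\<close> act on a product over maps \<open>R k\<close> of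
  the second factor, and on rectangles they make the first coordinates eventually independent.
  By approximation the correlation of any two bounded functions becomes that of their conditional
  expectations on \<open>Y\<close>. An eigenfunction keeps full correlation with itself, hence equals its conditional
  expectation.\<close>

lemma bounded_eigenfunction_factors:
  fixes M :: "'x measure" and Y :: "'y measure" and F :: "'x \<times> 'y \<Rightarrow> complex"
  assumes M: "prob_space M" and Y: "prob_space Y"
    and gen: "sets M = sigma_sets (space M) G" "G \<subseteq> Pow (space M)" "Int_stable G" "space M \<in> G"
    and S: "\<And>k. S k \<in> M \<Otimes>\<^sub>M Y \<rightarrow>\<^sub>M M \<Otimes>\<^sub>M Y" "\<And>k. distr (M \<Otimes>\<^sub>M Y) (M \<Otimes>\<^sub>M Y) (S k) = M \<Otimes>\<^sub>M Y"
    and R: "\<And>k. R k \<in> Y \<rightarrow>\<^sub>M Y" "\<And>k. distr Y Y (R k) = Y"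
    and decouple: "\<And>A B C D. A \<in> G \<Longrightarrow> B \<in> G \<Longrightarrow> C \<in> sets Y \<Longrightarrow> D \<in> sets Y \<Longrightarrow>
      eventually (\<lambda>k. measure (M \<Otimes>\<^sub>M Y) {z \<in> space (M \<Otimes>\<^sub>M Y). S k z \<in> A \<times> C \<and> z \<in> B \<times> D} =
        measure M A * measure M B * measure Y {y \<in> space Y. R k y \<in> C \<and> y \<in> D}) sequentially"
    and F[measurable]: "F \<in> borel_measurable (M \<Otimes>\<^sub>M Y)" and F1: "\<And>z. cmod (F z) \<le> 1"
    and c: "\<And>k. cmod (c k) = 1" "\<And>k. AE z in M \<Otimes>\<^sub>M Y. F (S k z) = c k * F z"
  shows "\<exists>f \<in> borel_measurable Y. AE z in M \<Otimes>\<^sub>M Y. F z = f (snd z)"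
proof -
  interpret M: prob_space M by fact
  interpret Y: prob_space Y by fact
  note [measurable] = S(1) R(1)
  have [measurable]: "cnj \<in> borel_measurable borel"
    by (intro borel_measurable_continuous_onI continuous_intros)
  let ?Z = "M \<Otimes>\<^sub>M Y"
  let ?W = "M \<Otimes>\<^sub>M ?Z"
  have pZ: "prob_space ?Z" by (rule prob_space_pair[OF M Y])
  interpret Z: prob_space ?Z by (rule pZ)
  interpret MY: pair_prob_space M Y ..
  interpret W: pair_prob_space M ?Z ..
  define \<alpha> where "\<alpha> = (\<lambda>k w. (fst w, R k (snd (snd (w :: 'x \<times> 'x \<times> 'y)))) :: 'x \<times> 'y)"
  have \<alpha>m[measurable]: "\<alpha> k \<in> ?W \<rightarrow>\<^sub>M ?Z" for k unfolding \<alpha>_def by measurable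
  have ds: "distr ?Z Y snd = Y" using M Y by (rule distr_snd_pair)
  have dW: "distr ?W ?Z snd = ?Z" using M pZ by (rule distr_snd_pair)
  have d\<alpha>: "distr ?W ?Z (\<alpha> k) = ?Z" for k
  proof -
    have d1: "distr ?Z Y (\<lambda>z. R k (snd z)) = Y"
      using distr_distr[of "R k" Y Y snd ?Z] ds R(2)[of k] by (simp add: comp_def)
    have "distr M M (\<lambda>x. x) \<Otimes>\<^sub>M distr ?Z Y (\<lambda>z. R k (snd z))
        = distr ?W ?Z (\<lambda>(x, z). (x, R k (snd z)))"
      by (rule pair_measure_distr) (use d1 Y.sigma_finite_measure_axioms in auto)
    then show ?thesis using d1 by (simp add: \<alpha>_def split_beta')
  qed
  \<comment> \<open>Correlation minus its conditional counterpart, in which the coordinates on \<^term>\<open>M\<close> are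
    independent copies while those on \<^term>\<open>Y\<close> are kept; bilinear in the two functions.\<close>
  define \<Delta> where "\<Delta> = (\<lambda>k (F :: 'x \<times> 'y \<Rightarrow> complex) H. (\<integral>z. F (S k z) * H z \<partial>?Z) - (\<integral>w. F (\<alpha> k w) * H (snd w) \<partial>?W))"
  have trS: "integrable ?Z (\<lambda>z. H (S k z))" "(\<integral>z. H (S k z) \<partial>?Z) = (\<integral>z. H z \<partial>?Z)"
    if "integrable ?Z H" for k and H :: "'x \<times> 'y \<Rightarrow> 'b::{banach,second_countable_topology}"
    using integrable_distr[of "S k" ?Z ?Z H] integral_distr[of "S k" ?Z ?Z H] S that by simp_all
  have tr\<alpha>: "integrable ?W (\<lambda>z. H (\<alpha> k z))" "(\<integral>z. H (\<alpha> k z) \<partial>?W) = (\<integral>z. H z \<partial>?Z)"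
    if "integrable ?Z H" for k and H :: "'x \<times> 'y \<Rightarrow> 'b::{banach,second_countable_topology}"
    using integrable_distr[of "\<alpha> k" ?W ?Z H] integral_distr[of "\<alpha> k" ?W ?Z H] d\<alpha>[of k] that by simp_all
  have trW: "integrable ?W (\<lambda>z. H (snd z))" "(\<integral>z. H (snd z) \<partial>?W) = (\<integral>z. H z \<partial>?Z)"
    if "integrable ?Z H" for H :: "'x \<times> 'y \<Rightarrow> 'b::{banach,second_countable_topology}"
    using integrable_distr[of "snd" ?W ?Z H] integral_distr[of "snd" ?W ?Z H] dW that by simp_all
  have bint: "integrable N (\<lambda>z. A z * B z)"
    if "integrable N A" "B \<in> borel_measurable N" "\<And>z. cmod (B z) \<le> K"
    for N :: "'n measure" and A B :: "'n \<Rightarrow> complex" and K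
  proof (rule Bochner_Integration.integrable_bound[where f="\<lambda>z. K *\<^sub>R A z"])
    have "0 \<le> K" using that(3) norm_ge_zero order_trans by blast
    then show "AE x in N. cmod (A x * B x) \<le> cmod (K *\<^sub>R A x)"
      using that(3) by (intro AE_I2) (simp add: norm_mult mult.commute[of K] mult_left_mono)
    show "(\<lambda>z. A z * B z) \<in> borel_measurable N" using that(1,2) by auto
  qed (use that in simp)
  have bint': "integrable N (\<lambda>z. B z * A z)"
    if "integrable N A" "B \<in> borel_measurable N" "\<And>z. cmod (B z) \<le> K"
    for N :: "'n measure" and A B :: "'n \<Rightarrow> complex" and K
    using bint[OF that] by (simp add: mult.commute)
  have bnd: "cmod (\<integral>z. A z * B z \<partial>N) \<le> K * (\<integral>z. cmod (A z) \<partial>N)"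
    if "integrable N A" "B \<in> borel_measurable N" "\<And>z. cmod (B z) \<le> K"
    for N :: "'n measure" and A B :: "'n \<Rightarrow> complex" and K
  proof -
    have "cmod (\<integral>z. A z * B z \<partial>N) \<le> (\<integral>z. K * cmod (A z) \<partial>N)"
      by (rule norm_integral_le_integral)
        (use bint[OF that] that in \<open>auto simp: norm_mult mult.commute[of K] intro!: mult_left_mono\<close>)
    then show ?thesis by simp
  qed
  have bnd': "cmod (\<integral>z. B z * A z \<partial>N) \<le> K * (\<integral>z. cmod (A z) \<partial>N)"
    if "integrable N A" "B \<in> borel_measurable N" "\<And>z. cmod (B z) \<le> K"
    for N :: "'n measure" and A B :: "'n \<Rightarrow> complex" and K
    using bnd[OF that] by (simp add: mult.commute)
  define G' where "G' = {A \<times> C | A C. A \<in> G \<and> C \<in> sets Y}"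
  have G': "sets ?Z = sigma_sets (space ?Z) G'" "G' \<subseteq> Pow (space ?Z)" "Int_stable G'" "space ?Z \<in> G'"
  proof -
    have "sets ?Z = sets (sigma (space M \<times> space Y) G')" unfolding G'_def
      using sets_pair_eq[of G M "{space M}" "sets Y" Y "{space Y}"] gen
      by (auto simp: sets.sigma_sets_eq sets.space_closed)
    moreover show sub: "G' \<subseteq> Pow (space ?Z)"
      using gen(2) sets.sets_into_space by (fastforce simp: G'_def space_pair_measure)
    ultimately show "sets ?Z = sigma_sets (space ?Z) G'" by (simp add: space_pair_measure)
    show "space ?Z \<in> G'" using gen(4) by (auto simp: G'_def space_pair_measure)
    show "Int_stable G'" using gen(3) unfolding G'_def Int_stable_def
      by (auto simp: Times_Int_Times) blast
  qed
  have GM: "A \<in> sets M" if "A \<in> G" for A using gen that by auto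
  have base: "(\<lambda>k. \<Delta> k (indicator P) (indicator Q)) \<longlonglongrightarrow> 0" if PQ: "P \<in> G'" "Q \<in> G'" for P Q
  proof -
    obtain A C where P: "P = A \<times> C" "A \<in> G" "C \<in> sets Y" using PQ by (auto simp: G'_def)
    obtain B D where Q: "Q = B \<times> D" "B \<in> G" "D \<in> sets Y" using PQ by (auto simp: G'_def)
    have [measurable]: "A \<in> sets M" "B \<in> sets M" "C \<in> sets Y" "D \<in> sets Y" using GM P Q by auto
    have 1: "(\<integral>z. indicator P (S k z) * indicator Q z \<partial>?Z)
       = complex_of_real (measure ?Z {z \<in> space ?Z. S k z \<in> A \<times> C \<and> z \<in> B \<times> D})" for k
    proof -
      have "(\<integral>z. indicator P (S k z) * indicator Q z \<partial>?Z)
        = (\<integral>z. of_real (indicator {z \<in> space ?Z. S k z \<in> A \<times> C \<and> z \<in> B \<times> D} z) \<partial>?Z)"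
        by (intro Bochner_Integration.integral_cong) (auto simp: P Q indicator_def)
      also have "\<dots> = complex_of_real (\<integral>z. indicator {z \<in> space ?Z. S k z \<in> A \<times> C \<and> z \<in> B \<times> D} z \<partial>?Z)"
        by (rule integral_complex_of_real)
      also have "(\<integral>z. indicator {z \<in> space ?Z. S k z \<in> A \<times> C \<and> z \<in> B \<times> D} z \<partial>?Z)
        = measure ?Z {z \<in> space ?Z. S k z \<in> A \<times> C \<and> z \<in> B \<times> D}"
        by (simp add: Int_absorb2)
      finally show ?thesis .
    qed
    have 2: "(\<integral>w. indicator P (\<alpha> k w) * indicator Q (snd w) \<partial>?W)
       = complex_of_real (measure M A * measure M B * measure Y {y \<in> space Y. R k y \<in> C \<and> y \<in> D})" for k
    proof -
      let ?E = "A \<times> B \<times> {y \<in> space Y. R k y \<in> C \<and> y \<in> D}"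
      have Y': "{y \<in> space Y. R k y \<in> C \<and> y \<in> D} \<in> sets Y" by measurable
      have "(\<integral>w. indicator P (\<alpha> k w) * indicator Q (snd w) \<partial>?W)
        = (\<integral>w. of_real (indicator ?E w) \<partial>?W)"
        using sets.sets_into_space[of D Y]
        by (intro Bochner_Integration.integral_cong) (auto simp: P Q indicator_def \<alpha>_def)
      also have "\<dots> = complex_of_real (\<integral>w. indicator ?E w \<partial>?W)"
        by (rule integral_complex_of_real)
      also have "(\<integral>w. indicator ?E w \<partial>?W) = measure ?W ?E"
      proof -
        have "?E \<in> sets ?W" using Y' by measurable
        then show ?thesis using sets.sets_into_space[of ?E ?W] by (simp add: Int_absorb2)
      qed
      also have "measure ?W ?E = measure M A * (measure M B * measure Y {y \<in> space Y. R k y \<in> C \<and> y \<in> D})"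
        using Y' by (simp add: measure_def Z.emeasure_pair_measure_Times Y.emeasure_pair_measure_Times enn2real_mult)
      finally show ?thesis by (simp add: mult.assoc)
    qed
    have "eventually (\<lambda>k. \<Delta> k (indicator P) (indicator Q) = 0) sequentially"
      using decouple[OF P(2) Q(2) P(3) Q(3)] by eventually_elim (simp only: \<Delta>_def 1 2 diff_self)
    then show ?thesis by (rule tendsto_eventually)
  qed
  have fm: "finite_measure ?Z" by unfold_locales
  \<comment> \<open>The first argument is freed from the generator, then the second.\<close>
  have step1: "(\<lambda>k. \<Delta> k F (indicator Q)) \<longlonglongrightarrow> 0" if Q: "Q \<in> G'" and F: "integrable ?Z F" for Q F
  proof (rule L1_bounded_functionals_vanish[OF fm G', where \<Lambda>="\<lambda>k F. \<Delta> k F (indicator Q)" and C=2])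
    have Qm[measurable]: "Q \<in> sets ?Z" using G'(1) Q by auto
    have q1: "cmod (indicator Q z) \<le> 1" for z by (simp add: indicator_def)
    have Qs: "(indicator Q :: _ \<Rightarrow> complex) \<in> borel_measurable ?Z" "(\<lambda>w. indicator Q (snd w) :: complex) \<in> borel_measurable ?W"
      by measurable
    fix k and F H :: "'x \<times> 'y \<Rightarrow> complex" and d
    assume F: "integrable ?Z F"
    have FS: "integrable ?Z (\<lambda>z. F (S k z) * indicator Q z)" "integrable ?W (\<lambda>w. F (\<alpha> k w) * indicator Q (snd w))"
      if "integrable ?Z F" for F :: "'x \<times> 'y \<Rightarrow> complex"
      using bint[OF trS(1)[OF that] Qs(1) q1] bint[OF tr\<alpha>(1)[OF that] Qs(2) q1] by auto
    show "\<Delta> k (\<lambda>z. F z + H z) (indicator Q) = \<Delta> k F (indicator Q) + \<Delta> k H (indicator Q)" if "integrable ?Z H"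
      using FS[OF F] FS[OF that] by (simp add: \<Delta>_def distrib_right)
    show "\<Delta> k (\<lambda>z. F z * d) (indicator Q) = \<Delta> k F (indicator Q) * d"
    proof -
      have "(\<integral>z. F (S k z) * d * indicator Q z \<partial>?Z) = (\<integral>z. F (S k z) * indicator Q z * d \<partial>?Z)"
        "(\<integral>w. F (\<alpha> k w) * d * indicator Q (snd w) \<partial>?W) = (\<integral>w. F (\<alpha> k w) * indicator Q (snd w) * d \<partial>?W)"
        by (simp_all add: ac_simps)
      then show ?thesis using FS[OF F] by (simp add: \<Delta>_def left_diff_distrib)
    qed
    show "cmod (\<Delta> k F (indicator Q)) \<le> 2 * (\<integral>z. cmod (F z) \<partial>?Z)"
      using bnd[OF trS(1)[OF F, of k] Qs(1) q1] bnd[OF tr\<alpha>(1)[OF F, of k] Qs(2) q1]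
        trS(2)[OF integrable_norm[OF F], of k] tr\<alpha>(2)[OF integrable_norm[OF F], of k]
      unfolding \<Delta>_def by (intro order_trans[OF norm_triangle_ineq4]) simp
  qed (use base[OF _ Q] F in auto)
  have F1S: "cmod (F (S k z)) \<le> 1" "cmod (F (\<alpha> k w)) \<le> 1" for k z w using F1 by auto
  have Fi: "integrable ?Z F" by (rule Z.integrable_const_bound[of _ 1]) (use F1 in auto)
  have Fs: "(\<lambda>z. F (S k z)) \<in> borel_measurable ?Z" "(\<lambda>w. F (\<alpha> k w)) \<in> borel_measurable ?W" for k by measurable
  have step2: "(\<lambda>k. \<Delta> k F H) \<longlonglongrightarrow> 0" if H: "integrable ?Z H" for H
  proof (rule L1_bounded_functionals_vanish[OF fm G', where \<Lambda>="\<lambda>k H. \<Delta> k F H" and C=2])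
    show "(\<lambda>k. \<Delta> k F (indicator A)) \<longlonglongrightarrow> 0" if "A \<in> G'" for A by (rule step1[OF that Fi])
    fix k and H H' :: "'x \<times> 'y \<Rightarrow> complex" and d
    assume H: "integrable ?Z H"
    have FS: "integrable ?Z (\<lambda>z. F (S k z) * H z)" "integrable ?W (\<lambda>w. F (\<alpha> k w) * H (snd w))"
      if "integrable ?Z H" for H :: "'x \<times> 'y \<Rightarrow> complex"
      using bint'[OF that Fs(1) F1S(1)] bint'[OF trW(1)[OF that] Fs(2) F1S(2)] by auto
    show "\<Delta> k F (\<lambda>z. H z + H' z) = \<Delta> k F H + \<Delta> k F H'" if "integrable ?Z H'"
      using FS[OF H] FS[OF that] by (simp add: \<Delta>_def distrib_left)
    show "\<Delta> k F (\<lambda>z. H z * d) = \<Delta> k F H * d"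
      using FS[OF H] by (simp add: \<Delta>_def left_diff_distrib mult.assoc[symmetric])
    show "cmod (\<Delta> k F H) \<le> 2 * (\<integral>z. cmod (H z) \<partial>?Z)"
      using bnd'[OF H Fs(1)[of k] F1S(1)] bnd'[OF trW(1)[OF H] Fs(2)[of k] F1S(2)]
        trW(2)[OF integrable_norm[OF H]]
      unfolding \<Delta>_def by (intro order_trans[OF norm_triangle_ineq4]) simp
  qed (fact H)
  \<comment> \<open>The conditional expectation of \<^term>\<open>F\<close> given the coordinate in \<^term>\<open>Y\<close>.\<close>
  define f where "f = (\<lambda>y. \<integral>x. F (x, y) \<partial>M)"
  have fm[measurable]: "f \<in> borel_measurable Y" unfolding f_def by measurable
  have Fx: "(\<lambda>x. F (x, y)) \<in> borel_measurable M" if "y \<in> space Y" for y using that by measurable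
  have Fxi: "integrable M (\<lambda>x. F (x, y))" if "y \<in> space Y" for y
    by (rule M.integrable_const_bound[of _ 1]) (use F1 Fx[OF that] in auto)
  have f1: "cmod (f y) \<le> 1" if "y \<in> space Y" for y
  proof -
    have "cmod (f y) \<le> (\<integral>x. 1 \<partial>M)" unfolding f_def
      by (rule norm_integral_le_integral) (use F1 Fxi[OF that] in auto)
    then show ?thesis by (simp add: M.prob_space)
  qed
  have Rs: "R k y \<in> space Y" if "y \<in> space Y" for k y using measurable_space[OF R(1) that] .
  have bi: "integrable ?Z g" if "g \<in> borel_measurable ?Z" "\<And>z. z \<in> space ?Z \<Longrightarrow> cmod (g z) \<le> 1" for g :: "'x \<times> 'y \<Rightarrow> complex"
    by (rule Z.integrable_const_bound[of _ 1]) (use that in auto)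
  have biY: "integrable Y g" if "g \<in> borel_measurable Y" "\<And>z. z \<in> space Y \<Longrightarrow> norm (g z) \<le> 1" for g :: "'y \<Rightarrow> 'b::{banach,second_countable_topology}"
    by (rule Y.integrable_const_bound[of _ 1]) (use that in auto)
  have sZ: "snd z \<in> space Y" if "z \<in> space ?Z" for z using that by (auto simp: space_pair_measure)
  have fub: "(\<integral>z. g (snd z) * F z \<partial>?Z) = (\<integral>y. g y * f y \<partial>Y)"
    "(\<integral>z. g (snd z) * cnj (F z) \<partial>?Z) = (\<integral>y. g y * cnj (f y) \<partial>Y)"
    if g[measurable]: "g \<in> borel_measurable Y" and g1: "\<And>y. y \<in> space Y \<Longrightarrow> cmod (g y) \<le> 1" for g
  proof -
    have i1: "integrable ?Z (\<lambda>(x, y). g y * F (x, y))"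
      using g1 F1 sZ by (intro bi) (auto simp: split_beta' norm_mult space_pair_measure intro!: mult_le_one)
    have "(\<integral>y. (\<integral>x. g y * F (x, y) \<partial>M) \<partial>Y) = (\<integral>z. g (snd z) * F z \<partial>?Z)"
      using MY.integral_snd[OF i1] by (simp add: split_beta')
    then show "(\<integral>z. g (snd z) * F z \<partial>?Z) = (\<integral>y. g y * f y \<partial>Y)" by (simp add: f_def)
    have i2: "integrable ?Z (\<lambda>(x, y). g y * cnj (F (x, y)))"
      using g1 F1 sZ by (intro bi) (auto simp: split_beta' norm_mult space_pair_measure intro!: mult_le_one)
    have "(\<integral>y. (\<integral>x. g y * cnj (F (x, y)) \<partial>M) \<partial>Y) = (\<integral>z. g (snd z) * cnj (F z) \<partial>?Z)"
      using MY.integral_snd[OF i2] by (simp add: split_beta')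
    then show "(\<integral>z. g (snd z) * cnj (F z) \<partial>?Z) = (\<integral>y. g y * cnj (f y) \<partial>Y)" by (simp add: f_def)
  qed
  define a where "a = (\<integral>z. (cmod (F z))\<^sup>2 \<partial>?Z)"
  define b where "b = (\<integral>y. (cmod (f y))\<^sup>2 \<partial>Y)"
  have a: "(\<integral>z. F z * cnj (F z) \<partial>?Z) = of_real a"
    unfolding a_def by (simp add: complex_norm_square[symmetric] flip: of_real_power)
  have b: "(\<integral>y. f y * cnj (f y) \<partial>Y) = of_real b"
    unfolding b_def by (simp add: complex_norm_square[symmetric] flip: of_real_power)
  have W: "cmod (\<integral>w. F (\<alpha> k w) * cnj (F (snd w)) \<partial>?W) \<le> b" for k
  proof -
    have i: "integrable ?W (\<lambda>(x, z). F (x, R k (snd z)) * cnj (F z))"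
      by (rule W.integrable_const_bound[of _ 1])
        (auto simp: split_beta' norm_mult F1 intro!: AE_I2 mult_le_one)
    have "(\<integral>w. F (\<alpha> k w) * cnj (F (snd w)) \<partial>?W) = (\<integral>z. (\<integral>x. F (x, R k (snd z)) * cnj (F z) \<partial>M) \<partial>?Z)"
      using W.integral_snd[OF i] by (simp add: \<alpha>_def split_beta')
    also have "\<dots> = (\<integral>z. f (R k (snd z)) * cnj (F z) \<partial>?Z)" by (simp add: f_def)
    also have "\<dots> = (\<integral>y. f (R k y) * cnj (f y) \<partial>Y)"
      by (rule fub(2)) (use f1 Rs in auto)
    finally have eq: "(\<integral>w. F (\<alpha> k w) * cnj (F (snd w)) \<partial>?W) = (\<integral>y. f (R k y) * cnj (f y) \<partial>Y)" .
    have i1: "integrable Y (\<lambda>y. (cmod (f y))\<^sup>2)" by (rule biY) (use f1 in \<open>auto simp: power_le_one\<close>)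
    have i2: "integrable Y (\<lambda>y. (cmod (f (R k y)))\<^sup>2)" by (rule biY) (use f1 Rs in \<open>auto simp: power_le_one\<close>)
    have i3: "integrable Y (\<lambda>y. f (R k y) * cnj (f y))"
      by (rule biY) (use f1 Rs in \<open>auto simp: norm_mult intro!: mult_le_one\<close>)
    have e2: "(\<integral>y. (cmod (f (R k y)))\<^sup>2 \<partial>Y) = b" unfolding b_def
      using integral_distr[of "R k" Y Y "\<lambda>y. (cmod (f y))\<^sup>2"] R(2)[of k] by simp
    have "cmod (\<integral>y. f (R k y) * cnj (f y) \<partial>Y) \<le> (\<integral>y. ((cmod (f (R k y)))\<^sup>2 + (cmod (f y))\<^sup>2) / 2 \<partial>Y)"
    proof (rule norm_integral_le_integral[OF i3])
      show "integrable Y (\<lambda>y. ((cmod (f (R k y)))\<^sup>2 + (cmod (f y))\<^sup>2) / 2)" using i1 i2 by simp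
      show "cmod (f (R k y) * cnj (f y)) \<le> ((cmod (f (R k y)))\<^sup>2 + (cmod (f y))\<^sup>2) / 2" for y
        using sum_squares_bound[of "cmod (f (R k y))" "cmod (f y)"] by (simp add: norm_mult)
    qed
    also have "\<dots> = b" using i1 i2 e2 by (simp add: b_def)
    finally show ?thesis using eq by simp
  qed
  \<comment> \<open>The eigenvalue equation makes the correlation constant in modulus, so in the limit the square norm
    of \<^term>\<open>F\<close> is at most that of its conditional expectation; this forces equality of the two functions.\<close>
  have ab: "a \<le> b"
  proof -
    have "a \<le> cmod (\<Delta> k F (\<lambda>z. cnj (F z))) + b" for k
    proof -
      have "(\<integral>z. F (S k z) * cnj (F z) \<partial>?Z) = (\<integral>z. c k * (F z * cnj (F z)) \<partial>?Z)"
        by (rule integral_cong_AE) (use c(2)[of k] in auto)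
      also have "\<dots> = c k * of_real a" using a by simp
      finally have "c k * of_real a = \<Delta> k F (\<lambda>z. cnj (F z)) + (\<integral>w. F (\<alpha> k w) * cnj (F (snd w)) \<partial>?W)"
        by (simp add: \<Delta>_def)
      then have "cmod (c k * of_real a) \<le> cmod (\<Delta> k F (\<lambda>z. cnj (F z))) + b"
        using W[of k] norm_triangle_ineq[of "\<Delta> k F (\<lambda>z. cnj (F z))"] by (smt (verit))
      then show ?thesis using c(1)[of k] by (simp add: norm_mult)
    qed
    moreover have "(\<lambda>k. cmod (\<Delta> k F (\<lambda>z. cnj (F z))) + b) \<longlonglongrightarrow> 0 + b"
      by (intro tendsto_add tendsto_norm_zero step2 tendsto_const) (use Fi in simp)
    ultimately show ?thesis by (intro LIMSEQ_le_const[of _ b]) auto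
  qed
  have F2i: "integrable ?Z (\<lambda>z. F z * cnj (F z))"
    by (rule bi) (auto simp: norm_mult F1 intro!: mult_le_one)
  have Ffi: "integrable ?Z (\<lambda>z. cnj (f (snd z)) * F z)" "integrable ?Z (\<lambda>z. f (snd z) * cnj (F z))"
    "integrable ?Z (\<lambda>z. f (snd z) * cnj (f (snd z)))"
    by (rule bi; use sZ f1 F1 in \<open>auto simp: norm_mult intro!: mult_le_one\<close>)+
  have ffi: "(\<integral>z. f (snd z) * cnj (f (snd z)) \<partial>?Z) = of_real b"
    using integral_distr[of snd ?Z Y "\<lambda>y. f y * cnj (f y)"] ds b by simp
  have "(\<integral>z. (F z - f (snd z)) * cnj (F z - f (snd z)) \<partial>?Z)
     = (\<integral>z. F z * cnj (F z) - cnj (f (snd z)) * F z - f (snd z) * cnj (F z) + f (snd z) * cnj (f (snd z)) \<partial>?Z)"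
    by (simp add: algebra_simps)
  also have "\<dots> = of_real a - (\<integral>z. cnj (f (snd z)) * F z \<partial>?Z) - (\<integral>z. f (snd z) * cnj (F z) \<partial>?Z) + of_real b"
    using F2i Ffi a ffi by simp
  also have "(\<integral>z. cnj (f (snd z)) * F z \<partial>?Z) = (\<integral>y. cnj (f y) * f y \<partial>Y)"
    by (rule fub(1)) (use f1 in auto)
  also have "\<dots> = of_real b" using b by (simp add: mult.commute)
  also have "(\<integral>z. f (snd z) * cnj (F z) \<partial>?Z) = of_real b"
    using fub(2)[OF fm f1] b by simp
  finally have "(\<integral>z. (F z - f (snd z)) * cnj (F z - f (snd z)) \<partial>?Z) = of_real (a - b)" by simp
  then have "complex_of_real (\<integral>z. (cmod (F z - f (snd z)))\<^sup>2 \<partial>?Z) = of_real (a - b)"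
    by (simp only: complex_norm_square[symmetric] integral_complex_of_real)
  then have "(\<integral>z. (cmod (F z - f (snd z)))\<^sup>2 \<partial>?Z) = a - b" using of_real_eq_iff by blast
  then have "(\<integral>z. (cmod (F z - f (snd z)))\<^sup>2 \<partial>?Z) = 0"
    using ab Bochner_Integration.integral_nonneg[of ?Z "\<lambda>z. (cmod (F z - f (snd z)))\<^sup>2"] by simp
  moreover have "integrable ?Z (\<lambda>z. (cmod (F z - f (snd z)))\<^sup>2)"
  proof (rule Z.integrable_const_bound[of _ 4])
    have "(cmod (F z - f (snd z)))\<^sup>2 \<le> 4" if "z \<in> space ?Z" for z
    proof -
      have "cmod (F z - f (snd z)) \<le> 2" using norm_triangle_ineq4[of "F z" "f (snd z)"] F1[of z] f1[OF sZ[OF that]] by simp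
      then have "(cmod (F z - f (snd z)))\<^sup>2 \<le> 2\<^sup>2" by (intro power_mono) auto
      then show ?thesis by simp
    qed
    then show "AE z in ?Z. norm ((cmod (F z - f (snd z)))\<^sup>2) \<le> 4" by auto
  qed simp
  ultimately have "AE z in ?Z. (cmod (F z - f (snd z)))\<^sup>2 = 0"
    by (subst (asm) integral_nonneg_eq_0_iff_AE) auto
  then have "AE z in ?Z. F z = f (snd z)" by eventually_elim simp
  then show ?thesis using fm by blast
qed

lemma eigenfunction_factors:
  fixes M :: "'x measure" and Y :: "'y measure" and F :: "'x \<times> 'y \<Rightarrow> complex"
  assumes M: "prob_space M" and Y: "prob_space Y"
    and gen: "sets M = sigma_sets (space M) G" "G \<subseteq> Pow (space M)" "Int_stable G" "space M \<in> G"
    and S: "\<And>k. S k \<in> M \<Otimes>\<^sub>M Y \<rightarrow>\<^sub>M M \<Otimes>\<^sub>M Y" "\<And>k. distr (M \<Otimes>\<^sub>M Y) (M \<Otimes>\<^sub>M Y) (S k) = M \<Otimes>\<^sub>M Y"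
    and R: "\<And>k. R k \<in> Y \<rightarrow>\<^sub>M Y" "\<And>k. distr Y Y (R k) = Y"
    and decouple: "\<And>A B C D. A \<in> G \<Longrightarrow> B \<in> G \<Longrightarrow> C \<in> sets Y \<Longrightarrow> D \<in> sets Y \<Longrightarrow>
      eventually (\<lambda>k. measure (M \<Otimes>\<^sub>M Y) {z \<in> space (M \<Otimes>\<^sub>M Y). S k z \<in> A \<times> C \<and> z \<in> B \<times> D} =
        measure M A * measure M B * measure Y {y \<in> space Y. R k y \<in> C \<and> y \<in> D}) sequentially"
    and F[measurable]: "F \<in> borel_measurable (M \<Otimes>\<^sub>M Y)"
    and c: "\<And>k. cmod (c k) = 1" "\<And>k. AE z in M \<Otimes>\<^sub>M Y. F (S k z) = c k * F z"
  shows "\<exists>f \<in> borel_measurable Y. AE z in M \<Otimes>\<^sub>M Y. F z = f (snd z)"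
proof -
  \<comment> \<open>An injective map into the unit disc commuting with rotations turns \<^term>\<open>F\<close> into a bounded
    eigenfunction; \<open>\<psi>\<close> is its inverse.\<close>
  define \<phi> where "\<phi> = (\<lambda>w::complex. w / of_real (1 + cmod w))"
  define \<psi> where "\<psi> = (\<lambda>w::complex. w / of_real (1 - cmod w))"
  have n\<phi>: "cmod (\<phi> w) = cmod w / (1 + cmod w)" for w
    by (simp add: \<phi>_def norm_divide del: of_real_add)
  have \<psi>\<phi>: "\<psi> (\<phi> w) = w" for w
  proof -
    have p: "1 + cmod w > 0" by (smt (verit) norm_ge_zero)
    have "1 - cmod (\<phi> w) = 1 / (1 + cmod w)" using p by (simp add: n\<phi> field_simps)
    then have "\<psi> (\<phi> w) = \<phi> w / of_real (1 / (1 + cmod w))" by (simp only: \<psi>_def)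
    also have "\<dots> = w" using p by (simp add: \<phi>_def del: of_real_add)
    finally show ?thesis .
  qed
  have [measurable]: "\<phi> \<in> borel_measurable borel" "\<psi> \<in> borel_measurable borel"
    unfolding \<phi>_def \<psi>_def by measurable
  have "\<exists>f \<in> borel_measurable Y. AE z in M \<Otimes>\<^sub>M Y. \<phi> (F z) = f (snd z)"
  proof (rule bounded_eigenfunction_factors[OF M Y gen S R decouple _ _ c(1), where F="\<lambda>z. \<phi> (F z)"])
    show "cmod (\<phi> (F z)) \<le> 1" for z by (simp add: n\<phi> divide_le_eq add_pos_nonneg not_less)
    show "AE z in M \<Otimes>\<^sub>M Y. \<phi> (F (S k z)) = c k * \<phi> (F z)" for k
      using c(2)[of k] by eventually_elim (simp add: \<phi>_def norm_mult c(1))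
  qed auto
  then obtain f where f[measurable]: "f \<in> borel_measurable Y" and eq: "AE z in M \<Otimes>\<^sub>M Y. \<phi> (F z) = f (snd z)" by blast
  have "AE z in M \<Otimes>\<^sub>M Y. F z = \<psi> (f (snd z))"
    using eq by eventually_elim (metis \<psi>\<phi>)
  moreover have "(\<lambda>y. \<psi> (f y)) \<in> borel_measurable Y" by measurable
  ultimately show ?thesis by (intro bexI[of _ "\<lambda>y. \<psi> (f y)"]) auto
qed

section \<open>Translations of a layered Poisson process\<close>

text \<open>Counting measure on the layers times Lebesgue measure on positions and marks.\<close>

definition intensity :: "(nat \<times> (real^'d) \<times> real) set \<Rightarrow> ennreal" where
  "intensity U = (\<Sum>n. emeasure lborel (Pair n -` U))"

text \<open>Bounded sets of finitely many layers; they exhaust the space of points.\<close>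

definition window :: "nat \<Rightarrow> (nat \<times> (real^'d) \<times> real) set" where
  "window N = {..N} \<times> ball 0 (real N) \<times> {- real N<..<real N}"

text \<open>A point consists of its layer, its position and its mark. Only the position moves.\<close>

definition layer_shift :: "(nat \<Rightarrow> real^'d \<Rightarrow> real^'d) \<Rightarrow> real^'d \<Rightarrow> nat \<times> (real^'d) \<times> real \<Rightarrow> nat \<times> (real^'d) \<times> real" where
  "layer_shift Q g = (\<lambda>(n, x, u). (n, x + Q n g, u))"

lemma open_slice: "open U \<Longrightarrow> open (Pair n -` U)"
  by (intro open_vimage continuous_intros)

lemma slice_borel: "open (U :: (nat \<times> (real^'d) \<times> real) set) \<Longrightarrow> Pair n -` U \<in> sets lborel"
  by (simp add: borel_open open_slice)

lemma open_window: "open (window N)"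
  unfolding window_def by (intro open_Times discrete_topology_class.open_discrete open_ball open_greaterThanLessThan)

lemma window_mono: "N \<le> N' \<Longrightarrow> window N \<subseteq> window N'"
  by (auto simp: window_def)

lemma UN_window: "(\<Union>N. window N) = (UNIV :: (nat \<times> (real^'d) \<times> real) set)"
proof -
  have "\<exists>N. z \<in> window N" for z :: "nat \<times> (real^'d) \<times> real"
  proof -
    obtain n x u where z: "z = (n, x, u)" by (cases z)
    obtain N where N: "real N > real n + norm x + \<bar>u\<bar>" using reals_Archimedean2 by blast
    have "real n < real N" "norm x < real N" "\<bar>u\<bar> < real N"
      using N norm_ge_zero[of x] abs_ge_zero[of u] by linarith+
    then have "z \<in> window N" by (auto simp: z window_def abs_less_iff)
    then show ?thesis ..
  qed
  then show ?thesis by blast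
qed

lemma intensity_Un_disjoint:
  assumes "open U" "open W" "U \<inter> W = {}"
  shows "intensity (U \<union> W) = intensity U + intensity W"
proof -
  have "emeasure lborel (Pair n -` (U \<union> W)) = emeasure lborel (Pair n -` U) + emeasure lborel (Pair n -` W)" for n
    using assms by (subst plus_emeasure[OF slice_borel slice_borel]) (auto intro!: arg_cong2[where f=emeasure])
  then show ?thesis unfolding intensity_def by (simp add: suminf_add)
qed

lemma intensity_layer: "intensity ({n} \<times> A) = emeasure lborel A"
proof -
  have "(Pair m -` ({n} \<times> A)) = (if m = n then A else {})" for m by auto
  then show ?thesis unfolding intensity_def by (subst suminf_finite[of "{n}"]) auto
qed

lemma lborel_Times:
  fixes A :: "(real^'d) set" and B :: "real set"
  assumes "open A" "open B"
  shows "emeasure lborel (A \<times> B) = emeasure lborel A * emeasure lborel B"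
  using assms by (subst lborel_prod[symmetric]) (simp add: lborel.emeasure_pair_measure_Times)

text \<open>Layers are open, so it suffices to look at one layer at a time.\<close>

lemma open_shift:
  assumes "\<And>n. linear (Q n)" and U: "open U"
  shows "open {(g, e). layer_shift Q g e \<in> U}"
proof -
  have cQ: "continuous_on UNIV (Q n)" for n using assms(1) linear_continuous_on linear_conv_bounded_linear by blast
  let ?W = "\<lambda>n. {z. fst (snd z) = n \<and> (n, fst (snd (snd z)) + Q n (fst z), snd (snd (snd z))) \<in> U}"
  have "open (?W n)" for n
  proof -
    have c: "continuous_on UNIV (\<lambda>z. (fst (snd z), n, fst (snd (snd z)) + Q n (fst z), snd (snd (snd z))))"
      by (intro continuous_intros continuous_on_compose2[OF cQ]) auto
    have "open ({n} \<times> U)" using U by (intro open_Times discrete_topology_class.open_discrete)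
    then have "open ((\<lambda>z. (fst (snd z), n, fst (snd (snd z)) + Q n (fst z), snd (snd (snd z)))) -` ({n} \<times> U))"
      by (rule open_vimage[OF _ c])
    then show ?thesis by (simp add: vimage_def)
  qed
  then have "open (\<Union>n. ?W n)" by (intro open_UN) auto
  also have "(\<Union>n. ?W n) = {(g, e). layer_shift Q g e \<in> U}" by (auto simp: layer_shift_def)
  finally show ?thesis .
qed

lemma open_shift_vimage:
  assumes "\<And>n. linear (Q n)" and U: "open U"
  shows "open (layer_shift Q g -` U)"
proof -
  have "open (Pair g -` {(g, e). layer_shift Q g e \<in> U})"
    by (rule open_vimage[OF open_shift[OF assms]]) (intro continuous_intros)
  then show ?thesis by (simp add: vimage_def)
qed

lemma intensity_layer_shift:
  fixes U :: "(nat \<times> (real^'d) \<times> real) set"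
  assumes "open U"
  shows "intensity (layer_shift Q g -` U) = intensity U"
proof -
  have "emeasure lborel (Pair n -` (layer_shift Q g -` U)) = emeasure lborel (Pair n -` U)" for n
  proof -
    have "Pair n -` (layer_shift Q g -` U) = (+) (Q n g, 0) -` (Pair n -` U)"
      by (auto simp: layer_shift_def add.commute)
    moreover have "emeasure lborel (Pair n -` U) = emeasure (distr lborel borel ((+) (Q n g, 0::real))) (Pair n -` U)"
      by (simp add: lborel_distr_plus)
    moreover have "\<dots> = emeasure lborel ((+) (Q n g, 0) -` (Pair n -` U))"
      using slice_borel[OF assms] by (subst emeasure_distr) auto
    ultimately show ?thesis by simp
  qed
  then show ?thesis by (simp add: intensity_def)
qed

text \<open>Fibrewise invariance and Fubini.\<close>

lemma skew_product:
  assumes M: "prob_space M" and Y: "prob_space Y"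
    and T: "(\<lambda>(g, x). T g x) \<in> borel \<Otimes>\<^sub>M M \<rightarrow>\<^sub>M M" "\<And>g. distr M M (T g) = M"
    and a: "a \<in> Y \<rightarrow>\<^sub>M borel"
    and R: "R \<in> Y \<rightarrow>\<^sub>M Y" "distr Y Y R = Y"
  shows "(\<lambda>(x, y). (T (a y) x, R y)) \<in> M \<Otimes>\<^sub>M Y \<rightarrow>\<^sub>M M \<Otimes>\<^sub>M Y"
    and "distr (M \<Otimes>\<^sub>M Y) (M \<Otimes>\<^sub>M Y) (\<lambda>(x, y). (T (a y) x, R y)) = M \<Otimes>\<^sub>M Y"
proof -
  interpret M: prob_space M by fact
  interpret Y: prob_space Y by fact
  interpret MY: pair_sigma_finite M Y ..
  let ?S = "\<lambda>(x, y). (T (a y) x, R y)"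
  note [measurable] = a R(1)
  have T': "(\<lambda>z. T (a (snd z)) (fst z)) \<in> M \<Otimes>\<^sub>M Y \<rightarrow>\<^sub>M M"
  proof -
    have "(\<lambda>z. (a (snd z), fst z)) \<in> M \<Otimes>\<^sub>M Y \<rightarrow>\<^sub>M borel \<Otimes>\<^sub>M M" by measurable
    from measurable_comp[OF this T(1)] show ?thesis by (simp add: comp_def)
  qed
  have Tg: "T g \<in> M \<rightarrow>\<^sub>M M" for g
    using measurable_compose[OF measurable_Pair1'[of g borel M] T(1)] by simp
  have "(\<lambda>z. (T (a (snd z)) (fst z), R (snd z))) \<in> M \<Otimes>\<^sub>M Y \<rightarrow>\<^sub>M M \<Otimes>\<^sub>M Y"
    by (intro measurable_Pair T') measurable
  then show S: "?S \<in> M \<Otimes>\<^sub>M Y \<rightarrow>\<^sub>M M \<Otimes>\<^sub>M Y" by (simp add: split_beta')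
  show "distr (M \<Otimes>\<^sub>M Y) (M \<Otimes>\<^sub>M Y) ?S = M \<Otimes>\<^sub>M Y"
  proof (rule pair_measure_eqI[symmetric])
    fix A B assume A: "A \<in> sets M" and B: "B \<in> sets Y"
    then have AB: "A \<times> B \<in> sets (M \<Otimes>\<^sub>M Y)" by simp
    have RB: "R -` B \<inter> space Y \<in> sets Y" using R(1) B by (rule measurable_sets)
    have TA: "emeasure M (T g -` A \<inter> space M) = emeasure M A" for g
      using emeasure_distr[OF Tg[of g] A] T(2)[of g] by simp
    have sl: "emeasure M ((\<lambda>x. (x, y)) -` (?S -` (A \<times> B) \<inter> space (M \<Otimes>\<^sub>M Y)))
        = emeasure M A * indicator (R -` B \<inter> space Y) y" for y
    proof (cases "y \<in> R -` B \<inter> space Y")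
      case True
      then have "(\<lambda>x. (x, y)) -` (?S -` (A \<times> B) \<inter> space (M \<Otimes>\<^sub>M Y)) = T (a y) -` A \<inter> space M"
        by (auto simp: space_pair_measure)
      then show ?thesis using True TA by simp
    next
      case False
      then have "(\<lambda>x. (x, y)) -` (?S -` (A \<times> B) \<inter> space (M \<Otimes>\<^sub>M Y)) = {}"
        by (auto simp: space_pair_measure)
      then show ?thesis using False by simp
    qed
    have "emeasure (distr (M \<Otimes>\<^sub>M Y) (M \<Otimes>\<^sub>M Y) ?S) (A \<times> B)
        = emeasure (M \<Otimes>\<^sub>M Y) (?S -` (A \<times> B) \<inter> space (M \<Otimes>\<^sub>M Y))"
      by (rule emeasure_distr[OF S AB])
    also have "\<dots> = (\<integral>\<^sup>+y. emeasure M A * indicator (R -` B \<inter> space Y) y \<partial>Y)"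
      unfolding MY.emeasure_pair_measure_alt2[OF measurable_sets[OF S AB]] by (simp only: sl)
    also have "\<dots> = emeasure M A * emeasure Y (R -` B \<inter> space Y)"
      using RB by (rule nn_integral_cmult_indicator)
    also have "emeasure Y (R -` B \<inter> space Y) = emeasure Y B"
      using emeasure_distr[OF R(1) B] R(2) by simp
    finally show "emeasure M A * emeasure Y B = emeasure (distr (M \<Otimes>\<^sub>M Y) (M \<Otimes>\<^sub>M Y) ?S) (A \<times> B)" by simp
  qed (auto intro: M.sigma_finite_measure_axioms Y.sigma_finite_measure_axioms)
qed

definition void_event :: "'x measure \<Rightarrow> ('x \<Rightarrow> 'e set) \<Rightarrow> 'e set \<Rightarrow> 'x set" where
  "void_event M D U = {x \<in> space M. D x \<inter> U = {}}"

text \<open>\<open>D x\<close> is the configuration of points; \<open>void_event M D U\<close> is the event that it misses \<open>U\<close>.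
  The assumptions say that void events of bounded open sets generate, that they have Poisson
  probabilities, and that \<open>T\<close> moves configurations by \<open>layer_shift Q\<close>. Keeping the base space abstract hides the
  coding of configurations by reals.\<close>

locale poisson_system =
  fixes M :: "'x measure" and T :: "real^'d \<Rightarrow> 'x \<Rightarrow> 'x"
    and D :: "'x \<Rightarrow> (nat \<times> (real^'d) \<times> real) set" and Q :: "nat \<Rightarrow> real^'d \<Rightarrow> real^'d"
  assumes linear_Q: "\<And>n. linear (Q n)"
    and prob_M: "prob_space M"
    and V_sets: "\<And>U. open U \<Longrightarrow> void_event M D U \<in> sets M"
    and gen: "sets M = sigma_sets (space M) {void_event M D U | U. open U \<and> (\<exists>N. U \<subseteq> window N)}"
    and measure_V: "\<And>U. open U \<Longrightarrow> measure M (void_event M D U) = (if intensity U = \<infinity> then 0 else exp (- enn2real (intensity U)))"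
    and T_meas: "(\<lambda>(g, x). T g x) \<in> borel \<Otimes>\<^sub>M M \<rightarrow>\<^sub>M M"
    and T_0: "\<And>x. x \<in> space M \<Longrightarrow> T 0 x = x"
    and T_add: "\<And>g h x. x \<in> space M \<Longrightarrow> T (g + h) x = T g (T h x)"
    and D_T: "\<And>g x. x \<in> space M \<Longrightarrow> D (T g x) = layer_shift Q g ` D x"
begin

abbreviation "V \<equiv> void_event M D"

sublocale prob_space M by (rule prob_M)

lemma T_g[measurable]: "T g \<in> M \<rightarrow>\<^sub>M M"
  using measurable_compose[OF measurable_Pair1'[of g borel M] T_meas] by simp

lemma T_space: "x \<in> space M \<Longrightarrow> T g x \<in> space M"
  using measurable_space[OF T_g] .

lemma V_Int: "V U \<inter> V W = V (U \<union> W)"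
  unfolding void_event_def by auto

lemma V_subset: "V U \<subseteq> space M"
  unfolding void_event_def by auto

lemma V_empty: "V {} = space M"
  unfolding void_event_def by auto

lemma T_in_V: "x \<in> space M \<Longrightarrow> T g x \<in> V U \<longleftrightarrow> x \<in> V (layer_shift Q g -` U)"
  unfolding void_event_def using T_space by (auto simp: D_T)

lemma vimage_V: "T g -` V U \<inter> space M = V (layer_shift Q g -` U)"
  using T_in_V[of _ g U] subsetD[OF V_subset, of _ "layer_shift Q g -` U"] by auto

abbreviation "voids \<equiv> {V U | U. open U \<and> (\<exists>N. U \<subseteq> window N)}"

lemma Int_stable_voids: "Int_stable voids"
proof (rule Int_stableI)
  fix A B assume "A \<in> voids" "B \<in> voids"
  then obtain U W N N' where "A = V U" "B = V W" "open U" "open W" "U \<subseteq> window N" "W \<subseteq> window N'"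
    by auto
  moreover have "window N \<union> window N' \<subseteq> window (max N N')"
    using window_mono[of N "max N N'"] window_mono[of N' "max N N'"] by simp
  ultimately have "A \<inter> B = V (U \<union> W)" "open (U \<union> W)" "U \<union> W \<subseteq> window (max N N')"
    by (auto simp: V_Int)
  then show "A \<inter> B \<in> voids" by blast
qed

lemma voids_Pow: "voids \<subseteq> Pow (space M)"
  using V_subset by auto

lemma space_voids: "space M \<in> voids"
  using V_empty by (intro CollectI exI[of _ "{}"]) auto

lemma measure_V_shift: "open U \<Longrightarrow> measure M (V (layer_shift Q g -` U)) = measure M (V U)"
  by (simp add: measure_V open_shift_vimage[OF linear_Q] intensity_layer_shift)

lemma T_mp: "distr M M (T g) = M"
proof (rule measure_eqI_generator_eq[OF Int_stable_voids voids_Pow, where A="\<lambda>_. space M"])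
  show "sets (distr M M (T g)) = sigma_sets (space M) voids" using gen by simp
  fix X assume "X \<in> voids"
  then obtain U where U: "X = V U" "open U" by auto
  have "emeasure (distr M M (T g)) X = emeasure M (V (layer_shift Q g -` U))"
    using U V_sets by (subst emeasure_distr) (auto simp: vimage_V)
  then show "emeasure (distr M M (T g)) X = emeasure M X"
    using measure_V_shift[OF U(2)] U by (simp add: emeasure_eq_measure)
next
  show "range (\<lambda>_. space M) \<subseteq> voids" using space_voids by auto
qed (use gen in \<open>auto simp: emeasure_distr emeasure_space_1\<close>)

text \<open>Disjoint sets have additive intensity; this is the independence property of the Poisson process.\<close>

lemma measure_V_Un:
  assumes "open U" "open W" "U \<inter> W = {}"
  shows "measure M (V (U \<union> W)) = measure M (V U) * measure M (V W)"
  using assms measure_V[of U] measure_V[of W] measure_V[of "U \<union> W"] intensity_Un_disjoint[OF assms]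
  by (auto simp: mult_exp_exp enn2real_plus less_top[symmetric] open_Un)

text \<open>A window is bounded and meets finitely many layers only, so vectors that escape in every layer
  eventually move it off itself, uniformly in \<open>y\<close>.\<close>

lemma window_disjoint:
  assumes esc: "\<And>n R. eventually (\<lambda>k. \<forall>y\<in>B. norm (Q n (a k y)) > R) sequentially"
  shows "eventually (\<lambda>k. \<forall>y\<in>B. window N \<inter> layer_shift Q (a k y) -` window N = {}) sequentially"
proof -
  have "eventually (\<lambda>k. \<forall>n\<in>{..N}. \<forall>y\<in>B. norm (Q n (a k y)) > 2 * real N) sequentially"
    by (intro eventually_ball_finite ballI esc) simp
  then show ?thesis
  proof eventually_elim
    case (elim k)
    have False if y: "y \<in> B" and z: "z \<in> window N" "layer_shift Q (a k y) z \<in> window N" for y z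
    proof -
      obtain n x u where zz: "z = (n, x, u)" by (cases z)
      have "n \<le> N" and "norm x < real N" "norm (x + Q n (a k y)) < real N"
        using z by (auto simp: zz window_def layer_shift_def)
      moreover have "norm (Q n (a k y)) \<le> norm (x + Q n (a k y)) + norm x"
        using norm_triangle_ineq4[of "x + Q n (a k y)" x] by simp
      moreover have "2 * real N < norm (Q n (a k y))" using elim y \<open>n \<le> N\<close> by auto
      ultimately show False by linarith
    qed
    then show ?case by blast
  qed
qed

text \<open>All three weak mixing statements below are instances: the vectors \<open>a k y\<close> are \<open>k v\<close>, its integer part, or
  the integer part of \<open>k v + y\<close> for \<open>y\<close> in the torus.\<close>

lemma skew_eigenfunction_factors:
  fixes Y :: "'y measure" and F :: "'x \<times> 'y \<Rightarrow> complex"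
  assumes Y: "prob_space Y"
    and a[measurable]: "\<And>k. a k \<in> Y \<rightarrow>\<^sub>M borel"
    and R: "\<And>k. R k \<in> Y \<rightarrow>\<^sub>M Y" "\<And>k. distr Y Y (R k) = Y"
    and esc: "\<And>n r. eventually (\<lambda>k. \<forall>y\<in>space Y. norm (Q n (a k y)) > r) sequentially"
    and F: "F \<in> borel_measurable (M \<Otimes>\<^sub>M Y)"
    and c: "\<And>k. cmod (c k) = 1" "\<And>k. AE z in M \<Otimes>\<^sub>M Y. F (T (a k (snd z)) (fst z), R k (snd z)) = c k * F z"
  shows "\<exists>f \<in> borel_measurable Y. AE z in M \<Otimes>\<^sub>M Y. F z = f (snd z)"
proof (rule eigenfunction_factors[OF prob_M Y gen voids_Pow Int_stable_voids space_voids _ _ R _ F c(1),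
      where S="\<lambda>k (x, y). (T (a k y) x, R k y)"])
  interpret Y: prob_space Y by fact
  interpret MY: pair_sigma_finite M Y ..
  note sk = skew_product[OF prob_M Y T_meas T_mp a R]
  show "(\<lambda>(x, y). (T (a k y) x, R k y)) \<in> M \<Otimes>\<^sub>M Y \<rightarrow>\<^sub>M M \<Otimes>\<^sub>M Y" for k by (rule sk)
  show "distr (M \<Otimes>\<^sub>M Y) (M \<Otimes>\<^sub>M Y) (\<lambda>(x, y). (T (a k y) x, R k y)) = M \<Otimes>\<^sub>M Y" for k by (rule sk)
  show "AE z in M \<Otimes>\<^sub>M Y. F ((\<lambda>(x, y). (T (a k y) x, R k y)) z) = c k * F z" for k
    using c(2)[of k] by (simp add: split_beta')
  fix A B C E assume A: "A \<in> voids" and B: "B \<in> voids" and C: "C \<in> sets Y" and E: "E \<in> sets Y"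
  obtain U W N0 N1 where "A = V W" "B = V U" and o: "open U" "open W" and w: "U \<subseteq> window N0" "W \<subseteq> window N1"
    using A B by auto
  note AB = \<open>A = V W\<close> \<open>B = V U\<close>
  define N where "N = max N0 N1"
  have UW: "U \<subseteq> window N" "W \<subseteq> window N"
    using w window_mono[of N0 N] window_mono[of N1 N] by (auto simp: N_def)
  show "eventually (\<lambda>k. measure (M \<Otimes>\<^sub>M Y) {z \<in> space (M \<Otimes>\<^sub>M Y).
        (case z of (x, y) \<Rightarrow> (T (a k y) x, R k y)) \<in> A \<times> C \<and> z \<in> B \<times> E} =
      measure M A * measure M B * measure Y {y \<in> space Y. R k y \<in> C \<and> y \<in> E}) sequentially"
    using window_disjoint[OF esc, of N]
  proof eventually_elim
    case (elim k)
    let ?P = "{z \<in> space (M \<Otimes>\<^sub>M Y). (case z of (x, y) \<Rightarrow> (T (a k y) x, R k y)) \<in> A \<times> C \<and> z \<in> B \<times> E}"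
    let ?K = "{y \<in> space Y. R k y \<in> C \<and> y \<in> E}"
    have Am: "A \<in> sets M" "B \<in> sets M" using AB o V_sets by auto
    have "?P = ((\<lambda>(x, y). (T (a k y) x, R k y)) -` (A \<times> C) \<inter> space (M \<Otimes>\<^sub>M Y)) \<inter> (B \<times> E)" by auto
    moreover have "\<dots> \<in> sets (M \<Otimes>\<^sub>M Y)"
      using Am C E by (intro sets.Int measurable_sets[OF sk(1)] pair_measureI) auto
    ultimately have Pm: "?P \<in> sets (M \<Otimes>\<^sub>M Y)" by simp
    have Km: "?K \<in> sets Y"
    proof -
      have "?K = (R k -` C \<inter> space Y) \<inter> E" by auto
      then show ?thesis using measurable_sets[OF R(1) C, of k] E by simp
    qed
    have sl: "emeasure M ((\<lambda>x. (x, y)) -` ?P) = ennreal (measure M A * measure M B) * indicator ?K y" for y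
    proof (cases "y \<in> ?K")
      case True
      have "(\<lambda>x. (x, y)) -` ?P = V (layer_shift Q (a k y) -` W) \<inter> V U"
        using True V_subset by (auto simp: space_pair_measure AB T_in_V dest: subsetD[OF V_subset])
      also have "\<dots> = V (layer_shift Q (a k y) -` W \<union> U)" by (rule V_Int)
      also have "emeasure M \<dots> = ennreal (measure M (V (layer_shift Q (a k y) -` W)) * measure M (V U))"
        unfolding emeasure_eq_measure
      proof (subst measure_V_Un)
        show "layer_shift Q (a k y) -` W \<inter> U = {}" using elim True UW by blast
      qed (use o open_shift_vimage[OF linear_Q] in auto)
      finally show ?thesis using True by (simp add: measure_V_shift o AB)
    next
      case False
      then have e: "(\<lambda>x. (x, y)) -` ?P = {}" by (auto simp: space_pair_measure)
      show ?thesis using False unfolding e by simp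
    qed
    have "emeasure (M \<Otimes>\<^sub>M Y) ?P = (\<integral>\<^sup>+y. ennreal (measure M A * measure M B) * indicator ?K y \<partial>Y)"
      unfolding MY.emeasure_pair_measure_alt2[OF Pm] by (simp only: sl)
    also have "\<dots> = ennreal (measure M A * measure M B) * emeasure Y ?K"
      using Km by (rule nn_integral_cmult_indicator)
    also have "\<dots> = ennreal (measure M A * measure M B * measure Y ?K)"
      unfolding Y.emeasure_eq_measure by (rule ennreal_mult'[symmetric]) simp
    finally show ?case by (intro measure_eq_emeasure_eq_ennreal) simp_all
  qed
qed

end

section \<open>The unit suspension and weak mixing directions\<close>

definition of_int_vec :: "int^'d \<Rightarrow> real^'d" where
  "of_int_vec g = (\<chi> i. of_int (g $ i))"

lemma of_int_vec_add: "of_int_vec (g + h) = of_int_vec g + of_int_vec h"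
  by (simp add: of_int_vec_def vec_eq_iff)

lemma of_int_vec_0: "of_int_vec 0 = 0"
  by (simp add: of_int_vec_def vec_eq_iff)

lemma of_int_vec_eq_0: "of_int_vec g = 0 \<longleftrightarrow> g = 0"
  by (simp add: of_int_vec_def vec_eq_iff)

lemma floor_plus_frac: "of_int_vec (vec_floor w) + vec_frac w = w"
  by (simp add: of_int_vec_def vec_floor_def vec_frac_def vec_eq_iff frac_def)

lemma of_int_vec_borel: "of_int_vec \<in> borel \<rightarrow>\<^sub>M borel"
proof (rule borel_measurable_continuous_onI)
  have "continuous_on UNIV (\<lambda>g::int^'d. real_of_int (g $ i))" for i
  proof -
    have "continuous_on UNIV real_of_int"
      by (simp add: continuous_on_open_vimage discrete_topology_class.open_discrete)
    moreover have "continuous_on UNIV (\<lambda>g::int^'d. g $ i)"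
      by (intro continuous_intros)
    ultimately show ?thesis by (rule continuous_on_compose2) auto
  qed
  then show "continuous_on UNIV (of_int_vec :: int^'d \<Rightarrow> real^'d)"
    unfolding of_int_vec_def by (rule continuous_on_vec_lambda)
qed

lemma borel_measurable_vecI:
  fixes f :: "'a \<Rightarrow> real^'d"
  assumes "\<And>i. (\<lambda>x. f x $ i) \<in> borel_measurable N"
  shows "f \<in> borel_measurable N"
  unfolding borel_measurable_euclidean_space[of f]
  using assms by (auto simp: Basis_vec_def inner_axis)

lemma vec_nth_borel[measurable]: "(\<lambda>x::real^'d. x $ i) \<in> borel_measurable borel"
  by (intro borel_measurable_continuous_onI continuous_intros)

lemma vec_floor_borel: "(\<lambda>w::real^'d. of_int_vec (vec_floor w)) \<in> borel_measurable borel"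
proof (rule borel_measurable_vecI)
  fix i :: 'd
  have "(\<lambda>w::real^'d. real_of_int \<lfloor>w $ i\<rfloor>) \<in> borel_measurable borel" by measurable
  then show "(\<lambda>w::real^'d. of_int_vec (vec_floor w) $ i) \<in> borel_measurable borel"
    by (simp add: of_int_vec_def vec_floor_def)
qed

lemma vec_frac_borel: "vec_frac \<in> borel_measurable (borel :: (real^'d) measure)"
proof -
  have "vec_frac = (\<lambda>w::real^'d. w - of_int_vec (vec_floor w))"
    using floor_plus_frac by (metis add_diff_cancel_left' ext)
  then show ?thesis by (rule ssubst) (intro borel_measurable_diff vec_floor_borel measurable_ident_sets refl)
qed

abbreviation cube :: "(real^'d) set" where
  "cube \<equiv> {r. \<forall>i. 0 \<le> r $ i \<and> r $ i < 1}"

lemma cube_borel: "cube \<in> sets (borel :: (real^'d) measure)"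
  by measurable

lemma space_unit_cube: "space unit_cube = cube"
  by (simp add: unit_cube_def space_restrict_space)

lemma sets_unit_cube: "A \<in> sets unit_cube \<longleftrightarrow> A \<subseteq> cube \<and> A \<in> sets borel"
  unfolding unit_cube_def using cube_borel by (subst sets_restrict_space_iff) auto

lemma emeasure_unit_cube: "A \<in> sets unit_cube \<Longrightarrow> emeasure unit_cube A = emeasure lborel A"
  unfolding unit_cube_def using cube_borel
  by (subst emeasure_restrict_space) (auto simp: sets_unit_cube[unfolded unit_cube_def])

lemma One_inner_Basis: "b \<in> Basis \<Longrightarrow> (One :: 'a::euclidean_space) \<bullet> b = 1"
  by (simp add: inner_sum_left inner_Basis)

lemma prob_space_unit_cube: "prob_space (unit_cube :: (real^'d) measure)"
proof (rule prob_spaceI, rule antisym)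
  have One: "(One :: real^'d) $ i = 1" for i
  proof -
    have "(One :: real^'d) \<bullet> axis i 1 = 1" by (rule One_inner_Basis) simp
    then show ?thesis by (simp only: inner_axis inner_real_def mult_1_right)
  qed
  have c: "(cube :: (real^'d) set) \<in> sets unit_cube" by (simp add: sets_unit_cube cube_borel)
  have sub: "cube \<subseteq> cbox 0 (One :: real^'d)" "box 0 (One :: real^'d) \<subseteq> cube"
    unfolding subset_iff mem_box_cart One by (auto simp: less_imp_le)
  have "emeasure lborel (cube :: (real^'d) set) \<le> emeasure lborel (cbox 0 (One :: real^'d))"
    using sub(1) by (intro emeasure_mono) auto
  then show "emeasure (unit_cube :: (real^'d) measure) (space unit_cube) \<le> 1"
    using c by (simp add: space_unit_cube emeasure_unit_cube emeasure_lborel_cbox_eq)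
  have "emeasure lborel (box 0 (One :: real^'d)) \<le> emeasure lborel (cube :: (real^'d) set)"
    using cube_borel sub(2) by (intro emeasure_mono) auto
  then show "1 \<le> emeasure (unit_cube :: (real^'d) measure) (space unit_cube)"
    using c by (simp add: space_unit_cube emeasure_unit_cube emeasure_lborel_box_eq)
qed

lemma vec_frac_cube: "vec_frac w \<in> cube"
  by (simp add: vec_frac_def frac_lt_1)

lemma floor_eq_iff_cube: "vec_floor w = n \<longleftrightarrow> w - of_int_vec n \<in> cube"
proof -
  have "\<lfloor>w $ i\<rfloor> = n $ i \<longleftrightarrow> 0 \<le> w $ i - of_int (n $ i) \<and> w $ i - of_int (n $ i) < 1" for i
    by linarith
  then show ?thesis by (simp add: vec_floor_def of_int_vec_def vec_eq_iff)
qed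

lemma torus_translation_measurable: "(\<lambda>r. vec_frac (t + r)) \<in> unit_cube \<rightarrow>\<^sub>M unit_cube"
proof -
  have "(\<lambda>r. vec_frac (t + r)) \<in> borel_measurable borel"
    by (rule measurable_compose[OF _ vec_frac_borel]) measurable
  then have "(\<lambda>r. vec_frac (t + r)) \<in> unit_cube \<rightarrow>\<^sub>M lborel"
    unfolding unit_cube_def by (intro measurable_restrict_space1) simp
  then show ?thesis using vec_frac_cube
    by (subst (2) unit_cube_def) (auto intro!: measurable_restrict_space2)
qed

text \<open>The translated cube is cut along the integer lattice and reassembled.\<close>

lemma torus_translation_mp: "distr unit_cube unit_cube (\<lambda>r. vec_frac (t + r)) = (unit_cube :: (real^'d) measure)"
proof (rule measure_eqI)
  fix A :: "(real^'d) set" assume "A \<in> sets (distr unit_cube unit_cube (\<lambda>r. vec_frac (t + r)))"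
  then have A: "A \<in> sets unit_cube" by simp
  then have Ab: "A \<subseteq> cube" "A \<in> sets borel" by (auto simp: sets_unit_cube)
  let ?P = "(\<lambda>r. vec_frac (t + r)) -` A \<inter> space unit_cube"
  have Pm: "?P \<in> sets unit_cube" by (rule measurable_sets[OF torus_translation_measurable A])
  \<comment> \<open>The piece of the cube that is moved by \<^term>\<open>t\<close> into \<^term>\<open>A\<close> shifted by \<^term>\<open>n\<close>, and the corresponding
    piece of \<^term>\<open>A\<close>; the pieces are translates of each other and partition both sets.\<close>
  define X where "X = (\<lambda>n::int^'d. cube \<inter> (\<lambda>r. (t - of_int_vec n) + r) -` A)"
  define Z where "Z = (\<lambda>n::int^'d. A \<inter> (\<lambda>s. (of_int_vec n - t) + s) -` cube)"
  have tr: "(\<lambda>r. (c::real^'d) + r) -` B \<in> sets borel" if "B \<in> sets borel" for c B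
  proof -
    have "(\<lambda>r. c + r) \<in> borel_measurable borel" by measurable
    from measurable_sets[OF this that] show ?thesis by simp
  qed
  have Xm: "X n \<in> sets lborel" "Z n \<in> sets lborel" for n
    using tr[OF Ab(2)] tr[OF cube_borel] Ab(2) cube_borel by (auto simp: X_def Z_def)
  have XZ: "emeasure lborel (X n) = emeasure lborel (Z n)" for n
  proof -
    have "emeasure lborel (X n) = emeasure (distr lborel borel ((+) (of_int_vec n - t))) (X n)"
      by (simp add: lborel_distr_plus)
    also have "\<dots> = emeasure lborel ((+) (of_int_vec n - t) -` X n)"
      using Xm(1)[of n] by (subst emeasure_distr) auto
    also have "(+) (of_int_vec n - t) -` X n = Z n" by (auto simp: X_def Z_def)
    finally show ?thesis .
  qed
  have fl: "r \<in> X n \<Longrightarrow> vec_floor (t + r) = n" for r n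
    using Ab(1) by (auto simp: X_def floor_eq_iff_cube algebra_simps)
  have PX: "?P = (\<Union>n. X n)"
  proof (intro set_eqI iffI)
    fix r assume r: "r \<in> ?P"
    have "vec_frac (t + r) = (t - of_int_vec (vec_floor (t + r))) + r"
      using floor_plus_frac[of "t + r"] by (simp add: algebra_simps eq_diff_eq)
    then have "r \<in> X (vec_floor (t + r))" using r by (simp add: X_def space_unit_cube)
    then show "r \<in> (\<Union>n. X n)" by blast
  next
    fix r assume "r \<in> (\<Union>n. X n)"
    then obtain n where n: "r \<in> X n" by blast
    have "vec_frac (t + r) = (t - of_int_vec n) + r"
      using floor_plus_frac[of "t + r"] fl[OF n] by (simp add: algebra_simps eq_diff_eq)
    then show "r \<in> ?P" using n by (simp add: X_def space_unit_cube)
  qed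
  have AZ: "A = (\<Union>n. Z n)"
  proof (intro set_eqI iffI)
    fix s assume s: "s \<in> A"
    have "(s - t) - of_int_vec (vec_floor (s - t)) \<in> cube" using floor_eq_iff_cube by blast
    then have "(of_int_vec (- vec_floor (s - t)) - t) + s \<in> cube"
      by (simp add: of_int_vec_def algebra_simps)
    then show "s \<in> (\<Union>n. Z n)" using s by (auto simp: Z_def)
  qed (auto simp: Z_def)
  have dX: "disjoint_family X" unfolding disjoint_family_on_def using fl by blast
  have flZ: "s \<in> Z n \<Longrightarrow> vec_floor (s - t) = - n" for s n
    by (auto simp: Z_def floor_eq_iff_cube of_int_vec_def algebra_simps)
  have dZ: "disjoint_family Z" unfolding disjoint_family_on_def using flZ by (metis disjoint_iff neg_equal_iff_equal)
  have "emeasure (distr unit_cube unit_cube (\<lambda>r. vec_frac (t + r))) A = emeasure lborel ?P"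
    using emeasure_distr[OF torus_translation_measurable A] emeasure_unit_cube[OF Pm] by simp
  also have "\<dots> = (\<integral>\<^sup>+n. emeasure lborel (X n) \<partial>count_space UNIV)"
    unfolding PX using Xm dX by (intro emeasure_UN_countable) auto
  also have "\<dots> = (\<integral>\<^sup>+n. emeasure lborel (Z n) \<partial>count_space UNIV)" by (simp only: XZ)
  also have "\<dots> = emeasure lborel (\<Union>n. Z n)"
    using Xm dZ by (intro emeasure_UN_countable[symmetric]) auto
  also have "\<dots> = emeasure unit_cube A" unfolding AZ[symmetric] emeasure_unit_cube[OF A] ..
  finally show "emeasure (distr unit_cube unit_cube (\<lambda>r. vec_frac (t + r))) A = emeasure unit_cube A" .
qed simp

lemma norm_vec_frac: "norm (vec_frac (w :: real^'d)) \<le> real CARD('d)"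
proof -
  have "norm (vec_frac w) \<le> (\<Sum>i\<in>UNIV. \<bar>vec_frac w $ i\<bar>)" by (rule norm_le_l1_cart)
  also have "\<dots> \<le> (\<Sum>i\<in>(UNIV :: 'd set). 1)"
    by (intro sum_mono) (simp add: vec_frac_def less_imp_le frac_lt_1)
  finally show ?thesis by simp
qed

lemma norm_cube: "r \<in> cube \<Longrightarrow> norm (r :: real^'d) \<le> real CARD('d)"
proof -
  assume r: "r \<in> cube"
  have "norm r \<le> (\<Sum>i\<in>UNIV. \<bar>r $ i\<bar>)" by (rule norm_le_l1_cart)
  also have "\<dots> \<le> (\<Sum>i\<in>(UNIV :: 'd set). 1)" using r by (intro sum_mono) (simp add: less_imp_le)
  finally show ?thesis by simp
qed

lemma norm_floor_diff: "norm (of_int_vec (vec_floor w) - (w :: real^'d)) \<le> real CARD('d)"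
proof -
  have "of_int_vec (vec_floor w) - w = - vec_frac w"
    using floor_plus_frac[of w] by (simp add: algebra_simps add_eq_0_iff2)
  then show ?thesis using norm_vec_frac[of w] by simp
qed

context poisson_system
begin

text \<open>A bounded error does not matter; this is what allows integer parts in place of multiples of \<open>v\<close>.\<close>

lemma escape:
  assumes v: "\<And>n. Q n v \<noteq> 0" and C: "\<And>k y. y \<in> B \<Longrightarrow> norm (a k y - real k *\<^sub>R v) \<le> C"
  shows "eventually (\<lambda>k. \<forall>y\<in>B. norm (Q n (a k y)) > r) sequentially"
proof -
  obtain K where K: "K > 0" "\<And>x. norm (Q n x) \<le> K * norm x"
    using linear_bounded_pos[OF linear_Q] by blast
  obtain k0 :: nat where k0: "real k0 * norm (Q n v) > r + K * C"
    using reals_Archimedean3[of "norm (Q n v)"] v by (metis zero_less_norm_iff)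
  have "norm (Q n (a k y)) > r" if k: "k \<ge> k0" and y: "y \<in> B" for k y
  proof -
    have "Q n (a k y) = Q n (a k y - real k *\<^sub>R v) + real k *\<^sub>R Q n v"
      using linear_Q[of n] by (simp add: linear_diff linear_scale)
    then have "norm (real k *\<^sub>R Q n v) \<le> norm (Q n (a k y)) + norm (Q n (a k y - real k *\<^sub>R v))"
      using norm_triangle_ineq4[of "Q n (a k y)" "Q n (a k y - real k *\<^sub>R v)"] by simp
    moreover have "norm (Q n (a k y - real k *\<^sub>R v)) \<le> K * C"
      using K(2)[of "a k y - real k *\<^sub>R v"] C[OF y, of k] K(1) by (meson mult_left_mono less_imp_le order_trans)
    moreover have "real k0 * norm (Q n v) \<le> real k * norm (Q n v)"
      using k by (intro mult_right_mono) auto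
    ultimately show ?thesis using k0 by simp
  qed
  then show ?thesis unfolding eventually_sequentially by blast
qed

text \<open>The case of a one-point second factor in \<open>skew_eigenfunction_factors\<close>.\<close>

lemma eigenfunction_constant:
  assumes v: "\<And>n. Q n v \<noteq> 0" and C: "\<And>k. norm (g k - real k *\<^sub>R v) \<le> C"
    and F[measurable]: "F \<in> borel_measurable M"
    and c: "\<And>k. cmod (c k) = 1" "\<And>k. AE x in M. F (T (g k) x) = c k * F x"
  shows "ae_constant M F"
proof -
  define Y where "Y = return (count_space (UNIV :: unit set)) ()"
  have Y: "prob_space Y" unfolding Y_def by (rule prob_space_return) simp
  interpret Y: prob_space Y by fact
  have f: "distr (M \<Otimes>\<^sub>M Y) M fst = M" by (rule Y.distr_pair_fst)
  have up: "AE z in M \<Otimes>\<^sub>M Y. P (fst z)" if "AE x in M. P x" for P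
  proof -
    have "AE x in distr (M \<Otimes>\<^sub>M Y) M fst. P x" unfolding f by (rule that)
    then show ?thesis by (rule AE_distrD[OF measurable_fst])
  qed
  have "\<exists>f \<in> borel_measurable Y. AE z in M \<Otimes>\<^sub>M Y. F (fst z) = f (snd z)"
  proof (rule skew_eigenfunction_factors[OF Y, where a="\<lambda>k _. g k" and R="\<lambda>_ y. y" and c=c])
    show "distr Y Y (\<lambda>y. y) = Y" by (rule distr_id)
    show "(\<lambda>y. y) \<in> Y \<rightarrow>\<^sub>M Y" by (rule measurable_ident_sets) (rule refl)
    show "eventually (\<lambda>k. \<forall>y\<in>space Y. norm (Q n (g k)) > r) sequentially" for n r
      by (rule escape[OF v]) (rule C)
    show "AE z in M \<Otimes>\<^sub>M Y. F (fst (T (g k) (fst z), snd z)) = c k * F (fst z)" for k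
      using up[OF c(2)[of k]] by simp
  qed (use c in auto)
  then obtain f where "AE z in M \<Otimes>\<^sub>M Y. F (fst z) = f (snd z)" by blast
  then have "AE z in M \<Otimes>\<^sub>M Y. F (fst z) = f ()" by simp
  then have "AE x in distr (M \<Otimes>\<^sub>M Y) M fst. F x = f ()"
    by (subst AE_distr_iff) auto
  then show ?thesis unfolding ae_constant_def f by blast
qed

lemma weak_mixing_R:
  assumes v: "\<And>n. Q n v \<noteq> 0" and H: "subspace H" "v \<in> H"
  shows "weak_mixing_on H M T"
  unfolding weak_mixing_on_def eigenfunction_on_def
proof (intro allI impI, elim conjE exE)
  fix f \<gamma> assume f: "f \<in> L2 M" and g: "character_on H \<gamma>" "\<forall>g\<in>H. AE x in M. f (T g x) = \<gamma> g * f x"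
  have kv: "real k *\<^sub>R v \<in> H" for k using H by (simp add: subspace_scale)
  show "ae_constant M f"
    by (rule eigenfunction_constant[OF v, where g="\<lambda>k. real k *\<^sub>R v" and C=0 and c="\<lambda>k. \<gamma> (real k *\<^sub>R v)"])
      (use f g kv in \<open>auto simp: L2_def character_on_def\<close>)
qed

text \<open>Along the integer parts of \<open>k v\<close>, although \<open>v\<close> itself may have to be irrational: integer vectors can all lie
  in non-ergodic directions.\<close>

lemma weak_mixing_Z:
  assumes v: "\<And>n. Q n v \<noteq> 0"
  shows "weak_mixing_on UNIV M (\<lambda>g. T (of_int_vec g))"
  unfolding weak_mixing_on_def eigenfunction_on_def
proof (intro allI impI, elim conjE exE)
  fix f and \<gamma> :: "int^'d \<Rightarrow> complex"
  assume f: "f \<in> L2 M" and g: "character_on UNIV \<gamma>" "\<forall>g\<in>UNIV. AE x in M. f (T (of_int_vec g) x) = \<gamma> g * f x"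
  show "ae_constant M f"
    by (rule eigenfunction_constant[OF v, where g="\<lambda>k. of_int_vec (vec_floor (real k *\<^sub>R v))"
          and C="real CARD('d)" and c="\<lambda>k. \<gamma> (vec_floor (real k *\<^sub>R v))"])
      (use f g norm_floor_diff in \<open>auto simp: L2_def character_on_def\<close>)
qed

text \<open>An eigenfunction of the suspension in the direction \<open>L\<close> is a function of the torus coordinate alone, so
  being orthogonal to all such functions it would be orthogonal to itself.\<close>

lemma direction_eigenfunction_not_perp:
  assumes v: "\<And>n. Q n v \<noteq> 0" and L: "subspace L" "v \<in> L"
    and F: "direction_eigenfunction M (\<lambda>g. T (of_int_vec g)) L F"
  shows "F \<notin> L2_perp M"
proof
  assume perp: "F \<in> L2_perp M"
  interpret Y: prob_space "unit_cube :: (real^'d) measure" by (rule prob_space_unit_cube)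
  let ?Z = "M \<Otimes>\<^sub>M (unit_cube :: (real^'d) measure)"
  obtain l where l: "l \<in> L" and
    eig: "\<And>t. t \<in> L \<Longrightarrow> AE y in ?Z. F (suspension (\<lambda>g. T (of_int_vec g)) t y) = exp (2 * of_real pi * \<i> * of_real (l \<bullet> t)) * F y"
    and F2: "F \<in> L2 ?Z" and nz: "nonzero_fun ?Z F"
    using F unfolding direction_eigenfunction_def suspension_space_def by blast
  have Fm[measurable]: "F \<in> borel_measurable ?Z" and Fi: "integrable ?Z (\<lambda>z. (cmod (F z))\<^sup>2)"
    using F2 by (auto simp: L2_def)
  have kv: "real k *\<^sub>R v \<in> L" for k using L by (simp add: subspace_scale)
  have "\<exists>f \<in> borel_measurable unit_cube. AE z in ?Z. F z = f (snd z)"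
  proof (rule skew_eigenfunction_factors[OF prob_space_unit_cube,
        where a="\<lambda>k r. of_int_vec (vec_floor (real k *\<^sub>R v + r))" and R="\<lambda>k r. vec_frac (real k *\<^sub>R v + r)"
          and c="\<lambda>k. exp (2 * of_real pi * \<i> * of_real (l \<bullet> (real k *\<^sub>R v)))"])
    show "(\<lambda>r. of_int_vec (vec_floor (real k *\<^sub>R v + r))) \<in> unit_cube \<rightarrow>\<^sub>M borel" for k
    proof -
      have "(\<lambda>r. of_int_vec (vec_floor (real k *\<^sub>R v + r)) :: real^'d) \<in> borel_measurable borel"
        by (rule measurable_compose[OF _ vec_floor_borel]) measurable
      then show ?thesis unfolding unit_cube_def by (intro measurable_restrict_space1) simp
    qed
    show "eventually (\<lambda>k. \<forall>y\<in>space unit_cube. norm (Q n (of_int_vec (vec_floor (real k *\<^sub>R v + y)))) > r) sequentially" for n r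
    proof (rule escape[OF v])
      fix k and y :: "real^'d" assume y: "y \<in> space unit_cube"
      have eq: "of_int_vec (vec_floor (real k *\<^sub>R v + y)) - real k *\<^sub>R v
        = (of_int_vec (vec_floor (real k *\<^sub>R v + y)) - (real k *\<^sub>R v + y)) + y" by simp
      have "y \<in> cube" using y by (simp add: space_unit_cube)
      then show "norm (of_int_vec (vec_floor (real k *\<^sub>R v + y)) - real k *\<^sub>R v) \<le> real CARD('d) + real CARD('d)"
        unfolding eq by (intro order_trans[OF norm_triangle_ineq] add_mono norm_floor_diff norm_cube)
    qed
    show "cmod (exp (2 * of_real pi * \<i> * of_real (l \<bullet> (real k *\<^sub>R v)))) = 1" for k
      by (simp add: norm_exp_eq_Re)
    show "AE z in ?Z. F (T (of_int_vec (vec_floor (real k *\<^sub>R v + snd z))) (fst z), vec_frac (real k *\<^sub>R v + snd z))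
       = exp (2 * of_real pi * \<i> * of_real (l \<bullet> (real k *\<^sub>R v))) * F z" for k
      using eig[OF kv[of k]] by (simp add: suspension_def split_beta')
  qed (use torus_translation_measurable torus_translation_mp in auto)
  then obtain f where f[measurable]: "f \<in> borel_measurable unit_cube" and Ff: "AE z in ?Z. F z = f (snd z)" by blast
  have ds: "distr ?Z unit_cube snd = unit_cube" using prob_M prob_space_unit_cube by (rule distr_snd_pair)
  have "integrable ?Z (\<lambda>z. (cmod (f (snd z)))\<^sup>2)"
    using Fi by (rule integrable_cong_AE_imp) (use Ff in auto)
  then have "integrable (distr ?Z unit_cube snd) (\<lambda>r. (cmod (f r))\<^sup>2)"
    by (subst integrable_distr_eq) auto
  then have "f \<in> L2 unit_cube" using f by (simp add: L2_def ds)
  then have "(\<lambda>(x, s). f s) \<in> (L2_base :: ('x \<times> (real^'d) \<Rightarrow> complex) set)" unfolding L2_base_def by blast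
  then have "(\<integral>z. F z * cnj ((\<lambda>(x, s). f s) z) \<partial>?Z) = 0"
    using perp unfolding L2_perp_def suspension_space_def by blast
  moreover have "(\<integral>z. F z * cnj ((\<lambda>(x, s). f s) z) \<partial>?Z) = (\<integral>z. of_real ((cmod (F z))\<^sup>2) \<partial>?Z)"
  proof (rule integral_cong_AE)
    have [measurable]: "cnj \<in> borel_measurable borel"
      by (intro borel_measurable_continuous_onI continuous_intros)
    show "(\<lambda>z. F z * cnj ((\<lambda>(x, s). f s) z)) \<in> borel_measurable ?Z" by measurable
    show "AE z in ?Z. F z * cnj ((\<lambda>(x, s). f s) z) = of_real ((cmod (F z))\<^sup>2)"
      using Ff
    proof eventually_elim
      fix z assume "F z = f (snd z)"
      then have "(\<lambda>(x, s). f s) z = F z" by (simp add: split_beta')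
      then show "F z * cnj ((\<lambda>(x, s). f s) z) = of_real ((cmod (F z))\<^sup>2)"
        by (simp only: complex_norm_square)
    qed
  qed measurable
  ultimately have "(\<integral>z. (cmod (F z))\<^sup>2 \<partial>?Z) = 0"
    by (simp only: integral_complex_of_real of_real_eq_0_iff)
  then have "AE z in ?Z. (cmod (F z))\<^sup>2 = 0"
    using Fi by (subst (asm) integral_nonneg_eq_0_iff_AE) auto
  then have "AE z in ?Z. F z = 0" by eventually_elim simp
  then show False using nz by (simp add: nonzero_fun_def)
qed

end

section \<open>Freeness and non-ergodic directions\<close>

lemma weak_mixing_imp_ergodic: "weak_mixing_on H M T \<Longrightarrow> ergodic_on H M T"
  unfolding weak_mixing_on_def ergodic_on_def
proof (intro allI impI)
  fix f assume wm: "\<forall>f. eigenfunction_on H M T f \<longrightarrow> ae_constant M f" and f: "invariant_function_on H M T f"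
  have "character_on H (\<lambda>_. 1)" by (simp add: character_on_def)
  then have "eigenfunction_on H M T f"
    using f unfolding eigenfunction_on_def invariant_function_on_def by (auto intro!: exI[of _ "\<lambda>_. 1"])
  then show "ae_constant M f" using wm by blast
qed

text \<open>An atom would have an infinite orbit of points of at least the same mass.\<close>

lemma free_action_nonatomic:
  fixes T :: "real^'d \<Rightarrow> 'x \<Rightarrow> 'x"
  assumes M: "prob_space M"
    and T: "\<And>g. T g \<in> M \<rightarrow>\<^sub>M M" "\<And>g. distr M M (T g) = M"
    and add: "\<And>g h x. x \<in> space M \<Longrightarrow> T (g + h) x = T g (T h x)"
    and T0: "\<And>x. x \<in> space M \<Longrightarrow> T 0 x = x"
    and free: "AE x in M. \<forall>g. T g x = x \<longrightarrow> g = 0"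
    and s: "\<And>y. y \<in> space M \<Longrightarrow> {y} \<in> sets M" and y: "y \<in> space M"
  shows "emeasure M {y} = 0"
proof (rule ccontr)
  interpret prob_space M by fact
  assume "emeasure M {y} \<noteq> 0"
  then have p: "measure M {y} > 0" by (simp add: emeasure_eq_measure zero_less_measure_iff)
  have fy: "g = 0" if "T g y = y" for g
  proof (rule ccontr)
    assume "g \<noteq> 0"
    from free obtain N where N: "{x \<in> space M. \<not> (\<forall>g. T g x = x \<longrightarrow> g = 0)} \<subseteq> N" "emeasure M N = 0" "N \<in> sets M"
      by (auto elim: AE_E)
    have "{y} \<subseteq> N" using N(1) y that \<open>g \<noteq> 0\<close> by auto
    then have "emeasure M {y} \<le> emeasure M N" using N(3) by (rule emeasure_mono)
    then show False using N(2) \<open>emeasure M {y} \<noteq> 0\<close> by simp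
  qed
  obtain v :: "real^'d" where v: "v \<noteq> 0" using nonempty_Basis nonzero_Basis by (metis all_not_in_conv)
  \<comment> \<open>Infinitely many distinct points, each of them at least as heavy as \<^term>\<open>y\<close>.\<close>
  define Y where "Y = (\<lambda>k::nat. T (real k *\<^sub>R v) y)"
  have sp: "Y k \<in> space M" for k unfolding Y_def using measurable_space[OF T(1) y] .
  have "inj Y"
  proof (rule injI)
    fix j k assume e: "Y j = Y k"
    have "T (- (real k *\<^sub>R v) + real j *\<^sub>R v) y = T (- (real k *\<^sub>R v) + real k *\<^sub>R v) y"
      unfolding add[OF y] using e by (simp add: Y_def)
    then have "- (real k *\<^sub>R v) + real j *\<^sub>R v = 0" using T0[OF y] by (intro fy) simp
    then have "(real j - real k) *\<^sub>R v = 0" by (simp add: algebra_simps)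
    then show "j = k" using v by simp
  qed
  have ge: "measure M {Y k} \<ge> measure M {y}" for k
  proof -
    have "measure M {Y k} = measure (distr M M (T (real k *\<^sub>R v))) {Y k}" by (simp add: T(2))
    also have "\<dots> = measure M (T (real k *\<^sub>R v) -` {Y k} \<inter> space M)"
      by (rule measure_distr[OF T(1) s[OF sp]])
    also have "\<dots> \<ge> measure M {y}"
      by (rule finite_measure_mono) (use y measurable_sets[OF T(1) s[OF sp]] in \<open>auto simp: Y_def\<close>)
    finally show ?thesis .
  qed
  have b: "real N * measure M {y} \<le> 1" for N
  proof -
    have "real N * measure M {y} = (\<Sum>k<N. measure M {y})" by simp
    also have "\<dots> \<le> (\<Sum>k<N. measure M {Y k})" by (intro sum_mono ge)
    also have "\<dots> = (\<Sum>z\<in>Y ` {..<N}. measure M {z})"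
      using \<open>inj Y\<close> by (subst sum.reindex) (auto intro: inj_on_subset)
    also have "\<dots> = measure M (Y ` {..<N})"
      by (rule finite_measure_eq_sum_singleton[symmetric]) (use sp s in auto)
    also have "\<dots> \<le> 1" by (rule prob_le_1)
    finally show ?thesis .
  qed
  obtain N :: nat where "real N * measure M {y} > 1" using reals_Archimedean3[OF p] by blast
  then show False using b[of N] by simp
qed

context poisson_system
begin

text \<open>That one particular bounded box of layer \<open>n\<close> is empty; any box of finite positive intensity would do.\<close>

definition layer_event :: "nat \<Rightarrow> 'x set" where
  "layer_event n = V ({n} \<times> ball 0 1 \<times> {0<..<1})"

lemma open_layer: "open A \<Longrightarrow> open ({n::nat} \<times> A)"
  by (intro open_Times discrete_topology_class.open_discrete)

lemma layer_event_sets[measurable]: "layer_event n \<in> sets M"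
  unfolding layer_event_def by (intro V_sets open_layer open_Times) auto

lemma layer_event_prob: "0 < measure M (layer_event n)" "measure M (layer_event n) < 1"
proof -
  have o: "open ({n} \<times> ball (0::real^'d) 1 \<times> {0<..<1::real})" by (intro open_layer open_Times) auto
  have "intensity ({n} \<times> ball (0::real^'d) 1 \<times> {0<..<1::real}) = ennreal (measure lborel (ball (0::real^'d) 1))"
  proof -
    have "emeasure lborel (ball (0::real^'d) 1) = ennreal (measure lborel (ball (0::real^'d) 1))"
      using emeasure_lborel_ball_finite[of "0::real^'d" 1] by (intro emeasure_eq_ennreal_measure) auto
    moreover have "emeasure lborel {0<..<1::real} = 1" by simp
    moreover have "intensity ({n} \<times> ball (0::real^'d) 1 \<times> {0<..<1::real})
        = emeasure lborel (ball (0::real^'d) 1) * emeasure lborel {0<..<1::real}"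
      unfolding intensity_layer by (rule lborel_Times) auto
    ultimately show ?thesis by simp
  qed
  then have "measure M (layer_event n) = exp (- measure lborel (ball (0::real^'d) 1))"
    unfolding layer_event_def measure_V[OF o] by simp
  then show "0 < measure M (layer_event n)" "measure M (layer_event n) < 1"
    using content_ball_pos[of 1 "0::real^'d"] by simp_all
qed

text \<open>A vector in the kernel of \<open>Q n\<close> fixes layer \<open>n\<close> pointwise.\<close>

lemma T_layer_event:
  assumes "Q n g = 0" "x \<in> space M"
  shows "T g x \<in> layer_event n \<longleftrightarrow> x \<in> layer_event n"
proof -
  have "layer_shift Q g -` ({n} \<times> A) = {n} \<times> A" for A :: "((real^'d) \<times> real) set"
    using assms(1) by (auto simp: layer_shift_def)
  then show ?thesis unfolding layer_event_def T_in_V[OF assms(2)] by simp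
qed

lemma not_ergodic_R:
  assumes L: "\<And>g. g \<in> L \<Longrightarrow> Q n g = 0"
  shows "\<not> ergodic_on L M T"
proof
  assume e: "ergodic_on L M T"
  define f where "f = (indicator (layer_event n) :: 'x \<Rightarrow> complex)"
  have "f \<in> L2 M" unfolding L2_def f_def
    by (auto intro!: integrable_const_bound[of _ 1] simp: indicator_def)
  moreover have "nonzero_fun M f" unfolding nonzero_fun_def
  proof
    assume "AE x in M. f x = 0"
    then have "AE x in M. x \<notin> layer_event n" by eventually_elim (simp add: f_def indicator_def split: if_splits)
    then have "measure M (layer_event n) = 0" by (subst prob_eq_0) auto
    then show False using layer_event_prob[of n] by simp
  qed
  moreover have "\<forall>g\<in>L. AE x in M. f (T g x) = f x"
    using T_layer_event[OF L] by (auto simp: f_def indicator_def)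
  ultimately have "ae_constant M f" using e by (simp add: ergodic_on_def invariant_function_on_def)
  then obtain c where c: "AE x in M. f x = c" by (auto simp: ae_constant_def)
  show False
  proof (cases "c = 1")
    case True
    have "AE x in M. x \<in> layer_event n" using c by eventually_elim (use True in \<open>simp add: f_def indicator_def split: if_splits\<close>)
    then have "measure M (layer_event n) = 1" by (subst prob_eq_1) auto
    then show False using layer_event_prob[of n] by simp
  next
    case False
    have "AE x in M. x \<notin> layer_event n" using c by eventually_elim (use False in \<open>auto simp: f_def\<close>)
    then have "measure M (layer_event n) = 0" by (subst prob_eq_0) auto
    then show False using layer_event_prob[of n] by simp
  qed
qed

text \<open>The event on layer \<open>n\<close>, centred, is a function on the base that \<open>T t\<close> preserves for real \<open>t\<close> in \<open>L\<close>. It is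
  transported to the suspension by the conjugacy with \<open>T\<close> times a rotation; integrating over the base
  first gives zero, whence the orthogonality.\<close>

lemma direction_invariant_perp:
  assumes L: "\<And>g. g \<in> L \<Longrightarrow> Q n g = 0"
  shows "\<exists>F\<in>L2_perp M. direction_invariant M (\<lambda>g. T (of_int_vec g)) L F"
proof -
  define p where "p = measure M (layer_event n)"
  define h where "h = (\<lambda>x. complex_of_real (indicator (layer_event n) x - p))"
  \<comment> \<open>Precomposing with \<^term>\<open>T r\<close> turns the suspension flow into \<^term>\<open>T\<close> times the rotation of the torus.\<close>
  define F where "F = (\<lambda>(x, r). h (T r x))"
  let ?Y = "unit_cube :: (real^'d) measure"
  let ?Z = "M \<Otimes>\<^sub>M ?Y"
  interpret Y: prob_space ?Y by (rule prob_space_unit_cube)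
  interpret MY: pair_sigma_finite M ?Y ..
  have pZ: "prob_space ?Z" by (rule prob_space_pair[OF prob_M prob_space_unit_cube])
  interpret Z: prob_space ?Z by fact
  have hm[measurable]: "h \<in> borel_measurable M" unfolding h_def by measurable
  have h1: "cmod (h x) \<le> 1" for x
    using layer_event_prob[of n] unfolding h_def norm_of_real by (auto simp: indicator_def p_def)
  have idc: "(\<lambda>r. r) \<in> ?Y \<rightarrow>\<^sub>M borel" unfolding unit_cube_def by (intro measurable_restrict_space1) simp
  have T': "(\<lambda>z. T (snd z) (fst z)) \<in> ?Z \<rightarrow>\<^sub>M M"
  proof -
    have "(\<lambda>z. (snd z, fst z)) \<in> ?Z \<rightarrow>\<^sub>M borel \<Otimes>\<^sub>M M"
      by (intro measurable_Pair measurable_compose[OF measurable_snd idc]) measurable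
    from measurable_comp[OF this T_meas] show ?thesis by (simp add: comp_def)
  qed
  have Fm[measurable]: "F \<in> borel_measurable ?Z"
    unfolding F_def split_beta' by (rule measurable_compose[OF T' hm])
  have F1: "cmod (F z) \<le> 1" for z by (simp add: F_def split_beta' h1)
  have "integrable ?Z (\<lambda>z. (cmod (F z))\<^sup>2)"
    by (rule Z.integrable_const_bound[of _ 1]) (use F1 in \<open>auto simp: power_le_one\<close>)
  then have F2: "F \<in> L2 ?Z" using Fm by (simp add: L2_def)
  have tr: "(\<integral>x. u (T r x) \<partial>M) = (\<integral>x. u x \<partial>M)" if "u \<in> borel_measurable M" for u :: "'x \<Rightarrow> 'b::{banach,second_countable_topology}" and r
    using integral_distr[OF T_g that, of r] T_mp by simp
  have h0: "(\<integral>x. h x \<partial>M) = 0"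
  proof -
    have "(\<integral>x. indicator (layer_event n) x - p \<partial>M) = 0"
      by (subst Bochner_Integration.integral_diff) (auto simp: p_def prob_space emeasure_eq_measure)
    then show ?thesis unfolding h_def integral_complex_of_real by simp
  qed
  have perp: "F \<in> L2_perp M" unfolding L2_perp_def suspension_space_def
  proof (intro CollectI conjI F2 ballI)
    fix G :: "'x \<times> (real^'d) \<Rightarrow> complex" assume "G \<in> L2_base"
    then obtain f where f: "f \<in> L2 ?Y" "G = (\<lambda>(x, s). f s)" by (auto simp: L2_base_def)
    have fm[measurable]: "f \<in> borel_measurable ?Y" and fi: "integrable ?Y (\<lambda>r. (cmod (f r))\<^sup>2)" using f by (auto simp: L2_def)
    have [measurable]: "cnj \<in> borel_measurable borel" by (intro borel_measurable_continuous_onI continuous_intros)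
    have ds: "distr ?Z ?Y snd = ?Y" using prob_M prob_space_unit_cube by (rule distr_snd_pair)
    have "integrable ?Z (\<lambda>z. 1 + (cmod (f (snd z)))\<^sup>2)"
      using integrable_distr[of snd ?Z ?Y "\<lambda>r. (cmod (f r))\<^sup>2"] fi ds by simp
    then have i: "integrable ?Z (\<lambda>(x, r). h (T r x) * cnj (f r))"
    proof (rule Bochner_Integration.integrable_bound)
      have "(\<lambda>z. F z * cnj (f (snd z))) \<in> borel_measurable ?Z" by measurable
      then show "(\<lambda>(x, r). h (T r x) * cnj (f r)) \<in> borel_measurable ?Z" by (simp add: F_def split_beta')
      have "cmod a * cmod b \<le> 1 + (cmod b)\<^sup>2" if "cmod a \<le> 1" for a b :: complex
      proof -
        have "cmod a * cmod b \<le> 1 * cmod b" using that by (intro mult_right_mono) auto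
        also have "\<dots> \<le> 1 + (cmod b)\<^sup>2"
        proof -
          have "2 * cmod b \<le> 1 + (cmod b)\<^sup>2" using sum_squares_bound[of 1 "cmod b"] by simp
          then show ?thesis using norm_ge_zero[of b] by linarith
        qed
        finally show ?thesis .
      qed
      then show "AE z in ?Z. cmod (case z of (x, r) \<Rightarrow> h (T r x) * cnj (f r)) \<le> norm (1 + (cmod (f (snd z)))\<^sup>2)"
        using h1 by (intro AE_I2) (auto simp: split_beta' norm_mult)
    qed
    have "(\<integral>z. F z * cnj (G z) \<partial>?Z) = (\<integral>r. (\<integral>x. h (T r x) * cnj (f r) \<partial>M) \<partial>?Y)"
      unfolding MY.integral_snd[OF i] by (simp add: F_def f(2) split_beta')
    also have "\<dots> = (\<integral>r. 0 \<partial>?Y)"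
    proof (rule Bochner_Integration.integral_cong[OF refl])
      fix r
      have "(\<integral>x. h (T r x) * cnj (f r) \<partial>M) = (\<integral>x. h (T r x) \<partial>M) * cnj (f r)" by simp
      also have "(\<integral>x. h (T r x) \<partial>M) = 0" using tr[OF hm] h0 by simp
      finally show "(\<integral>x. h (T r x) * cnj (f r) \<partial>M) = 0" by simp
    qed
    finally show "(\<integral>z. F z * cnj (G z) \<partial>?Z) = 0" by simp
  qed
  have nz: "nonzero_fun ?Z F" unfolding nonzero_fun_def
  proof
    assume "AE z in ?Z. F z = 0"
    then have "AE z in ?Z. False"
    proof eventually_elim
      case (elim z)
      then show ?case using layer_event_prob[of n]
        by (auto simp: F_def h_def p_def indicator_def of_bool_def split_beta' split: if_splits)
    qed
    then show False by simp
  qed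
  have inv: "AE y in ?Z. F (suspension (\<lambda>g. T (of_int_vec g)) t y) = F y" if t: "t \<in> L" for t
  proof (rule AE_I2)
    fix y assume "y \<in> space ?Z"
    then obtain x r where y: "y = (x, r)" "x \<in> space M" by (auto simp: space_pair_measure)
    let ?n = "of_int_vec (vec_floor (t + r))"
    have "T (vec_frac (t + r)) (T ?n x) = T (vec_frac (t + r) + ?n) x" by (rule T_add[OF y(2), symmetric])
    also have "vec_frac (t + r) + ?n = t + r" using floor_plus_frac[of "t + r"] by (simp add: add.commute)
    also have "T (t + r) x = T t (T r x)" by (rule T_add[OF y(2)])
    finally have "T (vec_frac (t + r)) (T ?n x) = T t (T r x)" .
    then show "F (suspension (\<lambda>g. T (of_int_vec g)) t y) = F y"
      using T_layer_event[OF L[OF t] T_space[OF y(2), of r]]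
      by (simp add: F_def suspension_def y(1) h_def indicator_def)
  qed
  have "direction_invariant M (\<lambda>g. T (of_int_vec g)) L F"
    unfolding direction_invariant_def suspension_space_def using F2 nz inv by blast
  then show ?thesis using perp by blast
qed

lemma measure_two_hits:
  assumes U: "open U" "intensity U = ennreal a" "0 \<le> a" and W: "open W" "intensity W = ennreal b" "0 \<le> b" and d: "U \<inter> W = {}"
  shows "measure M ((space M - V U) \<inter> (space M - V W)) \<le> a * b"
proof -
  have Vm: "V U \<in> sets M" "V W \<in> sets M" using V_sets U W by auto
  have mU: "measure M (V U) = exp (- a)" "measure M (V W) = exp (- b)"
    using U W by (simp_all add: measure_V)
  have "(space M - V U) \<inter> (space M - V W) = space M - (V U \<union> V W)" by auto
  then have "measure M ((space M - V U) \<inter> (space M - V W)) = 1 - measure M (V U \<union> V W)"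
    using Vm by (simp add: prob_compl)
  also have "measure M (V U \<union> V W) = measure M (V U) + measure M (V W - V U)"
    using Vm finite_measure_Union[of "V U" "V W - V U"] by simp
  also have "measure M (V W - V U) = measure M (V W) - measure M (V W \<inter> V U)"
    using Vm by (intro finite_measure_Diff') auto
  also have "measure M (V W \<inter> V U) = exp (- a) * exp (- b)"
    using measure_V_Un[OF U(1) W(1) d] mU by (simp add: V_Int Un_commute)
  also have "1 - (measure M (V U) + (measure M (V W) - exp (- a) * exp (- b))) = (1 - exp (- a)) * (1 - exp (- b))"
    using mU by (simp add: algebra_simps)
  also have "\<dots> \<le> a * b"
    using U(3) W(3) exp_ge_add_one_self[of "- a"] exp_ge_add_one_self[of "- b"]
    by (intro mult_mono) auto
  finally show ?thesis .
qed

text \<open>Splitting the marks into about \<open>N\<close> intervals of length of order \<open>1 / N\<close>, the probability that both sets are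
  hit with marks in a common interval is of order \<open>N * (1 / N)\<^sup>2\<close>.\<close>

lemma marks_distinct:
  assumes A: "open A" "bounded A" and B: "open B" "bounded B" and d: "A \<inter> B = {}"
  shows "AE x in M. \<not> (\<exists>u\<in>{0<..<1}. \<exists>p\<in>A. \<exists>q\<in>B. (0, p, u) \<in> D x \<and> (0, q, u) \<in> D x)"
proof -
  define \<alpha> \<beta> where "\<alpha> = measure lborel A" and "\<beta> = measure lborel B"
  have fin: "emeasure lborel A = ennreal \<alpha>" "emeasure lborel B = ennreal \<beta>"
    using emeasure_bounded_finite[OF A(2)] emeasure_bounded_finite[OF B(2)]
    by (auto simp: \<alpha>_def \<beta>_def emeasure_eq_ennreal_measure)
  \<comment> \<open>Overlapping intervals, so that they are open and still cover the marks in the unit interval.\<close>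
  define J where "J = (\<lambda>N i. {(real i - 1) / real (Suc N)<..<(real i + 1) / real (Suc N)})"
  define H where "H = (\<lambda>C N i. space M - V ({0} \<times> C \<times> J N i))"
  define E where "E = (\<lambda>N. \<Union>i\<le>Suc N. H A N i \<inter> H B N i)"
  have oJ: "open (J N i)" for N i by (simp add: J_def)
  have Hm: "H C N i \<in> sets M" if "open C" for C N i
    unfolding H_def using that oJ by (intro sets.Diff sets.top V_sets open_layer open_Times)
  have Em: "E N \<in> sets M" for N unfolding E_def using Hm A B by (intro sets.countable_UN'') auto
  have mE: "measure M (E N) \<le> 8 * \<alpha> * \<beta> / real (Suc N)" for N
  proof -
    have lJ: "emeasure lborel (J N i) = ennreal (2 / real (Suc N))" for i
      unfolding J_def by (subst emeasure_lborel_Ioo)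
        (simp_all add: diff_divide_distrib[symmetric] divide_right_mono del: of_nat_Suc)
    have one: "measure M (H A N i \<inter> H B N i) \<le> (\<alpha> * (2 / real (Suc N))) * (\<beta> * (2 / real (Suc N)))" for i
      unfolding H_def
    proof (rule measure_two_hits)
      show "intensity ({0} \<times> A \<times> J N i) = ennreal (\<alpha> * (2 / real (Suc N)))"
        "intensity ({0} \<times> B \<times> J N i) = ennreal (\<beta> * (2 / real (Suc N)))"
        by (simp_all add: intensity_layer lborel_Times A B oJ fin lJ \<alpha>_def \<beta>_def ennreal_mult''[symmetric] del: of_nat_Suc)
    qed (use A B oJ d in \<open>auto simp: \<alpha>_def \<beta>_def intro!: open_layer open_Times\<close>)
    have "measure M (E N) \<le> (\<Sum>i\<le>Suc N. measure M (H A N i \<inter> H B N i))"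
      unfolding E_def using Hm A B by (intro finite_measure_subadditive_finite) auto
    also have "\<dots> \<le> (\<Sum>i\<le>Suc N. (\<alpha> * (2 / real (Suc N))) * (\<beta> * (2 / real (Suc N))))"
      by (intro sum_mono one)
    also have "\<dots> = real (N + 2) * ((\<alpha> * (2 / real (Suc N))) * (\<beta> * (2 / real (Suc N))))" by simp
    also have "\<dots> \<le> (2 * real (Suc N)) * ((\<alpha> * (2 / real (Suc N))) * (\<beta> * (2 / real (Suc N))))"
      by (intro mult_right_mono) (auto simp: \<alpha>_def \<beta>_def)
    also have "\<dots> = 8 * \<alpha> * \<beta> / real (Suc N)"
    proof -
      have e: "(2 * c) * ((\<alpha> * (2 / c)) * (\<beta> * (2 / c))) = 8 * \<alpha> * \<beta> / c" if "c > 0" for c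
        using that by (simp add: field_simps)
      show ?thesis by (rule e) simp
    qed
    finally show ?thesis .
  qed
  have "(\<Inter>N. E N) \<in> sets M" using Em by auto
  moreover have "measure M (\<Inter>N. E N) = 0"
  proof -
    have "measure M (\<Inter>N. E N) \<le> 8 * \<alpha> * \<beta> / real (Suc N)" for N
      by (rule order_trans[OF finite_measure_mono mE[of N]]) (use Em in auto)
    moreover have "(\<lambda>N. 8 * \<alpha> * \<beta> / real (Suc N)) \<longlonglongrightarrow> 0"
      using LIMSEQ_Suc[OF lim_const_over_n] by simp
    ultimately have "measure M (\<Inter>N. E N) \<le> 0" by (intro LIMSEQ_le_const) auto
    then show ?thesis by (simp add: measure_le_0_iff)
  qed
  ultimately have "(\<Inter>N. E N) \<in> null_sets M" by (simp add: emeasure_eq_measure null_sets_def)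
  then have "AE x in M. x \<notin> (\<Inter>N. E N)" by (rule AE_not_in)
  then show ?thesis
  proof (rule AE_mp, intro AE_I2 impI notI)
    fix x assume x: "x \<in> space M" and nE: "x \<notin> (\<Inter>N. E N)"
      and ex: "\<exists>u\<in>{0<..<1}. \<exists>p\<in>A. \<exists>q\<in>B. (0, p, u) \<in> D x \<and> (0, q, u) \<in> D x"
    from ex obtain u p q where u: "0 < u" "u < 1" "p \<in> A" "q \<in> B" "(0, p, u) \<in> D x" "(0, q, u) \<in> D x" by auto
    have "x \<in> E N" for N
    proof -
      define i where "i = nat \<lfloor>u * real (Suc N)\<rfloor>"
      have i1: "real i \<le> u * real (Suc N)" "u * real (Suc N) < real i + 1"
        using u by (simp_all add: i_def del: of_nat_Suc)
      have "u * real (Suc N) < 1 * real (Suc N)" using u by (intro mult_strict_right_mono) auto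
      with i1(1) have "real i < 1 * real (Suc N)" by (rule order_le_less_trans)
      then have "real i < real (Suc N)" by (simp only: mult_1_left)
      then have i: "i \<le> Suc N" by simp
      have "u \<in> J N i" using i1 unfolding J_def by (auto simp: pos_divide_less_eq pos_less_divide_eq)
      then have "(0, p, u) \<in> D x \<inter> {0} \<times> A \<times> J N i" "(0, q, u) \<in> D x \<inter> {0} \<times> B \<times> J N i"
        using u by blast+
      then have "x \<in> H A N i" "x \<in> H B N i" using x unfolding H_def void_event_def by blast+
      then show ?thesis using i by (auto simp: E_def)
    qed
    then show False using nE by simp
  qed
qed

text \<open>A configuration fixed by \<open>g\<close> contains with each point of layer 0 its translate, which carries the same
  mark. Almost surely layer 0 is nonempty and distinct positions in it carry distinct marks.\<close>

lemma free:
  assumes Q0: "\<And>g. Q 0 g = 0 \<Longrightarrow> g = 0"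
  shows "AE x in M. \<forall>g. T g x = x \<longrightarrow> g = 0"
proof -
  let ?b = "basic_open :: nat \<Rightarrow> (real^'d) set"
  have "AE x in M. \<forall>j k. bounded (?b j) \<and> bounded (?b k) \<and> ?b j \<inter> ?b k = {} \<longrightarrow>
      \<not> (\<exists>u\<in>{0<..<1}. \<exists>p\<in>?b j. \<exists>q\<in>?b k. (0, p, u) \<in> D x \<and> (0, q, u) \<in> D x)"
    unfolding AE_all_countable
  proof (intro allI)
    fix j k
    show "AE x in M. bounded (?b j) \<and> bounded (?b k) \<and> ?b j \<inter> ?b k = {} \<longrightarrow>
      \<not> (\<exists>u\<in>{0<..<1}. \<exists>p\<in>?b j. \<exists>q\<in>?b k. (0, p, u) \<in> D x \<and> (0, q, u) \<in> D x)"
    proof (cases "bounded (?b j) \<and> bounded (?b k) \<and> ?b j \<inter> ?b k = {}")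
      case True
      then have "AE x in M. \<not> (\<exists>u\<in>{0<..<1}. \<exists>p\<in>?b j. \<exists>q\<in>?b k. (0, p, u) \<in> D x \<and> (0, q, u) \<in> D x)"
        by (intro marks_distinct open_basic_open) auto
      then show ?thesis by eventually_elim blast
    next
      case False
      then show ?thesis by (intro AE_I2) blast
    qed
  qed
  moreover have "AE x in M. x \<notin> V ({0} \<times> UNIV \<times> {0<..<1})"
  proof (rule AE_not_in)
    have o: "open ({0::nat} \<times> (UNIV :: (real^'d) set) \<times> {0<..<1::real})" by (intro open_layer open_Times) auto
    have "intensity ({0} \<times> (UNIV :: (real^'d) set) \<times> {0<..<1::real}) = \<infinity>"
      by (simp add: intensity_layer lborel_Times ennreal_top_mult)
    then show "V ({0} \<times> UNIV \<times> {0<..<1}) \<in> null_sets M"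
      using measure_V[OF o] V_sets[OF o] by (simp add: null_sets_def emeasure_eq_measure)
  qed
  ultimately show ?thesis using AE_space
  proof eventually_elim
    case (elim x)
    show ?case
    proof (intro allI impI, rule ccontr)
      fix g assume g: "T g x = x" and "g \<noteq> 0"
      then have Qg: "Q 0 g \<noteq> 0" using Q0 by blast
      obtain p u where pu: "(0, p, u) \<in> D x" "0 < u" "u < 1"
        using elim(2,3) by (auto simp: void_event_def)
      define q where "q = p + Q 0 g"
      have "layer_shift Q g (0, p, u) \<in> D (T g x)" using pu(1) elim(3) by (auto simp: D_T)
      then have q: "(0, q, u) \<in> D x" using g by (simp add: layer_shift_def q_def)
      define e where "e = dist p q / 2"
      have e: "0 < e" using Qg by (simp add: e_def q_def)
      obtain j where j: "p \<in> ?b j" "?b j \<subseteq> ball p e" using basic_open_cover[of "ball p e" p] e by auto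
      obtain k where k: "q \<in> ?b k" "?b k \<subseteq> ball q e" using basic_open_cover[of "ball q e" q] e by auto
      have "ball p e \<inter> ball q e = {}" by (rule disjoint_ballI) (simp add: e_def)
      then have "bounded (?b j) \<and> bounded (?b k) \<and> ?b j \<inter> ?b k = {}"
        using j k bounded_subset[OF bounded_ball] by blast
      then show False using elim(1) pu q j(1) k(1) by fastforce
    qed
  qed
qed

end

section \<open>Construction and conclusion\<close>

lemma closed_shift:
  assumes "\<And>n. linear (Q n)" and A: "closed A"
  shows "closed (layer_shift Q g ` A)"
proof -
  have i: "layer_shift Q g (layer_shift Q (- g) z) = z" "layer_shift Q (- g) (layer_shift Q g z) = z" for z
    using assms(1) by (cases z; simp add: layer_shift_def linear_neg)+
  have "- (layer_shift Q g ` A) = layer_shift Q (- g) -` (- A)"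
  proof (intro set_eqI iffI)
    fix z assume z: "z \<in> - (layer_shift Q g ` A)"
    have "layer_shift Q (- g) z \<notin> A"
    proof
      assume "layer_shift Q (- g) z \<in> A"
      then have "layer_shift Q g (layer_shift Q (- g) z) \<in> layer_shift Q g ` A" by (rule imageI)
      then have "z \<in> layer_shift Q g ` A" by (simp only: i(1))
      then show False using z by blast
    qed
    then show "z \<in> layer_shift Q (- g) -` (- A)" by simp
  next
    fix z assume "z \<in> layer_shift Q (- g) -` (- A)"
    then show "z \<in> - (layer_shift Q g ` A)" using i(2) by auto
  qed
  moreover have "open (layer_shift Q (- g) -` (- A))" using assms by (intro open_shift_vimage) auto
  ultimately show ?thesis by (simp add: closed_def)
qed

text \<open>Superposition of the clouds of all layers; the total intensity is the sum of their intensities.\<close>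

lemma poisson_random_set:
  shows "\<exists>(P :: (nat \<Rightarrow> real \<times> (nat \<Rightarrow> (real^'d) \<times> real)) measure) cfg.
    prob_space P \<and> sets P = sets borel \<and>
    (\<forall>U :: (nat \<times> (real^'d) \<times> real) set. open U \<longrightarrow> {w. cfg w \<inter> U = {}} \<in> sets borel \<and>
      measure P {w. cfg w \<inter> U = {}} = (if intensity U = \<infinity> then 0 else exp (- enn2real (intensity U))))"
proof -
  obtain A :: "nat \<Rightarrow> ((real^'d) \<times> real) set" where A: "range A \<subseteq> sets lborel" "(\<Union>i. A i) = space lborel"
    "\<And>i. emeasure lborel (A i) \<noteq> \<infinity>" "disjoint_family A"
    using lborel.sigma_finite_disjoint by blast
  have Am: "A i \<in> sets lborel" for i using A(1) by auto
  \<comment> \<open>One Poisson cloud of finite intensity for each layer and each piece of a countable partition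
    of the layer.\<close>
  define \<nu> where "\<nu> = (\<lambda>j. density lborel (indicator (A (snd (prod_decode j)))) :: ((real^'d) \<times> real) measure)"
  have \<nu>s: "sets (\<nu> j) = sets borel" for j by (simp add: \<nu>_def)
  have \<nu>e: "emeasure (\<nu> j) U = emeasure lborel (A (snd (prod_decode j)) \<inter> U)" if "U \<in> sets borel" for j U
    unfolding \<nu>_def using Am that by (intro emeasure_restricted) auto
  have \<nu>f: "finite_measure (\<nu> j)" for j
  proof (rule finite_measureI)
    have sp: "space (\<nu> j) = UNIV" by (simp add: \<nu>_def)
    show "emeasure (\<nu> j) (space (\<nu> j)) \<noteq> \<infinity>" unfolding sp using A(3) by (subst \<nu>e) auto
  qed
  from poisson_process_exists[of \<nu>, OF \<nu>f \<nu>s]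
  obtain P :: "(nat \<Rightarrow> real \<times> (nat \<Rightarrow> (real^'d) \<times> real)) measure" where P: "prob_space P" "sets P = sets borel"
    and void: "\<forall>U. (\<forall>j. U j \<in> sets borel) \<longrightarrow> {w. \<forall>j i. real i < fst (w j) \<longrightarrow> snd (w j) i \<notin> U j} \<in> sets borel \<and>
      (\<lambda>n. exp (- (\<Sum>j<n. measure (\<nu> j) (U j)))) \<longlonglongrightarrow>
        measure P {w. \<forall>j i. real i < fst (w j) \<longrightarrow> snd (w j) i \<notin> U j}"
    by (elim exE conjE)
  define cfg where "cfg = (\<lambda>w :: nat \<Rightarrow> real \<times> (nat \<Rightarrow> (real^'d) \<times> real).
    {(fst (prod_decode j), snd (w j) i) | j i. real i < fst (w j)})"
  have "{w. cfg w \<inter> U = {}} \<in> sets borel \<and>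
      measure P {w. cfg w \<inter> U = {}} = (if intensity U = \<infinity> then 0 else exp (- enn2real (intensity U)))"
    if U: "open U" for U :: "(nat \<times> (real^'d) \<times> real) set"
  proof -
    define W where "W = (\<lambda>j. Pair (fst (prod_decode j)) -` U)"
    have Wb: "W j \<in> sets borel" for j unfolding W_def using slice_borel[OF U] by simp
    have eq: "{w. cfg w \<inter> U = {}} = {w. \<forall>j i. real i < fst (w j) \<longrightarrow> snd (w j) i \<notin> W j}"
      unfolding cfg_def W_def by blast
    have sum: "(\<Sum>j. emeasure (\<nu> j) (W j)) = intensity U"
    proof -
      have "(\<Sum>j. emeasure (\<nu> j) (W j)) = (\<Sum>j. (\<lambda>(n, i). emeasure lborel (A i \<inter> Pair n -` U)) (prod_decode j))"
        using \<nu>e[OF Wb] by (simp add: W_def split_beta')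
      also have "\<dots> = (\<Sum>n. emeasure lborel (Pair n -` U))"
      proof (rule suminf_ennreal_2dimen)
        fix n
        have "(\<Sum>i. emeasure lborel (A i \<inter> Pair n -` U)) = emeasure lborel (\<Union>i. A i \<inter> Pair n -` U)"
        proof (rule suminf_emeasure)
          show "disjoint_family (\<lambda>i. A i \<inter> Pair n -` U)"
            using A(4) unfolding disjoint_family_on_def by blast
        qed (use Am slice_borel[OF U] in auto)
        also have "(\<Union>i. A i \<inter> Pair n -` U) = Pair n -` U" using A(2) by auto
        finally show "emeasure lborel (Pair n -` U) = (\<Sum>i. case (n, i) of (n, i) \<Rightarrow> emeasure lborel (A i \<inter> Pair n -` U))"
          by simp
      qed
      finally show ?thesis by (simp add: intensity_def)
    qed
    have "(\<lambda>n. \<Sum>j<n. emeasure (\<nu> j) (W j)) \<longlonglongrightarrow> intensity U"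
      unfolding sum[symmetric] by (rule summable_LIMSEQ[OF summableI])
    moreover have "(\<Sum>j<n. emeasure (\<nu> j) (W j)) = ennreal (\<Sum>j<n. measure (\<nu> j) (W j))" for n
      by (simp add: finite_measure.emeasure_eq_measure[OF \<nu>f])
    ultimately have lim: "(\<lambda>n. ennreal (\<Sum>j<n. measure (\<nu> j) (W j))) \<longlonglongrightarrow> intensity U" by simp
    have lim2: "(\<lambda>n. exp (- (\<Sum>j<n. measure (\<nu> j) (W j)))) \<longlonglongrightarrow> (if intensity U = \<infinity> then 0 else exp (- enn2real (intensity U)))"
    proof (cases "intensity U = \<infinity>")
      case True
      then have "filterlim (\<lambda>n. \<Sum>j<n. measure (\<nu> j) (W j)) at_top sequentially"
        using lim by (simp add: ennreal_tendsto_top_eq_at_top)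
      then have "(\<lambda>n. exp (- (\<Sum>j<n. measure (\<nu> j) (W j)))) \<longlonglongrightarrow> 0"
        by (intro filterlim_compose[OF exp_at_bot] filterlim_compose[OF filterlim_uminus_at_bot_at_top])
      then show ?thesis using True by simp
    next
      case False
      then have "intensity U = ennreal (enn2real (intensity U))" by (simp add: less_top)
      then have "(\<lambda>n. ennreal (\<Sum>j<n. measure (\<nu> j) (W j))) \<longlonglongrightarrow> ennreal (enn2real (intensity U))" using lim by simp
      then have "(\<lambda>n. \<Sum>j<n. measure (\<nu> j) (W j)) \<longlonglongrightarrow> enn2real (intensity U)"
        by (rule tendsto_ennrealD) (auto intro!: always_eventually sum_nonneg)
      then have "(\<lambda>n. exp (- (\<Sum>j<n. measure (\<nu> j) (W j)))) \<longlonglongrightarrow> exp (- enn2real (intensity U))"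
        by (intro tendsto_exp tendsto_minus)
      then show ?thesis using False by simp
    qed
    note v = void[rule_format, of W, OF Wb]
    show ?thesis unfolding eq using conjunct1[OF v] LIMSEQ_unique[OF conjunct2[OF v] lim2] by (rule conjI)
  qed
  then show ?thesis using P(1,2) by blast
qed

text \<open>The random set is replaced by its closure, which does not change void events, and coded by a real
  number. The base space is the set of all codes, so that the group laws hold at every point.\<close>

lemma poisson_system_exists:
  fixes Q :: "nat \<Rightarrow> real^'d \<Rightarrow> real^'d"
  assumes Q: "\<And>n. linear (Q n)" and Q0: "\<And>g. Q 0 g = 0 \<Longrightarrow> g = 0"
  shows "\<exists>(M :: real measure) T D. poisson_system M T D Q \<and> lebesgue_prob_space M"
proof -
  from poisson_random_set[where 'd='d]
  obtain P :: "(nat \<Rightarrow> real \<times> (nat \<Rightarrow> (real^'d) \<times> real)) measure" and cfg where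
    P: "prob_space P" "sets P = sets borel" and
    c: "\<forall>U :: (nat \<times> (real^'d) \<times> real) set. open U \<longrightarrow> {w. cfg w \<inter> U = {}} \<in> sets borel \<and>
      measure P {w. cfg w \<inter> U = {}} = (if intensity U = \<infinity> then 0 else exp (- enn2real (intensity U)))"
    by (elim exE conjE)
  note cb = conjunct1[OF c[rule_format]] and cm = conjunct2[OF c[rule_format]]
  have spP: "space P = UNIV" using P(2) sets_eq_imp_space_eq by fastforce
  define X where "X = codes TYPE(nat \<times> (real^'d) \<times> real)"
  define h where "h = (\<lambda>w. encode (closure (cfg w)))"
  define M where "M = distr P (restrict_space borel X) h"
  define D where "D = (decode :: real \<Rightarrow> (nat \<times> (real^'d) \<times> real) set)"
  define T where "T = (\<lambda>g y. encode (layer_shift Q g ` D y))"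
  have hb: "h \<in> borel_measurable borel" unfolding h_def
    by (rule measurable_encode_closure) (use cb in simp)
  have hX: "range h \<subseteq> X" unfolding h_def X_def by (auto intro: encode_in_codes)
  have hM: "h \<in> P \<rightarrow>\<^sub>M restrict_space borel X"
  proof (rule measurable_restrict_space2)
    show "h \<in> borel_measurable P" using hb P(2) by (subst measurable_cong_sets[OF P(2) refl])
  qed (use hX in auto)
  have sM: "sets M = sets (restrict_space borel X)" by (simp add: M_def)
  have spM: "space M = X" by (simp add: M_def space_restrict_space)
  have cs: "closed A \<Longrightarrow> closed (layer_shift Q g ` A)" for g A by (rule closed_shift[OF Q])
  have ve: "void_event M D U = {y \<in> X. decode y \<inter> U = {}}" for U
    by (simp add: void_event_def spM D_def)
  have vs: "void_event M D U \<in> sets M" if "open U" for U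
    unfolding ve sM X_def using that by (rule void_decode_sets)
  have DT: "D (T g y) = layer_shift Q g ` D y" for g y
    unfolding D_def T_def by (rule decode_encode[OF cs[OF closed_decode]])
  have Td: "T g y = encode (layer_shift Q g ` D y)" for g y by (simp add: T_def)
  have sys: "poisson_system M T D Q"
  proof (rule poisson_system.intro)
    show "linear (Q n)" for n by (rule Q)
    show "prob_space M" unfolding M_def by (rule prob_space.prob_space_distr[OF P(1) hM])
    show "void_event M D U \<in> sets M" if "open U" for U by (rule vs[OF that])
    show "sets M = sigma_sets (space M) {void_event M D U | U. open U \<and> (\<exists>N. U \<subseteq> window N)}"
      unfolding ve spM sM unfolding X_def by (rule sets_codes_eq_sigma_sets[OF open_window UN_window])
    show "measure M (void_event M D U) = (if intensity U = \<infinity> then 0 else exp (- enn2real (intensity U)))" if U: "open U" for U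
    proof -
      have "measure M (void_event M D U) = measure P (h -` void_event M D U \<inter> space P)"
        unfolding M_def by (rule measure_distr[OF hM]) (use vs[OF U] sM in \<open>simp add: M_def\<close>)
      also have "h -` void_event M D U \<inter> space P = {w. closure (cfg w) \<inter> U = {}}"
        using hX by (auto simp: ve spP h_def decode_encode)
      also have "\<dots> = {w. cfg w \<inter> U = {}}"
        using open_Int_closure_eq_empty[OF U] by (simp add: Int_commute)
      finally show ?thesis using cm[OF U] by simp
    qed
    show "(\<lambda>(g, x). T g x) \<in> borel \<Otimes>\<^sub>M M \<rightarrow>\<^sub>M M"
      unfolding T_def D_def
      by (rule coded_action_measurable) (use open_shift[OF Q] cs sM in \<open>auto simp: X_def\<close>)
    fix x assume x: "x \<in> space M"
    then have ed: "encode (D x) = x" unfolding D_def by (intro encode_decode) (simp add: spM X_def)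
    have s0: "layer_shift Q 0 = (\<lambda>z. z)" using Q by (auto simp: layer_shift_def linear_0 fun_eq_iff)
    show "T 0 x = x" unfolding T_def s0 by (simp add: ed)
    fix g h
    have sa: "layer_shift Q (g + h) ` A = layer_shift Q g ` layer_shift Q h ` A" for A
      unfolding image_image using Q by (intro image_cong) (auto simp: layer_shift_def linear_add)
    show "T (g + h) x = T g (T h x)" unfolding Td[of "g + h" x] Td[of g "T h x"] DT sa ..
    show "D (T g x) = layer_shift Q g ` D x" by (rule DT)
  qed
  then interpret poisson_system M T D Q .
  have sing: "{y} \<in> sets M" if "y \<in> X" for y
    using that by (auto simp: sM sets_restrict_space intro!: image_eqI[of _ _ "{y}"])
  have na: "emeasure M {y} = 0" if y: "y \<in> X" for y
    by (rule free_action_nonatomic[OF prob_M T_g T_mp T_add T_0 free[OF Q0]])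
      (use sing y spM in auto)
  have "lebesgue_prob_space M" unfolding M_def
    by (rule lebesgue_prob_space_distr[OF P hb hX]) (use na in \<open>simp add: M_def\<close>)
  then show ?thesis using sys by blast
qed

text \<open>A spanning set of the orthogonal complement provides the coordinates that vanish exactly on \<open>L\<close>.\<close>

lemma linear_with_kernel:
  fixes L :: "(real^'d) set"
  assumes L: "subspace L"
  shows "\<exists>f :: real^'d \<Rightarrow> real^'d. linear f \<and> (\<forall>g. f g = 0 \<longleftrightarrow> g \<in> L)"
proof -
  obtain B where B: "B \<subseteq> L\<^sup>\<bottom>" "finite B" "L\<^sup>\<bottom> \<subseteq> span B"
    using basis_exists[of "L\<^sup>\<bottom>"] finiteI_independent by metis
  define f where "f = (\<lambda>g :: real^'d. \<Sum>b\<in>B. (b \<bullet> g) *\<^sub>R b)"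
  have lin: "linear f" unfolding f_def
    by (rule linearI) (simp_all add: inner_add_right sum.distrib scaleR_add_left scaleR_sum_right)
  have "f g = 0 \<longleftrightarrow> g \<in> L" for g
  proof
    assume "f g = 0"
    then have "g \<bullet> f g = 0" by simp
    then have "(\<Sum>b\<in>B. (b \<bullet> g)\<^sup>2) = 0"
      by (simp add: f_def inner_sum_right power2_eq_square inner_commute)
    then have b: "\<forall>b\<in>B. b \<bullet> g = 0" using B(2) by (simp add: sum_nonneg_eq_0_iff)
    have "subspace {x. x \<bullet> g = 0}" by (rule subspaceI) (auto simp: inner_add_left)
    then have "span B \<subseteq> {x. x \<bullet> g = 0}" using b by (intro span_minimal) auto
    then have "g \<in> L\<^sup>\<bottom>\<^sup>\<bottom>" using B(3) by (auto simp: orthogonal_comp_def orthogonal_def)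
    then show "g \<in> L" using orthogonal_comp_self[OF L] by simp
  next
    assume g: "g \<in> L"
    then have "b \<bullet> g = 0" if "b \<in> B" for b
      using B(1) that by (auto simp: orthogonal_comp_def orthogonal_def inner_commute)
    then show "f g = 0" by (simp add: f_def)
  qed
  then show ?thesis using lin by blast
qed

text \<open>A proper subspace is closed and nowhere dense, so the Baire category theorem applies in \<open>L\<close>.\<close>

lemma subspace_escapes_countable_union:
  fixes L :: "(real^'d) set" and \<Lambda> :: "nat \<Rightarrow> (real^'d) set"
  assumes L: "subspace L" and \<Lambda>: "\<And>n. subspace (\<Lambda> n)" "\<And>n. \<not> L \<subseteq> \<Lambda> n"
  shows "\<exists>v\<in>L. \<forall>n. v \<notin> \<Lambda> n"
proof -
  have "L \<subseteq> closure (\<Inter>n. L - \<Lambda> n)"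
  proof (rule Baire)
    show "closed L" using L by (rule closed_subspace)
    show "countable (range (\<lambda>n. L - \<Lambda> n))" by simp
    fix S assume "S \<in> range (\<lambda>n. L - \<Lambda> n)"
    then obtain n where S: "S = L - \<Lambda> n" by auto
    have "openin (top_of_set L) S"
      unfolding S using closed_subspace[OF \<Lambda>(1)[of n]] by (auto simp: openin_open Diff_eq intro!: exI[of _ "- \<Lambda> n"])
    moreover have "L \<subseteq> closure S"
    proof
      fix x assume x: "x \<in> L"
      obtain w where w: "w \<in> L" "w \<notin> \<Lambda> n" using \<Lambda>(2)[of n] by (auto simp: subset_iff)
      show "x \<in> closure S"
      proof (cases "x \<in> \<Lambda> n")
        case False
        then have "x \<in> S" using x S by simp
        then show ?thesis by (rule subsetD[OF closure_subset])
      next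
        case True
        have "x + (1 / real (Suc k)) *\<^sub>R w \<in> S" for k
        proof -
          have "x + (1 / real (Suc k)) *\<^sub>R w \<notin> \<Lambda> n"
          proof
            assume "x + (1 / real (Suc k)) *\<^sub>R w \<in> \<Lambda> n"
            then have "(x + (1 / real (Suc k)) *\<^sub>R w) - x \<in> \<Lambda> n" using True \<Lambda>(1) by (intro subspace_diff)
            then have "(1 / real (Suc k)) *\<^sub>R w \<in> \<Lambda> n" by simp
            then have "real (Suc k) *\<^sub>R ((1 / real (Suc k)) *\<^sub>R w) \<in> \<Lambda> n" by (rule subspace_scale[OF \<Lambda>(1)])
            then show False using w(2) by (simp del: of_nat_Suc)
          qed
          then show ?thesis using x w L by (auto simp: S intro: subspace_add subspace_scale)
        qed
        moreover have "(\<lambda>k. x + (1 / real (Suc k)) *\<^sub>R w) \<longlonglongrightarrow> x + 0 *\<^sub>R w"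
          by (intro tendsto_intros LIMSEQ_Suc[OF lim_1_over_n])
        ultimately show ?thesis unfolding closure_sequential
          by (intro exI[of _ "\<lambda>k. x + (1 / real (Suc k)) *\<^sub>R w"]) auto
      qed
    qed
    ultimately show "openin (top_of_set L) S \<and> L \<subseteq> closure S" by simp
  qed
  moreover have "0 \<in> L" using L by (rule subspace_0)
  ultimately have "(\<Inter>n. L - \<Lambda> n) \<noteq> {}" by (metis closure_empty empty_iff subsetD)
  then show ?thesis by blast
qed

theorem theorem5p10:
  fixes \<L> :: "(real^'d) set set"
  assumes "\<L> \<subseteq> directions"
    and "countable \<L>"
    and "concise \<L>"
    and "\<L> \<noteq> {}"
    and "UNIV \<notin> \<L>"
  shows "\<exists>(M :: real measure) (T :: real^'d \<Rightarrow> real \<Rightarrow> real)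
           (N :: real measure) (S :: int^'d \<Rightarrow> real \<Rightarrow> real).
           free_mp_action M T \<and> weak_mixing_on UNIV M T \<and>
           free_mp_action N S \<and> weak_mixing_on UNIV N S \<and>
           is_NE_R M T \<L> \<and> is_NW_R M T \<L> \<and> is_NE_Z N S \<L> \<and> is_NW_Z N S \<L>"
proof -
  have sub: "subspace L" if "L \<in> directions" for L :: "(real^'d) set"
    using that by (auto simp: directions_def directions_dim_def)
  \<comment> \<open>The zero space is added as layer 0; it makes the action free and forbids no direction of
    positive dimension.\<close>
  define \<Lambda> where "\<Lambda> = (\<lambda>n. case n of 0 \<Rightarrow> {0 :: real^'d} | Suc m \<Rightarrow> from_nat_into \<L> m)"
  have \<Lambda>S: "range (\<lambda>m. \<Lambda> (Suc m)) = \<L>"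
    using assms(2,4) by (simp add: \<Lambda>_def range_from_nat_into)
  have \<Lambda>0: "\<Lambda> 0 = {0}" by (simp add: \<Lambda>_def)
  have \<Lambda>s: "subspace (\<Lambda> n)" for n
  proof (cases n)
    case (Suc m)
    then show ?thesis using \<Lambda>S assms(1) sub by blast
  qed (simp add: \<Lambda>0)
  have "\<forall>n. \<exists>f :: real^'d \<Rightarrow> real^'d. linear f \<and> (\<forall>g. f g = 0 \<longleftrightarrow> g \<in> \<Lambda> n)"
    using linear_with_kernel[OF \<Lambda>s] by (rule allI)
  from choice[OF this] obtain Q :: "nat \<Rightarrow> real^'d \<Rightarrow> real^'d"
    where Q: "\<And>n. linear (Q n)" "\<And>n g. Q n g = 0 \<longleftrightarrow> g \<in> \<Lambda> n" by blast
  have Q0: "Q 0 g = 0 \<Longrightarrow> g = 0" for g using Q(2)[of 0 g] \<Lambda>0 by simp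
  obtain M :: "real measure" and T D where sys: "poisson_system M T D Q" and leb: "lebesgue_prob_space M"
    using poisson_system_exists[of Q, OF Q(1) Q0] by blast
  interpret poisson_system M T D Q by (rule sys)
  define S where "S = (\<lambda>g. T (of_int_vec g))"
  have fr: "AE x in M. \<forall>g. T g x = x \<longrightarrow> g = 0" by (rule free) (rule Q0)
  \<comment> \<open>A direction below no member of the family contains a vector moving all layers.\<close>
  have esc: "\<exists>v\<in>L. \<forall>n. Q n v \<noteq> 0" if L: "L \<in> directions" "1 \<le> dim L" "\<not> subordinate L \<L>" for L
  proof -
    have "\<not> L \<subseteq> \<Lambda> n" for n
    proof (cases n)
      case 0
      show ?thesis
      proof
        assume "L \<subseteq> \<Lambda> n"
        then have "dim L = 0" unfolding 0 \<Lambda>0 by (simp only: dim_eq_0)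
        then show False using L(2) by linarith
      qed
    next
      case (Suc m)
      then show ?thesis using L(3) \<Lambda>S by (auto simp: subordinate_def)
    qed
    then show ?thesis using subspace_escapes_countable_union[of L \<Lambda>, OF sub[OF L(1)] \<Lambda>s] Q(2) by blast
  qed
  have trivial: "\<exists>n. \<forall>g\<in>L. Q n g = 0" if s: "subordinate L \<L>" for L
  proof -
    obtain L' where L': "L' \<in> \<L>" "L \<subseteq> L'" using s by (auto simp: subordinate_def)
    then obtain m where "L' = \<Lambda> (Suc m)" using \<Lambda>S by blast
    then show ?thesis using Q(2) L'(2) by blast
  qed
  have dim0: "subordinate L \<L>" if L: "L \<in> directions" "\<not> 1 \<le> dim L" for L
  proof -
    have "dim L = 0" using L(2) by linarith
    then have "L \<subseteq> {0}" by (simp only: dim_eq_0)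
    moreover obtain L' where "L' \<in> \<L>" using assms(4) by blast
    moreover have "0 \<in> L'" using sub assms(1) \<open>L' \<in> \<L>\<close> subspace_0 by blast
    ultimately show ?thesis unfolding subordinate_def by blast
  qed
  have U: "UNIV \<in> (directions :: (real^'d) set set)" "1 \<le> dim (UNIV :: (real^'d) set)"
    by (auto simp: directions_def directions_dim_def Suc_le_eq)
  have nU: "\<not> subordinate UNIV \<L>" using assms(5) by (auto simp: subordinate_def top.extremum_unique)
  obtain v where v: "\<And>n. Q n v \<noteq> 0" using esc[OF U nU] by blast
  have wmT: "weak_mixing_on UNIV M T" by (rule weak_mixing_R[OF v]) auto
  have wmS: "weak_mixing_on UNIV M S" unfolding S_def by (rule weak_mixing_Z[OF v])
  have freeT: "free_mp_action M T" unfolding free_mp_action_def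
    using leb T_meas T_0 T_add T_mp fr by blast
  have S_meas: "(\<lambda>(g, x). S g x) \<in> borel \<Otimes>\<^sub>M M \<rightarrow>\<^sub>M M"
  proof -
    have "(\<lambda>z. (of_int_vec (fst z), snd z)) \<in> borel \<Otimes>\<^sub>M M \<rightarrow>\<^sub>M borel \<Otimes>\<^sub>M M"
      by (intro measurable_Pair measurable_compose[OF measurable_fst of_int_vec_borel] measurable_snd)
    from measurable_comp[OF this T_meas] show ?thesis by (simp add: S_def comp_def split_beta')
  qed
  have freeS: "free_mp_action M S" unfolding free_mp_action_def
  proof (intro conjI allI ballI)
    show "AE x in M. \<forall>g. S g x = x \<longrightarrow> g = 0"
      using fr unfolding S_def by eventually_elim (metis of_int_vec_eq_0)
  qed (use leb S_meas T_mp in \<open>auto simp: S_def of_int_vec_0 of_int_vec_add T_0 T_add\<close>)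
  have R1: "L \<in> weak_mixing_directions_R M T" if L: "L \<in> directions" "\<not> subordinate L \<L>" for L
  proof -
    have d: "1 \<le> dim L" using dim0 L by blast
    then obtain v where "v \<in> L" "\<And>n. Q n v \<noteq> 0" using esc L by blast
    then have "weak_mixing_on L M T" using weak_mixing_R sub[OF L(1)] by blast
    then show ?thesis using d L by (simp add: weak_mixing_directions_R_def)
  qed
  have R2: "L \<notin> ergodic_directions_R M T" if "subordinate L \<L>" for L
    using trivial[OF that] not_ergodic_R by (auto simp: ergodic_directions_R_def)
  have R3: "weak_mixing_directions_R M T \<subseteq> ergodic_directions_R M T"
    using weak_mixing_imp_ergodic by (auto simp: weak_mixing_directions_R_def ergodic_directions_R_def)
  have Z1: "L \<in> weak_mixing_directions_Z M S" if L: "L \<in> directions" "\<not> subordinate L \<L>" for L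
  proof -
    have d: "1 \<le> dim L" using dim0 L by blast
    then obtain v where "v \<in> L" "\<And>n. Q n v \<noteq> 0" using esc L by blast
    then have "\<not> (\<exists>F\<in>L2_perp M. direction_eigenfunction M S L F)"
      using direction_eigenfunction_not_perp sub[OF L(1)] unfolding S_def by blast
    then show ?thesis using d L by (simp add: weak_mixing_directions_Z_def)
  qed
  have Z2: "L \<notin> ergodic_directions_Z M S" if "subordinate L \<L>" for L
    using trivial[OF that] direction_invariant_perp unfolding ergodic_directions_Z_def S_def by blast
  have Z3: "weak_mixing_directions_Z M S \<subseteq> ergodic_directions_Z M S"
  proof
    fix L assume L: "L \<in> weak_mixing_directions_Z M S"
    then have Ld: "L \<in> directions" by (simp add: weak_mixing_directions_Z_def)
    have "direction_eigenfunction M S L F" if "direction_invariant M S L F" for F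
      unfolding direction_eigenfunction_def
    proof (intro conjI bexI[of _ 0])
      show "0 \<in> L" by (rule subspace_0[OF sub[OF Ld]])
    qed (use that in \<open>auto simp: direction_invariant_def\<close>)
    then show "L \<in> ergodic_directions_Z M S"
      using L by (auto simp: weak_mixing_directions_Z_def ergodic_directions_Z_def)
  qed
  have gen': "concise_generator (directions - E) \<L>"
    if "\<And>L. L \<in> directions \<Longrightarrow> \<not> subordinate L \<L> \<Longrightarrow> L \<in> E" "\<And>L. subordinate L \<L> \<Longrightarrow> L \<notin> E" for E
    unfolding concise_generator_def using assms(1,2,3) that by blast
  have "is_NE_R M T \<L>" "is_NW_R M T \<L>" "is_NE_Z M S \<L>" "is_NW_Z M S \<L>"
    unfolding is_NE_R_def is_NW_R_def is_NE_Z_def is_NW_Z_def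
    using R1 R2 R3 Z1 Z2 Z3 by (intro gen'; blast)+
  then show ?thesis using freeT wmT freeS wmS by blast
qed

end
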